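(* Let $m,n,i,j\ge 0$ be integers with $m>n$, $i>j$ and $m-n>i-j$, let $a_{m,n},a_{i,j}\in\mathbb{C}\setminus\{0\}$, and let $f(z)=a_{m,n}z^{m}\bar{z}^{n}$ and $g(z)=a_{i,j}z^{i}\bar{z}^{j}$ on $\mathbb{D}$. For integers $k\ge 0$ let \[ C_{k}:=\begin{cases} \frac{m-n+k+1}{(m+k+1)(m-n+j+k+1)}, & 0\le k\le i-j-1,\\ \frac{m-n+k+1}{(m+k+1)(m-n+j+k+1)}-\frac{j-i+k+1}{(j+k+1)(j-i+m+k+1)}, & k\ge i-j, \end{cases} \] and for integers $k\ge m-n+i-j$ let \[ D_{k}:=\frac{j-i+k+1}{(j-i+n+k+1)(2j-i+k+1)}-\frac{2j-2i+n-m+k+1}{(2j-i+n-m+k+1)(2j-2i+n+k+1)}. \] Suppose that the following four conditions hold for integers $k$ in the indicated ranges: (1) for $0\le k\le i-j-1$, \[ \left|\frac{a_{m,n}}{a_{i,j}}\right|\frac{m+k-n+1}{(m+k+1)^{2}}+\left|\frac{a_{i,j}}{a_{m,n}}\right|\frac{i+k-j+1}{(i+k+1)^{2}}\ge C_{k}; \] (2) for $i-j\le k\le m-n-1$, \[ \left|\frac{a_{m,n}}{a_{i,j}}\right|\frac{m+k-n+1}{(m+k+1)^{2}}+\left|\frac{a_{i,j}}{a_{m,n}}\right|\left(\frac{i+k-j+1}{(i+k+1)^{2}}-\frac{j+k-i+1}{(j+k+1)^{2}}\right)\ge C_{k}; \] (3) for $m-n\le k\le m-n+i-j-1$, \[ \left|\frac{a_{m,n}}{a_{i,j}}\right|\left(\frac{m+k-n+1}{(m+k+1)^{2}}-\frac{n+k-m+1}{(n+k+1)^{2}}\right)+\left|\frac{a_{i,j}}{a_{m,n}}\right|\left(\frac{i+k-j+1}{(i+k+1)^{2}}-\frac{j+k-i+1}{(j+k+1)^{2}}\right)\ge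 C_{k}; \] (4) for $k\ge m-n+i-j$, \[ \left|\frac{a_{m,n}}{a_{i,j}}\right|\left(\frac{m+k-n+1}{(m+k+1)^{2}}-\frac{n+k-m+1}{(n+k+1)^{2}}\right)+\left|\frac{a_{i,j}}{a_{m,n}}\right|\left(\frac{i+k-j+1}{(i+k+1)^{2}}-\frac{j+k-i+1}{(j+k+1)^{2}}\right)\ge C_{k}+D_{k}. \] Then the Toeplitz operator $T_{f+g}$ acting on the Bergman space $A^{2}(\mathbb{D})$ is hyponormal.
   Context: $\mathbb{D}$ is the open unit disc in $\mathbb{C}$. The Bergman space is $A^{2}(\mathbb{D})=\{f \text{ holomorphic on }\mathbb{D}:\int_{\mathbb{D}}|f(z)|^{2}\,dA(z)<\infty\}$, where $dA$ is area measure, regarded as a closed subspace of $L^{2}(\mathbb{D})$. For $\varphi\in L^{\infty}(\mathbb{D})$, the Toeplitz operator is $T_{\varphi}f=P(\varphi f)$ for $f\in A^{2}(\mathbb{D})$, where $P$ is the orthogonal projection from $L^{2}(\mathbb{D})$ onto $A^{2}(\mathbb{D})$. A bounded operator $T$ on a complex Hilbert space $H$ is hyponormal if $[T^{*},T]:=T^{*}T-TT^{*}\ge 0$, i.e. $\langle [T^{*},T]u,u\rangle\ge 0$ for all $u\in H$. *)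

theory Defs
  imports "HOL-Complex_Analysis.Complex_Analysis"
begin

abbreviation unit_disc :: "complex set" where
  "unit_disc \<equiv> ball 0 1"

abbreviation area :: "complex measure" where
  "area \<equiv> lebesgue_on unit_disc"

(* The inner product of L^2(D), linear in the first argument. *)
definition l2_inner :: "(complex \<Rightarrow> complex) \<Rightarrow> (complex \<Rightarrow> complex) \<Rightarrow> complex" where
  "l2_inner f g = (LINT z|area. f z * cnj (g z))"

definition l2_norm :: "(complex \<Rightarrow> complex) \<Rightarrow> real" where
  "l2_norm f = sqrt (LINT z|area. (cmod (f z))\<^sup>2)"

(* Functions on the disc are represented by total functions that vanish off the disc, so that
   equality of elements is equality of functions on the disc (holomorphic functions that agree
   almost everywhere on the disc agree everywhere on it). *)
definition bergman_space :: "(complex \<Rightarrow> complex) set" where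
  "bergman_space = {f. f holomorphic_on unit_disc \<and> (\<forall>z. z \<notin> unit_disc \<longrightarrow> f z = 0) \<and>
     integrable area (\<lambda>z. (cmod (f z))\<^sup>2)}"

(* Orthogonal projection: the unique f in the Bergman space with h - f orthogonal to it.
   Meaningful for h in L^2(D) only. *)
definition bergman_proj :: "(complex \<Rightarrow> complex) \<Rightarrow> (complex \<Rightarrow> complex)" where
  "bergman_proj h = (THE f. f \<in> bergman_space \<and>
     (\<forall>g \<in> bergman_space. l2_inner (\<lambda>z. h z - f z) g = 0))"

definition toeplitz :: "(complex \<Rightarrow> complex) \<Rightarrow> (complex \<Rightarrow> complex) \<Rightarrow> (complex \<Rightarrow> complex)" where
  "toeplitz \<phi> f = bergman_proj (\<lambda>z. \<phi> z * f z)"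

definition bounded_operator :: "((complex \<Rightarrow> complex) \<Rightarrow> (complex \<Rightarrow> complex)) \<Rightarrow> bool" where
  "bounded_operator T \<longleftrightarrow>
     (\<forall>u \<in> bergman_space. T u \<in> bergman_space) \<and>
     (\<forall>u \<in> bergman_space. \<forall>v \<in> bergman_space. T (\<lambda>z. u z + v z) = (\<lambda>z. T u z + T v z)) \<and>
     (\<forall>u \<in> bergman_space. \<forall>c. T (\<lambda>z. c * u z) = (\<lambda>z. c * T u z)) \<and>
     (\<exists>B. \<forall>u \<in> bergman_space. l2_norm (T u) \<le> B * l2_norm u)"

(* The Hilbert space adjoint; it exists, by Riesz representation, for bounded T. *)
definition adjoint_op ::
  "((complex \<Rightarrow> complex) \<Rightarrow> (complex \<Rightarrow> complex)) \<Rightarrow> (complex \<Rightarrow> complex) \<Rightarrow> (complex \<Rightarrow> complex)" where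
  "adjoint_op T v = (THE w. w \<in> bergman_space \<and>
     (\<forall>u \<in> bergman_space. l2_inner (T u) v = l2_inner u w))"

definition self_commutator ::
  "((complex \<Rightarrow> complex) \<Rightarrow> (complex \<Rightarrow> complex)) \<Rightarrow> (complex \<Rightarrow> complex) \<Rightarrow> (complex \<Rightarrow> complex)" where
  "self_commutator T u = (\<lambda>z. adjoint_op T (T u) z - T (adjoint_op T u) z)"

definition hyponormal :: "((complex \<Rightarrow> complex) \<Rightarrow> (complex \<Rightarrow> complex)) \<Rightarrow> bool" where
  "hyponormal T \<longleftrightarrow> bounded_operator T \<and>
     (\<forall>u \<in> bergman_space. l2_inner (self_commutator T u) u \<in> \<real>\<^sub>\<ge>\<^sub>0)"

(* All differences below are taken in the reals, not in the naturals, except in the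
   range test k < i - j, which is used with j < i. *)
definition coeff_C :: "nat \<Rightarrow> nat \<Rightarrow> nat \<Rightarrow> nat \<Rightarrow> nat \<Rightarrow> real" where
  "coeff_C m n i j k =
    (if k < i - j then
       (real m - real n + real k + 1) /
         ((real m + real k + 1) * (real m - real n + real j + real k + 1))
     else
       (real m - real n + real k + 1) /
         ((real m + real k + 1) * (real m - real n + real j + real k + 1))
       - (real j - real i + real k + 1) /
         ((real j + real k + 1) * (real j - real i + real m + real k + 1)))"

definition coeff_D :: "nat \<Rightarrow> nat \<Rightarrow> nat \<Rightarrow> nat \<Rightarrow> nat \<Rightarrow> real" where
  "coeff_D m n i j k =
     (real j - real i + real k + 1) /
       ((real j - real i + real n + real k + 1) * (2 * real j - real i + real k + 1))
     - (2 * real j - 2 * real i + real n - real m + real k + 1) /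
       ((2 * real j - real i + real n - real m + real k + 1) *
        (2 * real j - 2 * real i + real n + real k + 1))"

end

theory Submission
  imports Defs
begin

text \<open>
  Put \<open>p = m - n\<close>, \<open>q = i - j\<close>, \<open>r = p - q\<close>, and let \<open>u = \<Sum> u\<^sub>k z\<^sup>k\<close> be in the Bergman space. In terms of the
  Taylor coefficients, \<open>(\<parallel>T u\<parallel>\<^sup>2 - \<parallel>T\<^sup>* u\<parallel>\<^sup>2) / (\<pi> |a b|)\<close> equals
  \<open>\<Sum> H\<^sub>k |u\<^sub>k|\<^sup>2 + 2 C\<^sub>k Re (\<omega> u\<^sub>k cnj u\<^sub>k\<^sub>+\<^sub>r)\<close> with \<open>|\<omega>| = 1\<close>: a direct sum of \<open>r\<close> Jacobi forms, whose
  off-diagonal entries are the \<open>C\<^sub>k\<close> of the theorem and whose diagonal entries \<open>H\<^sub>k\<close> are the left-hand sides of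
  its conditions. Such a form is nonnegative once the pivots \<open>d\<^sub>k = H\<^sub>k\<close> (for \<open>k < r\<close>),
  \<open>d\<^sub>k = H\<^sub>k - C\<^sub>k\<^sub>-\<^sub>r\<^sup>2 / d\<^sub>k\<^sub>-\<^sub>r\<close> of the symmetric Gauss elimination are all positive.

  The conditions do not make the form diagonally dominant, since the row of \<open>k\<close> also contains \<open>C\<^sub>k\<^sub>-\<^sub>r\<close>, so the
  positivity needs an argument. For \<open>k \<ge> q\<close> the sequence \<open>C\<close> is decreasing, convex and log-convex, and condition (4)
  at \<open>k = p + q\<close> bounds \<open>H\<^sub>k\<close> from below for all \<open>k\<close> in \<open>[p, p + q]\<close>; induction along each chain then gives
  \<open>d\<^sub>k \<ge> C\<^sub>k\<close> for \<open>k < q\<close>, \<open>d\<^sub>k \<ge> C\<close> at \<open>min (2 k) (p + q)\<close> for \<open>k\<close> in \<open>[max q r, p + q)\<close>, and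
  \<open>d\<^sub>k \<ge> C\<^sub>k\<close> from \<open>p + q\<close> on. For \<open>k < p\<close> the inductive step splits according to the size of \<open>t = |a / b|\<close>.
\<close>

text \<open>The term D_k of condition (4) is \<open>Ce\<close> at the index k - (p + q). So d_k >=
  C_k follows for large k once the subtracted square, taken at v = k - r, is at most this shifted
  value. Log-convexity about v gives such a bound if the pivot at v is at least \<open>Ce\<close> at
  some index w <= 2 v, and then the square is at most \<open>Ce\<close> at 2 v - w. Since w is to be
  large but neither 2 v - w negative nor the pivot bound unattainable, w is the minimum of 2 v and p
  + q; this is where the bound with the minimum comes from. The hard range is r <= k < p, where the
  hypotheses bound the diagonal entry alone and say nothing of the subtracted square. There the
  identity \<open>(al x)^2 = Ap x * Bp (x + r)\<close> settles large t. For smaller t the argument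
  depends on the order of j and n, because it decides whether Ap / al increases along a chain. If it
  does not, condition (4) at k = p + q has to exclude a whole interval of values of t; the
  inequalities at its two ends are rational in several parameters and are the reason for the
  polynomial certificates.\<close>

section \<open>Certifying that a polynomial is nonnegative\<close>

text \<open>
  Normal forms in nested Horner representation: \<open>Hn ps\<close> is a polynomial in variable \<open>0\<close> whose coefficients \<open>ps\<close>
  are polynomials in the remaining variables, shifted down by one.
\<close>

datatype npol = Cf int | Hn "npol list"

fun npev :: "npol \<Rightarrow> (nat \<Rightarrow> real) \<Rightarrow> real" and npevs :: "npol list \<Rightarrow> real \<Rightarrow> (nat \<Rightarrow> real) \<Rightarrow> real" where
  "npev (Cf c) e = real_of_int c"
| "npev (Hn ps) e = npevs ps (e 0) (\<lambda>k. e (Suc k))"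
| "npevs [] x e = 0"
| "npevs (p # ps) x e = npev p e + x * npevs ps x e"

fun npadd :: "npol \<Rightarrow> npol \<Rightarrow> npol" and npadds :: "npol list \<Rightarrow> npol list \<Rightarrow> npol list" where
  "npadd (Cf a) (Cf b) = Cf (a + b)"
| "npadd (Cf a) (Hn qs) = Hn (case qs of [] \<Rightarrow> [Cf a] | q # qs \<Rightarrow> npadd (Cf a) q # qs)"
| "npadd (Hn ps) (Cf b) = Hn (case ps of [] \<Rightarrow> [Cf b] | p # ps \<Rightarrow> npadd p (Cf b) # ps)"
| "npadd (Hn ps) (Hn qs) = Hn (npadds ps qs)"
| "npadds [] qs = qs"
| "npadds (p # ps) [] = p # ps"
| "npadds (p # ps) (q # qs) = npadd p q # npadds ps qs"

lemma npev_npadd: "npev (npadd p q) e = npev p e + npev q e"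
  and npevs_npadds: "npevs (npadds ps qs) x e = npevs ps x e + npevs qs x e"
  by (induction p q and ps qs arbitrary: e and x e rule: npadd_npadds.induct)
     (auto simp: algebra_simps split: list.splits)

fun npscale :: "int \<Rightarrow> npol \<Rightarrow> npol" where
  "npscale c (Cf a) = Cf (c * a)"
| "npscale c (Hn ps) = Hn (map (npscale c) ps)"

lemma npev_npscale: "npev (npscale c p) e = real_of_int c * npev p e"
proof (induction c p arbitrary: e rule: npscale.induct)
  case (2 c ps)
  have "npevs (map (npscale c) qs) x e = real_of_int c * npevs qs x e" if "set qs \<subseteq> set ps" for qs x e
    using that by (induction qs) (auto simp: 2 algebra_simps)
  then show ?case by simp
qed simp

fun npmul :: "npol \<Rightarrow> npol \<Rightarrow> npol" and npmuls :: "npol list \<Rightarrow> npol list \<Rightarrow> npol list"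
  and npmulc :: "npol \<Rightarrow> npol list \<Rightarrow> npol list" where
  "npmul (Cf a) q = npscale a q"
| "npmul (Hn ps) (Cf b) = npscale b (Hn ps)"
| "npmul (Hn ps) (Hn qs) = Hn (npmuls ps qs)"
| "npmuls [] qs = []"
| "npmuls (p # ps) qs = npadds (npmulc p qs) (Cf 0 # npmuls ps qs)"
| "npmulc p [] = []"
| "npmulc p (q # qs) = npmul p q # npmulc p qs"

lemma npev_npmul: "npev (npmul p q) e = npev p e * npev q e"
  and npevs_npmuls: "npevs (npmuls ps qs) x e = npevs ps x e * npevs qs x e"
  and npevs_npmulc: "npevs (npmulc p qs) x e = npev p e * npevs qs x e"
  by (induction p q and ps qs and p qs arbitrary: e and x e and x e rule: npmul_npmuls_npmulc.induct)
     (auto simp: algebra_simps npev_npscale npevs_npadds simp del: npscale.simps(2))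

primrec npvar :: "nat \<Rightarrow> npol" where
  "npvar 0 = Hn [Cf 0, Cf 1]"
| "npvar (Suc k) = Hn [npvar k]"

lemma npev_npvar: "npev (npvar k) e = e k"
  by (induction k arbitrary: e) auto

datatype pex = PV nat | PC int | PA pex pex | PS pex pex | PM pex pex

instantiation pex :: "{plus, minus, times}"
begin
definition "plus_pex = PA"
definition "minus_pex = PS"
definition "times_pex = PM"
instance ..
end

primrec pnorm :: "pex \<Rightarrow> npol" where
  "pnorm (PV k) = npvar k"
| "pnorm (PC c) = Cf c"
| "pnorm (PA e f) = npadd (pnorm e) (pnorm f)"
| "pnorm (PS e f) = npadd (pnorm e) (npscale (-1) (pnorm f))"
| "pnorm (PM e f) = npmul (pnorm e) (pnorm f)"

primrec pev :: "pex \<Rightarrow> (nat \<Rightarrow> real) \<Rightarrow> real" where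
  "pev (PV k) e = e k"
| "pev (PC c) e = real_of_int c"
| "pev (PA f g) e = pev f e + pev g e"
| "pev (PS f g) e = pev f e - pev g e"
| "pev (PM f g) e = pev f e * pev g e"

lemma pev_arith [simp]:
  "pev (f + g) e = pev f e + pev g e" "pev (f - g) e = pev f e - pev g e" "pev (f * g) e = pev f e * pev g e"
  by (simp_all add: plus_pex_def minus_pex_def times_pex_def)

lemma npev_pnorm: "npev (pnorm f) e = pev f e"
  by (induction f) (auto simp: npev_npvar npev_npadd npev_npscale npev_npmul)

text \<open>A sufficient criterion for nonnegativity on the orthant, decided by evaluation.\<close>

fun npnn :: "npol \<Rightarrow> bool" where
  "npnn (Cf c) = (0 \<le> c)"
| "npnn (Hn ps) = list_all npnn ps"

lemma npev_nonneg: "npnn p \<Longrightarrow> (\<And>k. 0 \<le> e k) \<Longrightarrow> 0 \<le> npev p e"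
proof (induction p arbitrary: e rule: npnn.induct)
  case (2 ps)
  have "0 \<le> npevs qs x e'" if "set qs \<subseteq> set ps" "0 \<le> x" "\<And>k. 0 \<le> e' k" for qs x e'
    using that
  proof (induction qs)
    case (Cons q qs)
    then show ?case using 2 by (auto simp: list_all_iff intro!: add_nonneg_nonneg mult_nonneg_nonneg)
  qed simp
  then show ?case using 2 by simp
qed simp

text \<open>Variables beyond the list are 0, which keeps the whole environment nonnegative.\<close>

definition penv :: "real list \<Rightarrow> nat \<Rightarrow> real" where
  "penv xs k = (if k < length xs then xs ! k else 0)"

lemma pev_nonneg:
  assumes "npnn (pnorm f)" and "\<forall>x\<in>set xs. 0 \<le> x"
  shows "0 \<le> pev f (penv xs)"
  using npev_nonneg[OF assms(1), of "penv xs"] assms(2) by (auto simp: npev_pnorm penv_def)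

section \<open>The entries of the Jacobi form\<close>

text \<open>For \<open>x = k + 1\<close> with \<open>k >= p\<close>, the diagonal coefficient that a
  single monomial with exponents \<open>n + p\<close> and \<open>n\<close> contributes.\<close>

definition profile :: "real \<Rightarrow> real \<Rightarrow> real \<Rightarrow> real" where
  "profile n p x = (p + x) / (n + p + x)\<^sup>2 - (x - p) / (n + x)\<^sup>2"

text \<open>Over a common denominator the cancellation disappears: the numerator is positive and
  decreasing in \<open>x\<close>, the denominator increasing.\<close>

lemma profile_alt:
  assumes "0 \<le> n" "0 \<le> p" "0 < x"
  shows "profile n p x = p * ((2 * n + p) + p * (n + p) / (n + x)) / ((n + p + x)\<^sup>2 * (n + x))"
proof -
  have "n + x \<noteq> 0" "n + p + x \<noteq> 0" using assms by auto
  then show ?thesis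
    unfolding profile_def by (simp add: divide_simps) (simp add: algebra_simps power2_eq_square)
qed

lemma profile_antimono:
  assumes "0 \<le> n" "0 \<le> p" "0 < x" "x \<le> y"
  shows "profile n p y \<le> profile n p x"
proof -
  have "p * (n + p) / (n + y) \<le> p * (n + p) / (n + x)"
    using assms by (intro divide_left_mono) (auto intro!: mult_pos_pos)
  moreover have "(n + p + x)\<^sup>2 * (n + x) \<le> (n + p + y)\<^sup>2 * (n + y)"
    using assms by (intro mult_mono power_mono) auto
  moreover have "0 < (n + p + x)\<^sup>2 * (n + x)" using assms by auto
  ultimately show ?thesis
    using assms unfolding profile_alt[OF assms(1-3)] profile_alt[OF assms(1,2) less_le_trans[OF assms(3,4)]]
    by (intro frac_le mult_left_mono mult_nonneg_nonneg add_mono add_nonneg_nonneg) auto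
qed

text \<open>With denominators cleared, the difference of the two sides has the factor
  \<open>x - p\<close>; the bound is an equality at \<open>x = p\<close>.\<close>

lemma profile_le:
  assumes "0 \<le> n" "0 \<le> p" "p \<le> x" "0 < x"
  shows "profile n p x \<le> 2 * p / ((n + p + x) * (n + 2 * x))"
proof -
  have pos: "0 < n + x" "0 < n + p + x" "0 < n + 2 * x" using assms by auto
  have "((2 * n + p) * (n + x) + p * (n + p)) * (n + 2 * x) \<le> 2 * (n + p + x) * (n + x)\<^sup>2"
  proof -
    have "2 * (n + p + x) * (n + x)\<^sup>2 - ((2 * n + p) * (n + x) + p * (n + p)) * (n + 2 * x)
        = (x - p) * (n * (2 * x + p) + 2 * x * (x + p))"
      by (simp add: algebra_simps power2_eq_square)
    moreover have "0 \<le> (x - p) * (n * (2 * x + p) + 2 * x * (x + p))"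
      using assms by simp
    ultimately show ?thesis by linarith
  qed
  then have "p * (((2 * n + p) * (n + x) + p * (n + p)) * (n + 2 * x)) \<le> p * (2 * (n + p + x) * (n + x)\<^sup>2)"
    using assms by (intro mult_left_mono) auto
  moreover have "profile n p x = p * ((2 * n + p) * (n + x) + p * (n + p)) / ((n + p + x)\<^sup>2 * (n + x)\<^sup>2)"
    using pos unfolding profile_alt[OF assms(1,2,4)] by (simp add: field_simps power2_eq_square)
  moreover have "p * K / (a\<^sup>2 * b\<^sup>2) \<le> 2 * p / (a * c)"
    if "p * (K * c) \<le> p * (2 * a * b\<^sup>2)" "0 < a" "0 < b" "0 < c" for a b c K :: real
    using that by (simp add: divide_simps power2_eq_square mult_ac)
  ultimately show ?thesis using pos by simp
qed

section \<open>Monotonicity, convexity and log-convexity of products of three reciprocals\<close>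

definition recip3 :: "real \<Rightarrow> real \<Rightarrow> real \<Rightarrow> real \<Rightarrow> real" where
  "recip3 a b c x = 1 / ((a + x) * (b + x) * (c + x))"

lemma recip3_pos: "0 \<le> a \<Longrightarrow> 0 \<le> b \<Longrightarrow> 0 \<le> c \<Longrightarrow> 0 < x \<Longrightarrow> 0 < recip3 a b c x"
  by (simp add: recip3_def)

lemma recip3_antimono: "0 \<le> a \<Longrightarrow> 0 \<le> b \<Longrightarrow> 0 \<le> c \<Longrightarrow> 0 < x \<Longrightarrow> x \<le> y \<Longrightarrow> recip3 a b c y \<le> recip3 a b c x"
  unfolding recip3_def by (intro divide_left_mono mult_mono mult_nonneg_nonneg mult_pos_pos) auto

text \<open>For a fixed sum of the two points, the product of the values of \<open>d + x\<close>
  grows when the points move together, by exactly \<open>(y - x) * (y' - x)\<close>. Three such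
  products are multiplied and inverted.\<close>

lemma recip3_log_convex:
  assumes "0 \<le> a" "0 \<le> b" "0 \<le> c" "0 < x" "x \<le> y" "x \<le> y'" "x + z = y + y'"
  shows "recip3 a b c y * recip3 a b c y' \<le> recip3 a b c x * recip3 a b c z"
proof -
  have z: "z = y + y' - x" using assms by simp
  have *: "(d + x) * (d + z) \<le> (d + y) * (d + y')" for d
  proof -
    have "(d + y) * (d + y') - (d + x) * (d + z) = (y - x) * (y' - x)"
      unfolding z by (simp add: algebra_simps)
    moreover have "0 \<le> (y - x) * (y' - x)" using assms by simp
    ultimately show ?thesis by linarith
  qed
  have "((a + x) * (a + z)) * ((b + x) * (b + z)) * ((c + x) * (c + z))
      \<le> ((a + y) * (a + y')) * ((b + y) * (b + y')) * ((c + y) * (c + y'))"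
    using assms z by (intro mult_mono *) (auto intro!: mult_nonneg_nonneg)
  moreover have "0 < ((a + x) * (a + z)) * ((b + x) * (b + z)) * ((c + x) * (c + z))"
    using assms z by (auto intro!: mult_pos_pos)
  ultimately have "1 / (((a + y) * (a + y')) * ((b + y) * (b + y')) * ((c + y) * (c + y')))
      \<le> 1 / (((a + x) * (a + z)) * ((b + x) * (b + z)) * ((c + x) * (c + z)))"
    by (intro divide_left_mono) auto
  then show ?thesis by (simp add: recip3_def mult.commute mult.left_commute)
qed

text \<open>Expand \<open>(f x - f y) * (f x - f y') >= 0\<close>, replace \<open>f y * f y'\<close>
  by \<open>f x * f z\<close> through log-convexity, and cancel \<open>f x\<close>.\<close>

lemma recip3_convex:
  assumes "0 \<le> a" "0 \<le> b" "0 \<le> c" "0 < x" "x \<le> y" "x \<le> y'" "x + z = y + y'"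
  shows "recip3 a b c y + recip3 a b c y' \<le> recip3 a b c x + recip3 a b c z"
proof -
  let ?f = "recip3 a b c"
  have "0 \<le> (?f x - ?f y) * (?f x - ?f y')"
    using recip3_antimono assms by (intro mult_nonneg_nonneg) auto
  then have "?f x * (?f y + ?f y') \<le> ?f x * ?f x + ?f y * ?f y'" by (simp add: algebra_simps)
  also have "\<dots> \<le> ?f x * (?f x + ?f z)"
    using recip3_log_convex[OF assms] by (simp add: algebra_simps)
  finally show ?thesis using recip3_pos[OF assms(1-4)] by simp
qed

text \<open>Cauchy-Schwarz in dimension two; it makes sums of log-convex sequences
  log-convex.\<close>

lemma sq_add_le_mult_add:
  fixes u v :: real
  assumes "u\<^sup>2 \<le> u1 * u2" "v\<^sup>2 \<le> v1 * v2" "0 \<le> u" "0 \<le> v" "0 \<le> u1" "0 \<le> u2" "0 \<le> v1" "0 \<le> v2"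
  shows "(u + v)\<^sup>2 \<le> (u1 + v1) * (u2 + v2)"
proof -
  have "(u * v)\<^sup>2 \<le> (u1 * u2) * (v1 * v2)"
    unfolding power_mult_distrib using assms by (intro mult_mono) auto
  also have "\<dots> = (u1 * v2) * (v1 * u2)" by simp
  also have "\<dots> \<le> ((u1 * v2 + v1 * u2) / 2)\<^sup>2"
  proof -
    have "0 \<le> (u1 * v2 - v1 * u2)\<^sup>2" by simp
    then show ?thesis by (simp add: power2_eq_square algebra_simps)
  qed
  finally have "u * v \<le> (u1 * v2 + v1 * u2) / 2"
    by (rule power2_le_imp_le) (use assms in auto)
  then show ?thesis using assms by (simp add: power2_eq_square algebra_simps)
qed

text \<open>The parameters are real, so that polynomial certificates apply to them directly; of
  integrality only \<open>1 <= q\<close> and \<open>1 <= r\<close> are kept. The number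
  \<open>t\<close> stands for |a / b|.\<close>

locale monomial_pair =
  fixes n j q r t :: real
  assumes n0: "0 \<le> n" and j0: "0 \<le> j" and q0: "1 \<le> q" and r0: "1 \<le> r" and t0: "0 < t"
begin

definition "p = q + r"
definition "m = n + p"
definition "i = j + q"
definition "s = j + p"
definition "X = p + q + 1"

text \<open>
  With \<open>x = k + 1\<close>, \<open>al x\<close> and \<open>al x - be x = Ce x\<close> are the two branches of \<open>C\<^sub>k\<close>, and \<open>X\<close> belongs to
  \<open>k = p + q\<close>. In the diagonal entries, \<open>Ap - Am\<close> comes from the monomial with coefficient \<open>a\<close> and \<open>Bp - Bm\<close> from
  the one with coefficient \<open>b\<close>; \<open>Am\<close> and \<open>Bm\<close> are present only for \<open>k \<ge> p\<close> and \<open>k \<ge> q\<close>.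
\<close>

definition "Ce x = p * j * recip3 m j s x + q * m * recip3 m j (n + r) x"
definition "al x = (p + x) / ((m + x) * (s + x))"
definition "be x = (x - q) / ((j + x) * (n + r + x))"
definition "Ap x = t * ((p + x) / (m + x)\<^sup>2)"
definition "Bp x = (q + x) / (i + x)\<^sup>2 / t"
definition "Am x = t * ((x - p) / (n + x)\<^sup>2)"
definition "Bm x = (x - q) / (j + x)\<^sup>2 / t"

lemma p0: "1 \<le> p" "q < p" and m0: "1 \<le> m" "n < m" and i0: "1 \<le> i" and s0: "1 \<le> s" "i \<le> s" and X0: "1 \<le> X" "p < X"
  using n0 j0 q0 r0 by (auto simp: p_def m_def i_def s_def X_def)

lemma Ap_Am: "0 < x \<Longrightarrow> Ap x - Am x = t * profile n p x"
  by (simp add: Ap_def Am_def profile_def m_def algebra_simps)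

lemma Bp_Bm: "0 < x \<Longrightarrow> Bp x - Bm x = profile j q x / t"
  by (simp add: Bp_def Bm_def profile_def i_def diff_divide_distrib)

text \<open>In the common numerator the cubic and quadratic terms in \<open>x\<close> cancel because
  \<open>p = q + r\<close>. What is left is a combination of two \<open>recip3\<close> terms with
  nonnegative weights, from which positivity, monotonicity and log-convexity of the difference are
  read off.\<close>

lemma Ce_eq: assumes "0 < x" shows "Ce x = al x - be x"
proof -
  have pos: "m + x \<noteq> 0" "j + x \<noteq> 0" "s + x \<noteq> 0" "n + r + x \<noteq> 0"
    using assms n0 j0 m0 s0 r0 by auto
  have "(p + x) * ((j + x) * (n + r + x)) - (x - q) * ((m + x) * (s + x)) = p * j * (n + r + x) + q * m * (s + x)"
    by (simp add: m_def s_def p_def algebra_simps)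
  moreover have "u * (1 / (a * b * c)) + v * (1 / (a * b * d)) = w / (a * c) - y / (b * d)"
    if "w * (b * d) - y * (a * c) = u * d + v * c" "a \<noteq> 0" "b \<noteq> 0" "c \<noteq> 0" "d \<noteq> 0" for a b c d u v w y :: real
    using that by (simp add: divide_simps mult_ac)
  ultimately show ?thesis using pos unfolding al_def be_def Ce_def recip3_def by simp
qed

lemma Ce_pos: "0 < x \<Longrightarrow> 0 < Ce x"
  using n0 j0 m0 s0 r0 p0 q0 recip3_pos[of m j s x] recip3_pos[of m j "n + r" x]
  unfolding Ce_def by (intro add_nonneg_pos mult_nonneg_nonneg mult_pos_pos) auto

lemma Ce_antimono: "0 < x \<Longrightarrow> x \<le> y \<Longrightarrow> Ce y \<le> Ce x"
  using n0 j0 m0 s0 r0 p0 q0 unfolding Ce_def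
  by (intro add_mono mult_left_mono recip3_antimono) auto

lemma Ce_log_convex:
  assumes "0 < x" "x \<le> y" "x + z = 2 * y"
  shows "(Ce y)\<^sup>2 \<le> Ce x * Ce z"
proof -
  have "(c * recip3 m j b y)\<^sup>2 \<le> (c * recip3 m j b x) * (c * recip3 m j b z)" if "0 \<le> b" for b c
  proof -
    have "recip3 m j b y * recip3 m j b y \<le> recip3 m j b x * recip3 m j b z"
      using assms that m0 j0 by (intro recip3_log_convex) auto
    then have "c\<^sup>2 * (recip3 m j b y * recip3 m j b y) \<le> c\<^sup>2 * (recip3 m j b x * recip3 m j b z)"
      by (intro mult_left_mono) auto
    then show ?thesis by (simp add: power2_eq_square mult_ac)
  qed
  moreover have "0 \<le> recip3 m j b u" if "0 \<le> b" "0 < u" for b u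
    using recip3_pos[of m j b u] that m0 j0 by auto
  ultimately show ?thesis
    unfolding Ce_def using assms n0 j0 m0 s0 r0 p0 q0
    by (intro sq_add_le_mult_add) (auto intro!: mult_nonneg_nonneg)
qed

lemma Ce_convex:
  assumes "0 < x" "x \<le> y" "x \<le> y'" "x + z = y + y'"
  shows "Ce y + Ce y' \<le> Ce x + Ce z"
proof -
  have "c * recip3 m j b y + c * recip3 m j b y' \<le> c * recip3 m j b x + c * recip3 m j b z" if "0 \<le> b" "0 \<le> c" for b c
    using recip3_convex[OF _ j0 that(1) assms, of m] m0 that by (simp flip: distrib_left add: mult_left_mono)
  from this[of s "p * j"] this[of "n + r" "q * m"] show ?thesis
    unfolding Ce_def using n0 j0 m0 s0 r0 p0 q0 by (auto intro: add_mono)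
qed

section \<open>Lower bounds for the diagonal entries, according to the size of t\<close>

lemma al_pos: "0 < x \<Longrightarrow> 0 < al x"
  using m0 s0 p0 by (simp add: al_def)

lemma Ap_pos: "0 < x \<Longrightarrow> 0 < Ap x"
  using m0 t0 p0 by (simp add: Ap_def)

lemma Bp_pos: "0 < x \<Longrightarrow> 0 < Bp x"
  using i0 t0 q0 by (simp add: Bp_def)

lemma al_sq: "0 < x \<Longrightarrow> (al x)\<^sup>2 = Ap x * Bp (x + r)"
proof -
  assume "0 < x"
  have *: "q + (x + r) = p + x" "i + (x + r) = s + x" by (simp_all add: p_def i_def s_def)
  show ?thesis unfolding al_def Ap_def Bp_def * using t0
    by (simp add: power_divide power_mult_distrib power2_eq_square)
qed

text \<open>For large \<open>t\<close> the two parts compare separately: \<open>al x <= Ap x\<close>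
  needs \<open>m + x <= t * (s + x)\<close>, and \<open>Bm x <= be x\<close> needs
  \<open>n + r + x <= t * (j + x)\<close>. The hypothesis with \<open>j + x - r\<close> implies both
  and complements the one of \<open>low_branch\<close>.\<close>

lemma high_branch:
  assumes "q < x" "r < x" "m + x \<le> t * (j + x - r)"
  shows "Ce x \<le> Ap x - Bm x"
proof -
  have x: "0 < x" using assms q0 by simp
  have jx: "j + x - r \<le> j + x" "j + x - r \<le> s + x" using r0 p0 by (auto simp: s_def)
  have "m + x \<le> t * (s + x)" using order_trans[OF assms(3) mult_left_mono[OF jx(2), of t]] t0 by simp
  then have 1: "1 / (s + x) \<le> t / (m + x)"
    using x m0 s0 by (simp add: field_simps)
  have "al x = (p + x) / (m + x) * (1 / (s + x))" by (simp add: al_def)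
  also have "\<dots> \<le> (p + x) / (m + x) * (t / (m + x))"
    using x p0 m0 by (intro mult_left_mono 1) auto
  also have "\<dots> = Ap x" by (simp add: Ap_def power2_eq_square)
  finally have al: "al x \<le> Ap x" .
  have "n + r + x \<le> t * (j + x)" using order_trans[OF assms(3) mult_left_mono[OF jx(1), of t]] t0 q0 by (simp add: m_def p_def)
  then have 2: "1 / (t * (j + x)) \<le> 1 / (n + r + x)"
    using x n0 r0 by (intro divide_left_mono) (auto intro!: mult_pos_pos simp: t0 j0 add_nonneg_pos)
  have "Bm x = (x - q) / (j + x) * (1 / (t * (j + x)))" by (simp add: Bm_def power2_eq_square)
  also have "\<dots> \<le> (x - q) / (j + x) * (1 / (n + r + x))"
    using x j0 assms by (intro mult_left_mono 2) auto
  also have "\<dots> = be x" by (simp add: be_def)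
  finally show ?thesis using al by (simp add: Ce_eq x)
qed

text \<open>Carries the bound at \<open>X\<close> back to \<open>x <= p\<close>, where
  \<open>Am\<close> is absent. The profile at \<open>X\<close> is at most its value at
  \<open>p\<close>, hence at most \<open>Ap x / t\<close> plus a correction; the upper bound on
  \<open>t\<close> turns the correction into \<open>- be (x - r)\<close>, which is the excess of
  \<open>Ce (x - r)\<close> over \<open>al (x - r)\<close>.\<close>

lemma low_branch:
  assumes "r < x" "q < x" "x \<le> p" "t * (j + x - r) \<le> m + x"
    and N: "Ce X + Ce 1 \<le> t * profile n p X + profile j q X / t"
  shows "Ce X + Ce 1 - Ce (x - r) + al (x - r) \<le> Ap x + Bp x - Bm x"
proof -
  have x: "0 < x" "0 < x - r" "0 < n + x" "0 < m + x" "0 < j + x - r" using assms q0 n0 m0 j0 by auto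
  have "2 * p / (m + p)\<^sup>2 = profile n p p" by (simp add: profile_def m_def)
  then have pX: "profile n p X \<le> p * (2 / (m + p)\<^sup>2)"
    using profile_antimono[of n p p X] n0 p0 X0 by (simp add: mult.commute)
  have "2 * (n + x) * ((m + x) * (m + x)) \<le> (m + n + x) * ((m + p) * (m + p))"
    using assms x m0 n0 by (intro mult_mono) (auto simp: m_def)
  moreover have "2 / a\<^sup>2 \<le> b / (c\<^sup>2 * d)" if "2 * d * (c * c) \<le> b * (a * a)" "0 < a" "0 < c" "0 < d" for a b c d :: real
    using that by (simp add: divide_simps power2_eq_square mult_ac)
  ultimately have "2 / (m + p)\<^sup>2 \<le> (m + n + x) / ((m + x)\<^sup>2 * (n + x))"
    using x m0 p0 by simp
  then have "p * (2 / (m + p)\<^sup>2) \<le> p * ((m + n + x) / ((m + x)\<^sup>2 * (n + x)))"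
    using p0 by (intro mult_left_mono) auto
  also have "\<dots> = (p + x) / (m + x)\<^sup>2 + (p - x) / ((n + x) * (m + x))"
    using x by (simp add: divide_simps power2_eq_square) (simp add: m_def algebra_simps)
  finally have "t * profile n p X \<le> t * ((p + x) / (m + x)\<^sup>2 + (p - x) / ((n + x) * (m + x)))"
    using pX t0 by (intro mult_left_mono) linarith+
  also have "\<dots> = Ap x + (p - x) / (n + x) * (t / (m + x))"
    by (simp add: Ap_def distrib_left)
  also have "\<dots> \<le> Ap x + (p - x) / (n + x) * (1 / (j + x - r))"
    using assms x by (intro add_left_mono mult_left_mono) (auto simp: field_simps)
  also have "(p - x) / (n + x) * (1 / (j + x - r)) = - be (x - r)"
  proof -
    have *: "n + r + (x - r) = n + x" "p - x = - (x - r - q)" "j + (x - r) = j + x - r" by (simp_all add: p_def)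
    have "- d / a * (1 / b) = - (d / (b * a))" for a b d :: real by simp
    then show ?thesis unfolding be_def * .
  qed
  finally have "t * profile n p X \<le> Ap x + al (x - r) * 0 - be (x - r)" by simp
  moreover have "profile j q X / t \<le> Bp x - Bm x"
    using profile_antimono[of j q x X] assms x X0 j0 q0 t0 by (simp add: Bp_Bm divide_right_mono)
  moreover have "Ce (x - r) = al (x - r) - be (x - r)" using x by (simp add: Ce_eq)
  ultimately show ?thesis using N by simp
qed

text \<open>With \<open>u z = Ap z / al z\<close> one has \<open>Bp (z + r) = al z / u z\<close>, so
  the claim reads \<open>al x * (1 - u x) <= al y * (1 / u y - u y)\<close>. For
  \<open>j <= n\<close> the ratio \<open>u\<close> is nondecreasing, so it follows from
  \<open>1 / u - u >= 2 * (1 - u)\<close> and \<open>al x <= 2 * al y\<close>.\<close>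

lemma chain_step:
  assumes "j \<le> n" "0 < y" "y \<le> x" "x \<le> p" "t * (s + x) \<le> m + x"
  shows "al x - Ap x \<le> Bp (y + r) - Ap y"
proof -
  define u where "u z = t * (s + z) / (m + z)" for z
  have pos: "0 < m + x" "0 < m + y" "0 < s + x" "0 < s + y" "0 < p + y" using assms m0 s0 p0 by auto
  have "s \<le> m" using assms by (simp add: s_def m_def)
  have Ap: "Ap z = al z * u z" if "0 < m + z" "0 < s + z" for z
    using that by (simp add: Ap_def al_def u_def power2_eq_square)
  have e: "q + (y + r) = p + y" "i + (y + r) = s + y" by (simp_all add: p_def i_def s_def)
  have Bp: "Bp (y + r) = al y / u y"
    using pos t0 unfolding Bp_def e by (simp add: al_def u_def power2_eq_square)
  have u1: "u x \<le> 1" using assms pos by (simp add: u_def)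
  have "(s + y) * (m + x) \<le> (s + x) * (m + y)"
  proof -
    have "(s + x) * (m + y) - (s + y) * (m + x) = (m - s) * (x - y)" by (simp add: algebra_simps)
    moreover have "0 \<le> (m - s) * (x - y)" using \<open>s \<le> m\<close> assms by simp
    ultimately show ?thesis by linarith
  qed
  then have "t * ((s + y) * (m + x)) \<le> t * ((s + x) * (m + y))" using t0 by simp
  then have uy: "u y \<le> u x" using pos by (simp add: u_def divide_simps mult_ac)
  have uy0: "0 < u y" using pos t0 by (simp add: u_def)
  have "2 - u y \<le> 1 / u y"
  proof -
    have "0 \<le> (1 - u y)\<^sup>2" by simp
    then have "(2 - u y) * u y \<le> 1" by (simp add: power2_eq_square algebra_simps)
    then show ?thesis using uy0 by (simp add: pos_le_divide_eq)
  qed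
  then have *: "2 * (1 - u x) \<le> 1 / u y - u y" using uy by simp
  have "al x \<le> 2 * al y"
  proof -
    have "al x \<le> (p + x) / ((m + y) * (s + y))"
      unfolding al_def using assms pos by (intro divide_left_mono mult_mono mult_pos_pos) auto
    also have "\<dots> \<le> (2 * (p + y)) / ((m + y) * (s + y))"
      using assms pos by (intro divide_right_mono mult_nonneg_nonneg) auto
    finally show ?thesis by (simp add: al_def)
  qed
  then have "al x * (1 - u x) \<le> 2 * al y * (1 - u x)" using u1 by (intro mult_right_mono) auto
  also have "\<dots> \<le> al y * (1 / u y - u y)"
    using mult_left_mono[OF *, of "al y"] al_pos[OF assms(2)] by (simp add: mult_ac)
  finally show ?thesis using Ap pos by (simp add: Bp right_diff_distrib)
qed

text \<open>At the first index of a chain \<open>Bp y\<close> alone has to cover the deficit. The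
  estimate \<open>u * (1 - u) <= 1 / 4\<close> disposes of \<open>t\<close>, and
  \<open>p + x <= 4 * (q + y)\<close> holds since \<open>r\<close> and \<open>x\<close> are at most
  \<open>q\<close>.\<close>

lemma chain_start:
  assumes "0 < y" "y \<le> x" "x \<le> q" "r \<le> q" "t * (s + x) \<le> m + x"
  shows "al x - Ap x \<le> Bp y"
proof -
  define u where "u = t * (s + x) / (m + x)"
  have pos: "0 < m + x" "0 < s + x" "0 < i + y" using assms m0 s0 i0 by auto
  have u1: "u \<le> 1" and u0: "0 < u" using assms pos t0 by (simp_all add: u_def)
  have Ap: "Ap x = al x * u" using pos by (simp add: Ap_def al_def u_def power2_eq_square)
  have "u * (1 - u) \<le> 1 / 4"
  proof -
    have "0 \<le> (1 - 2 * u)\<^sup>2" by simp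
    then show ?thesis by (simp add: power2_eq_square algebra_simps)
  qed
  then have "(p + x) * (u * (1 - u)) \<le> (p + x) * (1 / 4)" using assms p0 by (intro mult_left_mono) auto
  also have "\<dots> \<le> q + y" using assms by (simp add: p_def)
  finally have "(p + x) * (u * (1 - u)) * (i + y)\<^sup>2 \<le> (q + y) * (s + x)\<^sup>2"
    using assms s0 pos q0 u0 u1 by (intro mult_mono power_mono) auto
  moreover have "a / (b * c) * (1 - u) \<le> d / f\<^sup>2 / t" 
    if "a * (u * (1 - u)) * f\<^sup>2 \<le> d * c\<^sup>2" "t * c = u * b" "0 < b" "0 < c" "0 < f" for a b c d f
  proof -
    have t: "t = u * b / c" using that by (simp add: field_simps)
    show ?thesis unfolding t using that u0 by (simp add: divide_simps power2_eq_square mult_ac)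
  qed
  moreover have "t * (s + x) = u * (m + x)" using pos by (simp add: u_def)
  ultimately have "al x * (1 - u) \<le> Bp y" unfolding al_def Bp_def using pos by blast
  then show ?thesis by (simp add: Ap right_diff_distrib)
qed

text \<open>With \<open>A = q + x\<close> and \<open>W = n + A\<close> this is
  \<open>W * A / (A + r)\<close> shrunk by the factor \<open>(W + 2 * A) / (W + 3 * A)\<close>; it
  is the range of \<open>t * (s + x)\<close> in which \<open>low_quadratic\<close> applies.\<close>

definition "lo_bound x = (n + q + x) * (q + x) * (n + 3 * (q + x)) / ((p + x) * (n + 4 * (q + x)))"

text \<open>Put \<theta> = \<open>W * A / ((A + r) * (1 + e))\<close>. Then A / \<theta> becomes
  \<open>(A + r) * (1 + e) / W\<close>, and replacing \<open>1 / (1 + e)\<close> by the smaller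
  \<open>1 - e\<close> leaves an inequality linear in \<open>e\<close>. The bound on \<theta> says
  exactly that \<open>e >= A / (W + 2 * A)\<close>.\<close>

lemma low_quadratic:
  fixes A W \<theta> :: real
  assumes "0 < A" "A \<le> W" "0 < \<theta>" "\<theta> \<le> W * A * (W + 2 * A) / ((A + r) * (W + 3 * A))"
  shows "(A + r) / (W + r) + A / W \<le> (A + r) * \<theta> / (W + r)\<^sup>2 + A / \<theta>"
proof -
  have r: "0 < r" using r0 by simp
  define e where "e = W * A / ((A + r) * \<theta>) - 1"
  have th: "\<theta> = W * A / ((A + r) * (1 + e))" and e1: "0 < 1 + e"
    using assms r by (simp_all add: e_def)
  have "\<theta> * ((A + r) * (W + 3 * A)) \<le> W * A * (W + 2 * A)"
    using assms r by (simp add: pos_le_divide_eq)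
  then have "W + 3 * A \<le> W * A * (W + 2 * A) / ((A + r) * \<theta>)"
    using assms r by (simp add: pos_le_divide_eq mult_ac)
  then have "W + 3 * A \<le> (1 + e) * (W + 2 * A)" by (simp add: e_def)
  then have "A \<le> e * (W + 2 * A)" by (simp add: algebra_simps)
  then have "A * W \<le> e * (W + 2 * A) * W" and e0: "0 \<le> e"
    using assms mult_right_mono[of A "e * (W + 2 * A)" W] zero_le_mult_iff[of e "W + 2 * A"] by auto
  moreover have "0 \<le> A * (e * r)" "0 \<le> W * (e * r)" "0 \<le> e * (r * r)" "0 \<le> W * r" "0 \<le> r * r"
    using assms r e0 by simp_all
  moreover have "e * (2 * A * W + A * r + (W + r)\<^sup>2) - (A * W - r * W - r * r)
      = (e * (W + 2 * A) * W - A * W) + A * (e * r) + 2 * (W * (e * r)) + e * (r * r) + W * r + r * r"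
    by (simp add: power2_eq_square algebra_simps)
  ultimately have "A * W - r * W - r * r \<le> e * (2 * A * W + A * r + (W + r)\<^sup>2)" by linarith
  then have "0 \<le> r * (e * (2 * A * W + A * r + (W + r)\<^sup>2) - (A * W - r * W - r * r))"
    using r by simp
  also have "\<dots> = A * W * W * (1 - e) + (r + e * (A + r)) * (W + r)\<^sup>2 - (A + r) * W * (W + r)"
    by (simp add: power2_eq_square algebra_simps)
  finally have "(A + r) * W * (W + r) \<le> A * W * W * (1 - e) + (r + e * (A + r)) * (W + r)\<^sup>2" by simp
  then have "(A + r) / (W + r) \<le> A * W * (1 - e) / (W + r)\<^sup>2 + (r + e * (A + r)) / W"
    using assms r by (simp add: divide_simps power2_eq_square mult_ac)
  also have "A * W * (1 - e) / (W + r)\<^sup>2 \<le> A * W * (1 / (1 + e)) / (W + r)\<^sup>2"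
  proof -
    have "(1 - e) * (1 + e) \<le> 1" by (simp add: algebra_simps)
    then have "1 - e \<le> 1 / (1 + e)" using e1 by (simp add: pos_le_divide_eq)
    then show ?thesis using assms by (intro divide_right_mono mult_left_mono) auto
  qed
  also have "A * W * (1 / (1 + e)) = (A + r) * \<theta>"
    unfolding th using assms(1) r by simp
  also have "(r + e * (A + r)) / W = A / \<theta> - A / W"
  proof -
    have "A / \<theta> = (A + r) * (1 + e) / W"
      unfolding th using assms(1) r by simp
    moreover have "(r + e * (A + r)) / W = (A + r) * (1 + e) / W - A / W"
      unfolding diff_divide_distrib[symmetric] by (simp add: algebra_simps)
    ultimately show ?thesis by simp
  qed
  finally show ?thesis by simp
qed

text \<open>After multiplication by \<open>s + x\<close>, only the ratio
  \<open>g = (s + x) / (i + x) >= 1\<close> separates this from \<open>low_quadratic\<close>.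
  Passing from 1 to \<open>g\<close> adds \<open>A * (g - 1) / W\<close> on the left and A (g^2 - 1)
  / \<theta> on the right, and \<theta> <= W.\<close>

lemma low_zone:
  assumes "r < x" "t * (s + x) \<le> lo_bound x"
  shows "al x + al (x - r) \<le> Ap x + Bp x"
proof -
  define A W \<theta> where "A = q + x" and "W = n + A" and "\<theta> = t * (s + x)"
  have x: "0 < x" using assms r0 by simp
  have pos: "0 < A" "A \<le> W" "0 < W" "0 < s + x" "0 < i + x" "0 < \<theta>" "0 < W + r"
    using x n0 q0 s0 i0 t0 r0 by (auto simp: A_def W_def \<theta>_def)
  have e: "p + x = A + r" "m + x = W + r" "n + q + x = W" "q + x = A" "n + 3 * A = W + 2 * A" "n + 4 * A = W + 3 * A"
    "s + (x - r) = i + x" "m + (x - r) = W" "p + (x - r) = A"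
    by (simp_all add: A_def W_def p_def m_def s_def i_def)
  have \<theta>le: "\<theta> \<le> W * A * (W + 2 * A) / ((A + r) * (W + 3 * A))"
    using assms(2) unfolding lo_bound_def e \<theta>_def .
  also have "\<dots> \<le> W"
  proof -
    have "A * (W + 2 * A) \<le> (A + r) * (W + 3 * A)" using pos r0 by (intro mult_mono) auto
    then have "W * (A * (W + 2 * A)) \<le> W * ((A + r) * (W + 3 * A))" using pos by (intro mult_left_mono) auto
    then show ?thesis using pos r0 by (simp add: pos_divide_le_eq mult.assoc)
  qed
  finally have "\<theta> \<le> W" .
  define g where "g = (s + x) / (i + x)"
  have g: "1 \<le> g" using pos s0 by (simp add: g_def)
  have "A * g / W - A / W \<le> A * g\<^sup>2 / \<theta> - A / \<theta>"
  proof -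
    have "A * (g - 1) * 1 / W \<le> A * (g - 1) * (g + 1) / \<theta>"
      using pos g \<open>\<theta> \<le> W\<close> by (intro frac_le mult_left_mono mult_nonneg_nonneg) auto
    then show ?thesis by (simp add: algebra_simps power2_eq_square diff_divide_distrib)
  qed
  with low_quadratic[OF pos(1,2,6) \<theta>le]
  have "(A + r) / (W + r) + A * g / W \<le> (A + r) * \<theta> / (W + r)\<^sup>2 + A * g\<^sup>2 / \<theta>" by simp
  then have "((A + r) / (W + r) + A * g / W) / (s + x) \<le> ((A + r) * \<theta> / (W + r)\<^sup>2 + A * g\<^sup>2 / \<theta>) / (s + x)"
    using pos by (intro divide_right_mono) auto
  moreover have "al x + al (x - r) = ((A + r) / (W + r) + A * g / W) / (s + x)"
  proof -
    have "al x = (A + r) / (W + r) / (s + x)" "al (x - r) = A * g / W / (s + x)"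
      unfolding al_def e g_def using pos by simp_all
    then show ?thesis by (simp only: add_divide_distrib)
  qed
  moreover have "Ap x + Bp x = ((A + r) * \<theta> / (W + r)\<^sup>2 + A * g\<^sup>2 / \<theta>) / (s + x)"
  proof -
    have "Ap x = (A + r) * \<theta> / (W + r)\<^sup>2 / (s + x)" "Bp x = A * g\<^sup>2 / \<theta> / (s + x)"
      unfolding Ap_def Bp_def e g_def \<theta>_def using pos by (simp_all add: power2_eq_square)
    then show ?thesis by (simp only: add_divide_distrib)
  qed
  ultimately show ?thesis by simp
qed

end

text \<open>
  The four polynomials below are defined over any type with \<open>+\<close>, \<open>-\<close>, \<open>*\<close>, so that the same definition is a real
  number and, over \<^typ>\<open>pex\<close>, a syntactic polynomial. After substituting nonnegative slack variables for the
  hypotheses on the parameters, all their coefficients turn out to be nonnegative.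
\<close>

definition harmonic_gap :: "'a \<Rightarrow> 'a \<Rightarrow> 'a \<Rightarrow> 'a \<Rightarrow> 'a \<Rightarrow> 'a::{plus, minus, times}" where
  "harmonic_gap one n j q r = (let p = q + r; m = n + p; s = j + p; X = p + q + one; h = n + r; c = s + p + one + one in
     (p * j * c * (h + one) + q * m * c * (s + one) - (p * (h + one) + q * m) * (j + one) * (s + one))
        * (m + X) * (j + X) * (s + X) * (h + X)
     + (p * j * c * (h + X) + q * m * c * (s + X) - (p * (h + X) + q * m) * (j + X) * (s + X))
        * (m + one) * (j + one) * (s + one) * (h + one))"

definition zone_high_gap :: "'a \<Rightarrow> 'a \<Rightarrow> 'a \<Rightarrow> 'a \<Rightarrow> 'a::{plus, minus, times}" where
  "zone_high_gap one n q r = (let p = q + r; m = n + p; X = p + q + one; h = n + r in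
     ((p * (h + one) + q * m) * (m + X) * (h + X) + (p * (h + X) + q * m) * (m + one) * (h + one)) * (n + X + X) * m
     - (p + p) * (m + p + one + one) * m * (m + one) * (h + one) * (h + X)
     - (q + q) * (m + one) * (h + one) * (m + X) * (h + X) * (n + X + X))"

definition zone_low_gap :: "'a \<Rightarrow> 'a \<Rightarrow> 'a \<Rightarrow> 'a \<Rightarrow> 'a \<Rightarrow> 'a::{plus, minus, times}" where
  "zone_low_gap one n q r x = (let p = q + r; m = n + p; X = p + q + one; h = n + r; A = q + x; W = n + A in
     ((p * (h + one) + q * m) * (m + X) * (h + X) + (p * (h + X) + q * m) * (m + one) * (h + one))
        * (n + X + X) * (m + x) * (A + r) * (W + A + A + A) * W * A * (W + A + A)
     - (p + p) * (m + p + one + one) * (m + one) * (h + one) * (h + X) * W * A * (W + A + A) * W * A * (W + A + A)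
     - (q + q) * (m + one) * (h + one) * (m + X) * (h + X) * (n + X + X) * (m + x)
        * (A + r) * (W + A + A + A) * (A + r) * (W + A + A + A))"

definition crossing_gap :: "'a \<Rightarrow> 'a \<Rightarrow> 'a \<Rightarrow> 'a \<Rightarrow> 'a \<Rightarrow> 'a \<Rightarrow> 'a::{plus, minus, times}" where
  "crossing_gap one n j q r u = (let p = q + r; m = n + p; s = j + p; i = j + q; X = p + q + one; h = n + r;
       four = one + one + one + one; y = u + u + r + r - one in
     (four * (q + u) * (s + u) * (s + u) - (p + u) * (i + u) * (i + u)) * (p + u)
        * (m + y) * (j + y) * (s + y) * (h + y) * (m + X) * (j + X) * (s + X) * (h + X)
     - ((p * j * (h + y) + q * m * (s + y)) * (m + X) * (j + X) * (s + X) * (h + X)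
        - (p * j * (h + X) + q * m * (s + X)) * (m + y) * (j + y) * (s + y) * (h + y))
        * (four + four) * (q + u) * (m + u) * (s + u) * (s + u) * (s + u))"

lemma harmonic_gap_nonneg:
  fixes n j q r :: real
  assumes "0 \<le> n" "n \<le> j" "1 \<le> r" "r + 1 \<le> q"
  shows "0 \<le> harmonic_gap 1 n j q r"
proof -
  have "0 \<le> pev (harmonic_gap (PC 1) (PV 0) (PV 0 + PV 3) (PV 1 + PC 1 + PC 1 + PV 2) (PV 1 + PC 1))
      (penv [n, r - 1, q - r - 1, j - n])"
    by (rule pev_nonneg, code_simp) (use assms in auto)
  moreover have "pev (harmonic_gap a b c d f) e = harmonic_gap (pev a e) (pev b e) (pev c e) (pev d e) (pev f e)" for a b c d f e
    by (simp only: harmonic_gap_def Let_def pev_arith)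
  ultimately show ?thesis by (simp add: penv_def)
qed

text \<open>Strictness is certified by subtracting 1 first: after the substitution the constant
  coefficient is at least 1.\<close>

lemma zone_high_gap_pos:
  fixes n q r :: real
  assumes "0 \<le> n" "1 \<le> r" "r + 1 \<le> q"
  shows "0 < zone_high_gap 1 n q r"
proof -
  have "0 \<le> pev (zone_high_gap (PC 1) (PV 0) (PV 1 + PC 1 + PC 1 + PV 2) (PV 1 + PC 1) - PC 1)
      (penv [n, r - 1, q - r - 1])"
    by (rule pev_nonneg, code_simp) (use assms in auto)
  moreover have "pev (zone_high_gap a b c d) e = zone_high_gap (pev a e) (pev b e) (pev c e) (pev d e)" for a b c d e
    by (simp only: zone_high_gap_def Let_def pev_arith)
  ultimately show ?thesis by (simp add: penv_def)
qed

lemma zone_low_gap_pos: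
  fixes n q r x :: real
  assumes "0 \<le> n" "1 \<le> r" "r + 1 \<le> x" "x \<le> q"
  shows "0 < zone_low_gap 1 n q r x"
proof -
  have "0 \<le> pev (zone_low_gap (PC 1) (PV 0) (PV 1 + PC 1 + PC 1 + PV 2 + PV 3) (PV 1 + PC 1) (PV 1 + PC 1 + PC 1 + PV 2) - PC 1)
      (penv [n, r - 1, x - r - 1, q - x])"
    by (rule pev_nonneg, code_simp) (use assms in auto)
  moreover have "pev (zone_low_gap a b c d f) e = zone_low_gap (pev a e) (pev b e) (pev c e) (pev d e) (pev f e)" for a b c d e f
    by (simp only: zone_low_gap_def Let_def pev_arith)
  ultimately show ?thesis by (simp add: penv_def)
qed

text \<open>The sign of \<open>q - r\<close> decides which of \<open>1 <= u\<close> and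
  \<open>q <= u - 1 + r\<close> is the stronger constraint. Each case uses slack variables for that
  constraint, for \<open>d >= 1\<close> and for the distance of \<open>q\<close> and
  \<open>r\<close>.\<close>

lemma crossing_gap_nonneg:
  fixes n j q r u :: real
  assumes "0 \<le> n" "0 \<le> j" "1 \<le> u" "q \<le> u - 1 + r" "2 * (u - 1) + r + 1 \<le> 2 * q"
  shows "0 \<le> crossing_gap 1 n j q r u"
proof -
  define d where "d = 2 * q - r - 2 * (u - 1)"
  have hom: "pev (crossing_gap a b c d f g) e = crossing_gap (pev a e) (pev b e) (pev c e) (pev d e) (pev f e) (pev g e)" for a b c d e f g
    by (simp only: crossing_gap_def Let_def pev_arith)
  show ?thesis
  proof (cases "q \<le> r")
    case True
    have "0 \<le> pev (crossing_gap (PC 1) (PV 0) (PV 1) (PC 2 * PV 2 + PC 1 + PV 3 + PV 4) (PC 2 * PV 2 + PC 1 + PV 3 + PV 4 + PV 4) (PV 2 + PC 1))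
        (penv [n, j, u - 1, d - 1, r - q])"
      by (rule pev_nonneg, code_simp) (use assms True in \<open>auto simp: d_def\<close>)
    then show ?thesis by (simp add: hom penv_def d_def algebra_simps)
  next
    case False
    have "0 \<le> pev (crossing_gap (PC 1) (PV 0) (PV 1) (PC 2 * PV 2 + PC 1 + PV 3 + PV 4) (PC 2 * PV 2 + PC 1 + PV 3) (PV 2 + PV 4 + PC 1))
        (penv [n, j, u - 1 + r - q, d - 1, q - r])"
      by (rule pev_nonneg, code_simp) (use assms False in \<open>auto simp: d_def\<close>)
    then show ?thesis by (simp add: hom penv_def d_def algebra_simps)
  qed
qed

section \<open>From the polynomial gaps to inequalities between fractions\<close>

lemma less_if_diff: "a - b = c \<Longrightarrow> 0 < c \<Longrightarrow> b < (a::real)"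
  and le_if_diff: "a - b = c \<Longrightarrow> 0 \<le> c \<Longrightarrow> b \<le> (a::real)"
  by simp_all

text \<open>The shifted denominators are opaque positive variables, so clearing them never expands
  the shifts. Only the sum of the gaps at the two points is assumed nonnegative.\<close>

lemma quotient_gap:
  fixes p j q m c m1 j1 s1 h1 m2 j2 s2 h2 :: real
  assumes "0 \<le> (p * j * c * h1 + q * m * c * s1 - (p * h1 + q * m) * j1 * s1) * m2 * j2 * s2 * h2
     + (p * j * c * h2 + q * m * c * s2 - (p * h2 + q * m) * j2 * s2) * m1 * j1 * s1 * h1"
    and pos: "0 < c" "0 < m1" "0 < j1" "0 < s1" "0 < h1" "0 < m2" "0 < j2" "0 < s2" "0 < h2"
  shows "(p / m1 + q * m / (m1 * h1) + (p / m2 + q * m / (m2 * h2))) / c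
    \<le> p * j * (1 / (m1 * j1 * s1)) + q * m * (1 / (m1 * j1 * h1)) + (p * j * (1 / (m2 * j2 * s2)) + q * m * (1 / (m2 * j2 * h2)))"
proof -
  have *: "p * j * (1 / (a * b * d)) + q * m * (1 / (a * b * e)) - (p / a + q * m / (a * e)) / c
      = (p * j * c * e + q * m * c * d - (p * e + q * m) * b * d) / (c * a * b * d * e)"
    if "0 < a" "0 < b" "0 < d" "0 < e" for a b d e
    using that pos(1) by (simp add: divide_simps) (simp add: algebra_simps)
  have **: "0 \<le> A / (c * D) + B / (c * E)" if "0 \<le> A * E + B * D" "0 < D" "0 < E" for A B D E
  proof -
    have "A / (c * D) + B / (c * E) = (A * E + B * D) / (c * D * E)"
      using that pos(1) by (simp add: divide_simps)
    then show ?thesis using that pos(1) by simp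
  qed
  have "0 \<le> (p * j * c * h1 + q * m * c * s1 - (p * h1 + q * m) * j1 * s1) / (c * (m1 * j1 * s1 * h1))
     + (p * j * c * h2 + q * m * c * s2 - (p * h2 + q * m) * j2 * s2) / (c * (m2 * j2 * s2 * h2))"
    by (rule **) (use assms in \<open>simp_all add: mult.assoc\<close>)
  also have "\<dots> = p * j * (1 / (m1 * j1 * s1)) + q * m * (1 / (m1 * j1 * h1)) - (p / m1 + q * m / (m1 * h1)) / c
     + (p * j * (1 / (m2 * j2 * s2)) + q * m * (1 / (m2 * j2 * h2)) - (p / m2 + q * m / (m2 * h2)) / c)"
    using *[OF pos(2-5)] *[OF pos(6-9)] by (simp add: mult.assoc)
  finally show ?thesis by (simp add: add_divide_distrib)
qed

text \<open>Multiplied by \<open>z\<close>, the claim says that a convex quadratic is negative on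
  [l, h]; the chord identity derives this from the two ends.\<close>

lemma convex_quotient_less:
  fixes K c g :: real
  assumes "0 < l" "l \<le> z" "z \<le> h" "0 \<le> K" "K * l + c / l < g" "K * h + c / h < g"
  shows "K * z + c / z < g"
proof -
  have z: "0 < z" "0 < h" using assms by auto
  have l: "K * l * l + c < g * l" and h: "K * h * h + c < g * h"
    using assms(1,5,6) z by (simp_all add: field_simps)
  have "K * z * z + c < g * z"
  proof (cases "l = h")
    case True then show ?thesis using assms l by simp
  next
    case False
    then have lh: "0 < h - l" using assms by simp
    have "K * ((z - l) * (h - z)) \<ge> 0" using assms by simp
    moreover have "(z - l) * (g * h - (K * h * h + c)) + (h - z) * (g * l - (K * l * l + c)) > 0"
    proof (cases "z = l")
      case True then show ?thesis using l lh by (simp add: mult_pos_pos)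
    next
      case False
      then have "0 < z - l" using assms by simp
      then show ?thesis using h l assms by (intro add_pos_nonneg mult_pos_pos mult_nonneg_nonneg) auto
    qed
    moreover have "(h - l) * (g * z - (K * z * z + c))
      = (z - l) * (g * h - (K * h * h + c)) + (h - z) * (g * l - (K * l * l + c)) + (h - l) * (K * ((z - l) * (h - z)))"
      by (simp add: algebra_simps)
    ultimately have "0 < (h - l) * (g * z - (K * z * z + c))" using lh by (simp add: add_pos_nonneg)
    then show ?thesis using lh by (simp add: zero_less_mult_iff)
  qed
  then show ?thesis using z by (simp add: field_simps)
qed

context monomial_pair
begin

text \<open>A lower bound for \<open>(s + p + 2) * (Ce X + Ce 1)\<close> that does not depend on \<open>j\<close>.\<close>

definition "Ce_lower = p / (m + 1) + q * m / ((m + 1) * (n + r + 1)) + (p / (m + X) + q * m / ((m + X) * (n + r + X)))"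

text \<open>The weight \<open>s + p + 2\<close> equals \<open>j + 2 * X - 2 * q\<close>. It is
  chosen to match the factor \<open>j + 2 * X\<close> that \<open>profile_le\<close> puts into the
  denominator for the other monomial, so that \<open>j\<close> can be removed on both sides.\<close>

lemma Ce_lower_le:
  assumes "n \<le> j" "r + 1 \<le> q"
  shows "Ce_lower / (s + p + 2) \<le> Ce X + Ce 1"
proof -
  have "0 \<le> (p * j * (s + p + 2) * (n + r + 1) + q * m * (s + p + 2) * (s + 1) - (p * (n + r + 1) + q * m) * (j + 1) * (s + 1))
        * (m + X) * (j + X) * (s + X) * (n + r + X)
     + (p * j * (s + p + 2) * (n + r + X) + q * m * (s + p + 2) * (s + X) - (p * (n + r + X) + q * m) * (j + X) * (s + X))
        * (m + 1) * (j + 1) * (s + 1) * (n + r + 1)"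
    using harmonic_gap_nonneg[OF n0 assms(1) r0 assms(2)]
    unfolding harmonic_gap_def Let_def p_def[symmetric] m_def[symmetric] s_def[symmetric] X_def[symmetric]
    by (simp only: add.assoc one_add_one)
  from quotient_gap[OF this] show ?thesis
    using n0 j0 r0 p0 m0 s0 X0 unfolding Ce_lower_def Ce_def recip3_def by (simp add: add.commute)
qed

lemma Ce_lower_eq:
  "Ce_lower = ((p * (n + r + 1) + q * m) * (m + X) * (n + r + X) + (p * (n + r + X) + q * m) * (m + 1) * (n + r + 1))
    / ((m + 1) * (n + r + 1) * (m + X) * (n + r + X))"
proof -
  have "p / a + q * m / (a * b) + (p / c + q * m / (c * d))
      = ((p * b + q * m) * c * d + (p * d + q * m) * a * b) / (a * b * c * d)"
    if "0 < a" "0 < b" "0 < c" "0 < d" for a b c d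
  proof -
    have "p / a + q * m / (a * b) = (p * b + q * m) / (a * b)" "p / c + q * m / (c * d) = (p * d + q * m) / (c * d)"
      using that by (simp_all add: divide_simps)
    then show ?thesis using that by (simp add: divide_simps mult_ac)
  qed
  then show ?thesis unfolding Ce_lower_def using n0 r0 m0 X0 by simp
qed

text \<open>\<open>profile_le\<close> at \<open>X\<close>, times the factor \<open>m + p + 2\<close>
  that appears when \<open>t\<close> is expressed by \<open>t * (s + x)\<close> and the weight
  \<open>s + p + 2\<close>.\<close>

definition "slope = 2 * p * (m + p + 2) / ((m + X) * (n + 2 * X))"

text \<open>The upper end \<open>t * (s + x) = m + x\<close> of the excluded interval, with
  \<open>2 * q / (m + x)\<close> enlarged to \<open>2 * q / m\<close> to remove
  \<open>x\<close>.\<close>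

lemma zone_high:
  assumes "r + 1 \<le> q"
  shows "slope + 2 * q / m < Ce_lower"
proof -
  have "0 < U * (n + 2 * X) * m - 2 * p * (m + p + 2) * m * a * b * d - 2 * q * a * b * c * d * (n + 2 * X)
     \<Longrightarrow> 2 * p * (m + p + 2) / (c * (n + 2 * X)) + 2 * q / m < U / (a * b * c * d)"
    if "0 < a" "0 < b" "0 < c" "0 < d" for U a b c d
  proof -
    assume A: "0 < U * (n + 2 * X) * m - 2 * p * (m + p + 2) * m * a * b * d - 2 * q * a * b * c * d * (n + 2 * X)"
    have pos: "0 < n + 2 * X" "0 < m" using n0 X0 m0 by auto
    have "U / (a * b * c * d) - (2 * p * (m + p + 2) / (c * (n + 2 * X)) + 2 * q / m)
      = (U * (n + 2 * X) * m - 2 * p * (m + p + 2) * m * a * b * d - 2 * q * a * b * c * d * (n + 2 * X)) / (a * b * c * d * (n + 2 * X) * m)"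
      (is "_ = ?R")
    proof -
      have "U / (a * b * c * d) = U * (n + 2 * X) * m / (a * b * c * d * (n + 2 * X) * m)"
        "2 * p * (m + p + 2) / (c * (n + 2 * X)) = 2 * p * (m + p + 2) * m * a * b * d / (a * b * c * d * (n + 2 * X) * m)"
        "2 * q / m = 2 * q * a * b * c * d * (n + 2 * X) / (a * b * c * d * (n + 2 * X) * m)"
        using that pos by simp_all
      then show ?thesis by (simp only: diff_divide_distrib add_divide_distrib diff_diff_eq)
    qed
    moreover have "0 < ?R" using A that pos by (intro divide_pos_pos mult_pos_pos) auto
    ultimately show ?thesis by (rule less_if_diff)
  qed
  note * = this
  have "0 < ((p * (n + r + 1) + q * m) * (m + X) * (n + r + X) + (p * (n + r + X) + q * m) * (m + 1) * (n + r + 1)) * (n + 2 * X) * m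
     - 2 * p * (m + p + 2) * m * (m + 1) * (n + r + 1) * (n + r + X)
     - 2 * q * (m + 1) * (n + r + 1) * (m + X) * (n + r + X) * (n + 2 * X)"
    using zone_high_gap_pos[OF n0 r0 assms]
    unfolding zone_high_gap_def Let_def p_def[symmetric] m_def[symmetric] X_def[symmetric]
    by (simp only: add.assoc one_add_one mult_2[symmetric] mult.right_neutral)
  from *[OF _ _ _ _ this] show ?thesis
    using n0 r0 m0 X0 unfolding slope_def Ce_lower_eq by (simp add: mult_ac)
qed

text \<open>The lower end \<open>t * (s + x) = lo_bound x\<close> of the excluded interval.\<close>

lemma zone_low:
  assumes "r + 1 \<le> x" "x \<le> q"
  shows "slope / (m + x) * lo_bound x + 2 * q / lo_bound x < Ce_lower"
proof -
  define A W where "A = q + x" and "W = n + A"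
  have pos: "0 < n + 2 * X" "0 < m + x" "0 < A" "0 < W" "0 < A + r" "0 < m + X"
    using n0 X0 m0 q0 r0 assms by (auto simp: A_def W_def)
  have lo: "lo_bound x = W * A * (W + 2 * A) / ((A + r) * (W + 3 * A))"
    by (simp add: lo_bound_def A_def W_def p_def add_ac)
  have *: "2 * p * (m + p + 2) / (c * (n + 2 * X)) / (m + x) * (W * A * (W + 2 * A) / ((A + r) * (W + 3 * A)))
       + 2 * q / (W * A * (W + 2 * A) / ((A + r) * (W + 3 * A))) < U / (a * b * c * d)"
    if A: "0 < U * (n + 2 * X) * (m + x) * (A + r) * (W + 3 * A) * W * A * (W + 2 * A)
       - 2 * p * (m + p + 2) * a * b * d * W * A * (W + 2 * A) * W * A * (W + 2 * A)
       - 2 * q * a * b * c * d * (n + 2 * X) * (m + x) * (A + r) * (W + 3 * A) * (A + r) * (W + 3 * A)"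
      (is "0 < ?N") and that: "0 < a" "0 < b" "0 < c" "0 < d" for U a b c d
  proof -
    let ?D = "a * b * c * d * (n + 2 * X) * (m + x) * (A + r) * (W + 3 * A) * W * A * (W + 2 * A)"
    have w: "W + 2 * A \<noteq> 0" "W + 3 * A \<noteq> 0" "0 < W + 2 * A" "0 < W + 3 * A" using pos by auto
    have "U / (a * b * c * d) = U * (n + 2 * X) * (m + x) * (A + r) * (W + 3 * A) * W * A * (W + 2 * A) / ?D"
      using that pos w by simp
    moreover have "2 * p * (m + p + 2) / (c * (n + 2 * X)) / (m + x) * (W * A * (W + 2 * A) / ((A + r) * (W + 3 * A)))
      = 2 * p * (m + p + 2) * a * b * d * W * A * (W + 2 * A) * W * A * (W + 2 * A) / ?D"
      using that pos w by simp
    moreover have "2 * q / (W * A * (W + 2 * A) / ((A + r) * (W + 3 * A)))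
      = 2 * q * a * b * c * d * (n + 2 * X) * (m + x) * (A + r) * (W + 3 * A) * (A + r) * (W + 3 * A) / ?D"
      using that pos w by simp
    ultimately have "U / (a * b * c * d) - (2 * p * (m + p + 2) / (c * (n + 2 * X)) / (m + x) * (W * A * (W + 2 * A) / ((A + r) * (W + 3 * A)))
       + 2 * q / (W * A * (W + 2 * A) / ((A + r) * (W + 3 * A)))) = ?N / ?D"
      by (simp only: diff_divide_distrib add_divide_distrib diff_diff_eq)
    moreover have "0 < ?N / ?D" by (rule divide_pos_pos[OF A]) (intro mult_pos_pos that pos w)
    ultimately show ?thesis by (rule less_if_diff)
  qed
  have "0 < ((p * (n + r + 1) + q * m) * (m + X) * (n + r + X) + (p * (n + r + X) + q * m) * (m + 1) * (n + r + 1))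
        * (n + 2 * X) * (m + x) * (A + r) * (W + 3 * A) * W * A * (W + 2 * A)
     - 2 * p * (m + p + 2) * (m + 1) * (n + r + 1) * (n + r + X) * W * A * (W + 2 * A) * W * A * (W + 2 * A)
     - 2 * q * (m + 1) * (n + r + 1) * (m + X) * (n + r + X) * (n + 2 * X) * (m + x)
        * (A + r) * (W + 3 * A) * (A + r) * (W + 3 * A)"
  proof -
    have "z + y + y = z + 2 * y" "z + y + y + y = z + 3 * y" for y z :: real by simp_all
    then show ?thesis
    using zone_low_gap_pos[OF n0 r0 assms]
    unfolding zone_low_gap_def Let_def p_def[symmetric] m_def[symmetric] X_def[symmetric] A_def[symmetric] W_def[symmetric]
    by (simp only: add.assoc one_add_one mult_2[symmetric] mult.right_neutral)
  qed
  from *[OF this] show ?thesis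
    using n0 r0 m0 X0 unfolding slope_def Ce_lower_eq lo by simp
qed

text \<open>Condition (4) at \<open>k = p + q\<close> is what rules out these intermediate values of \<open>t\<close>.\<close>

lemma excluded_zone:
  assumes "n \<le> j" "r + 1 \<le> x" "x \<le> q" "lo_bound x \<le> t * (s + x)" "t * (s + x) \<le> m + x"
  shows "t * profile n p X + profile j q X / t < Ce X + Ce 1"
proof -
  define \<theta> where "\<theta> = t * (s + x)"
  have x: "0 < x" using assms r0 by simp
  have pos: "0 < m + x" "0 < s + x" "0 < n + 2 * X" "0 < m + X" "0 < s + p + 2" "0 < \<theta>" "0 < lo_bound x"
    using x n0 m0 s0 X0 p0 q0 t0 by (auto simp: \<theta>_def lo_bound_def intro!: divide_pos_pos mult_pos_pos)
  have slope0: "0 \<le> slope / (m + x)" using pos p0 m0 by (simp add: slope_def)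
  \<comment> \<open>The coefficients do not involve \<theta>, so only the two ends of its interval
    have to be checked.\<close>
  have "slope / (m + x) * \<theta> + 2 * q / \<theta> < Ce_lower"
  proof (rule convex_quotient_less[OF pos(7) _ _ slope0 zone_low])
    have "2 * q / (m + x) \<le> 2 * q / m" using x m0 q0 by (intro divide_left_mono) auto
    then show "slope / (m + x) * (m + x) + 2 * q / (m + x) < Ce_lower"
      using zone_high assms pos by simp
  qed (use assms in \<open>auto simp: \<theta>_def\<close>)
  then have "(slope / (m + x) * \<theta> + 2 * q / \<theta>) / (s + p + 2) < Ce_lower / (s + p + 2)"
    using pos by (intro divide_strict_right_mono) auto
  moreover have "Ce_lower / (s + p + 2) \<le> Ce X + Ce 1" using assms by (intro Ce_lower_le) auto
  moreover have "t * profile n p X \<le> slope / (m + x) * \<theta> / (s + p + 2)"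
  proof -
    have "profile n p X \<le> 2 * p / ((m + X) * (n + 2 * X))"
      using profile_le[of n p X] n0 p0 X0 by (simp add: m_def)
    then have "t * profile n p X \<le> t * (2 * p / ((m + X) * (n + 2 * X)))"
      by (rule mult_left_mono) (use t0 in auto)
    also have "\<dots> \<le> \<theta> * (m + p + 2) / ((m + x) * (s + p + 2)) * (2 * p / ((m + X) * (n + 2 * X)))"
    proof (rule mult_right_mono)
      \<comment> \<open>The sign comes from \<open>s - m = j - n\<close>.\<close>
      have "(m + p + 2) * (s + x) - (s + p + 2) * (m + x) = (p + 2 - x) * (s - m)" by (simp add: algebra_simps)
      moreover have "0 \<le> (p + 2 - x) * (s - m)" using assms p0 by (simp add: s_def m_def)
      ultimately have "(s + p + 2) * (m + x) \<le> (m + p + 2) * (s + x)" by linarith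
      then have "(s + p + 2) / (s + x) \<le> (m + p + 2) / (m + x)" using pos by (simp add: divide_simps)
      then have "\<theta> / (s + p + 2) * ((s + p + 2) / (s + x)) \<le> \<theta> / (s + p + 2) * ((m + p + 2) / (m + x))"
        using pos by (intro mult_left_mono) auto
      moreover have "t = \<theta> / (s + x)" using pos by (simp add: \<theta>_def)
      ultimately show "t \<le> \<theta> * (m + p + 2) / ((m + x) * (s + p + 2))" using pos by (simp add: mult_ac)
    qed (use pos p0 in auto)
    finally have "t * profile n p X \<le> \<theta> * (m + p + 2) / ((m + x) * (s + p + 2)) * (2 * p / ((m + X) * (n + 2 * X)))" .
    then show ?thesis by (simp add: slope_def mult_ac)
  qed
  moreover have "profile j q X / t \<le> 2 * q / \<theta> / (s + p + 2)"
  proof -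
    have e: "j + q + X = s + 2 * q + 1" "j + 2 * X = s + p + 2 + 2 * q" by (simp_all add: X_def s_def p_def)
    have "profile j q X \<le> 2 * q / ((s + 2 * q + 1) * (s + p + 2 + 2 * q))"
      using profile_le[of j q X] j0 q0 p0 X0 unfolding e by simp
    also have "\<dots> \<le> 2 * q / ((s + x) * (s + p + 2))"
      using assms s0 p0 q0 x by (intro divide_left_mono mult_mono) auto
    finally have "profile j q X / t \<le> 2 * q / ((s + x) * (s + p + 2)) / t" using t0 by (intro divide_right_mono) auto
    then show ?thesis by (simp add: \<theta>_def mult_ac)
  qed
  ultimately show ?thesis by (simp add: add_divide_distrib)
qed

text \<open>This is \<open>(al u)^2 / (4 * Ap u * Bp u)\<close>, in which \<open>t\<close>
  cancels.\<close>

definition "hump u = (p + u) * (i + u)\<^sup>2 / (4 * (q + u) * (s + u)\<^sup>2)"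

text \<open>For \<open>u = k' + 1\<close> the argument \<open>2 * (u + r) - 1\<close> belongs to the
  index \<open>2 * (k' + r)\<close>. The drop of \<open>Ce\<close> from there to \<open>X\<close> is
  compensated by the gain of \<open>hump_gain\<close>; as neither side involves \<open>t\<close>,
  this is a statement about \<open>crossing_gap\<close>.\<close>

lemma crossing:
  assumes "1 \<le> u" "q \<le> u - 1 + r" "2 * (u - 1) + r + 1 \<le> 2 * q"
  shows "Ce (2 * (u + r) - 1) - Ce X \<le> al u * (1 - hump u) / 2"
proof -
  define y where "y = u + u + r + r - 1"
  have y0: "0 < y" using assms r0 by (simp add: y_def)
  have gen: "Pj * (1 / (m1 * j1 * s1)) + Qm * (1 / (m1 * j1 * h1)) - (Pj * (1 / (m2 * j2 * s2)) + Qm * (1 / (m2 * j2 * h2)))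
      \<le> P / (M * S) * (1 - P * I / (4 * Q * (S * S))) / 2"
    if le: "0 \<le> (4 * Q * S * S - P * I) * P * m1 * j1 * s1 * h1 * m2 * j2 * s2 * h2
     - ((Pj * h1 + Qm * s1) * m2 * j2 * s2 * h2 - (Pj * h2 + Qm * s2) * m1 * j1 * s1 * h1) * 8 * Q * M * S * S * S" (is "0 \<le> ?N")
      and pos: "0 < m1" "0 < j1" "0 < s1" "0 < h1" "0 < m2" "0 < j2" "0 < s2" "0 < h2" "0 < Q" "0 < M" "0 < S"
    for Pj Qm m1 j1 s1 h1 m2 j2 s2 h2 P I Q M S :: real
  proof -
    let ?D = "m1 * j1 * s1 * h1 * m2 * j2 * s2 * h2 * 8 * Q * M * S * S * S"
    have "Pj * (1 / (m1 * j1 * s1)) + Qm * (1 / (m1 * j1 * h1)) = (Pj * h1 + Qm * s1) * m2 * j2 * s2 * h2 * 8 * Q * M * S * S * S / ?D"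
      using pos by (simp add: divide_simps)
    moreover have "Pj * (1 / (m2 * j2 * s2)) + Qm * (1 / (m2 * j2 * h2)) = (Pj * h2 + Qm * s2) * m1 * j1 * s1 * h1 * 8 * Q * M * S * S * S / ?D"
      using pos by (simp add: divide_simps)
    moreover have "P / (M * S) * (1 - P * I / (4 * Q * (S * S))) / 2 = (4 * Q * S * S - P * I) * P * m1 * j1 * s1 * h1 * m2 * j2 * s2 * h2 / ?D"
      using pos by (simp add: divide_simps)
    ultimately have "P / (M * S) * (1 - P * I / (4 * Q * (S * S))) / 2
       - (Pj * (1 / (m1 * j1 * s1)) + Qm * (1 / (m1 * j1 * h1)) - (Pj * (1 / (m2 * j2 * s2)) + Qm * (1 / (m2 * j2 * h2)))) = ?N / ?D"
      by (simp only: diff_divide_distrib left_diff_distrib)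
    moreover have "0 \<le> ?N / ?D" by (rule divide_nonneg_pos[OF le]) (use pos in \<open>intro mult_pos_pos; simp\<close>)
    ultimately show ?thesis by (rule le_if_diff)
  qed
  have "0 \<le> (4 * (q + u) * (s + u) * (s + u) - (p + u) * ((i + u) * (i + u))) * (p + u)
      * (m + y) * (j + y) * (s + y) * (n + r + y) * (m + X) * (j + X) * (s + X) * (n + r + X)
    - ((p * j * (n + r + y) + q * m * (s + y)) * (m + X) * (j + X) * (s + X) * (n + r + X)
      - (p * j * (n + r + X) + q * m * (s + X)) * (m + y) * (j + y) * (s + y) * (n + r + y))
      * 8 * (q + u) * (m + u) * (s + u) * (s + u) * (s + u)"
  proof -
    have "1 + 1 + 1 + 1 = (4::real)" "4 + 4 = (8::real)" by simp_all
    then show ?thesis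
      using crossing_gap_nonneg[OF n0 j0 assms]
      unfolding crossing_gap_def Let_def p_def[symmetric] m_def[symmetric] s_def[symmetric] i_def[symmetric] X_def[symmetric] y_def[symmetric]
      by (simp only: mult.assoc)
  qed
  from gen[OF this] have "Ce y - Ce X \<le> al u * (1 - hump u) / 2"
    using n0 j0 r0 m0 s0 X0 p0 q0 assms y0 unfolding Ce_def recip3_def al_def hump_def power2_eq_square by simp
  moreover have "y = 2 * (u + r) - 1" by (simp add: y_def)
  ultimately show ?thesis by simp
qed

lemma big_Ap: "0 < x \<Longrightarrow> m + x \<le> t * (s + x) \<Longrightarrow> al x \<le> Ap x"
proof -
  assume x: "0 < x" and A: "m + x \<le> t * (s + x)"
  have pos: "0 < m + x" "0 < s + x" using x m0 s0 by auto
  then have "1 / (s + x) \<le> t / (m + x)" using A by (simp add: divide_simps)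
  then have "(p + x) / (m + x) * (1 / (s + x)) \<le> (p + x) / (m + x) * (t / (m + x))"
    using x p0 pos by (intro mult_left_mono) auto
  then show "al x \<le> Ap x" by (simp add: al_def Ap_def power2_eq_square mult_ac)
qed

text \<open>Let \<open>z = al u / (Ap u + Bp u)\<close>. The inequality between the means gives
  \<open>z^2 <= hump u\<close>, and \<open>2 * z <= 1 + z^2\<close> then bounds from below,
  independently of \<open>t\<close>, what remains of \<open>al u\<close> after the elimination step
  from a first pivot \<open>Ap u + Bp u\<close>.\<close>

lemma hump_gain:
  assumes "0 < u"
  shows "al u * (1 - hump u) / 2 \<le> al u - (al u)\<^sup>2 / (Ap u + Bp u)"
proof -
  have pos: "0 < p + u" "0 < q + u" "0 < m + u" "0 < s + u" "0 < i + u"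
    using assms p0 q0 m0 s0 i0 by auto
  note AB = Ap_pos[OF assms] Bp_pos[OF assms] al_pos[OF assms]
  define z where "z = al u / (Ap u + Bp u)"
  have "4 * (t * (P / M\<^sup>2) * (Q / I\<^sup>2 / t)) * (P * I\<^sup>2 / (4 * Q * S\<^sup>2)) = (P / (M * S))\<^sup>2"
    if "0 < Q" "0 < I" for P Q M I S
    using that t0 by (simp add: power2_eq_square)
  then have "4 * (Ap u * Bp u) * hump u = (al u)\<^sup>2"
    using pos unfolding Ap_def Bp_def al_def hump_def by blast
  moreover have "4 * (Ap u * Bp u) \<le> (Ap u + Bp u)\<^sup>2"
  proof -
    have "0 \<le> (Ap u - Bp u)\<^sup>2" by simp
    then show ?thesis by (simp add: power2_eq_square algebra_simps)
  qed
  moreover have "0 \<le> hump u" using pos by (simp add: hump_def)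
  ultimately have "(al u)\<^sup>2 \<le> (Ap u + Bp u)\<^sup>2 * hump u"
    using mult_right_mono[of "4 * (Ap u * Bp u)" "(Ap u + Bp u)\<^sup>2" "hump u"] by simp
  then have "z\<^sup>2 \<le> hump u"
    using AB by (simp add: z_def power_divide pos_divide_le_eq mult.commute)
  moreover have "2 * z \<le> 1 + z\<^sup>2"
  proof -
    have "0 \<le> (1 - z)\<^sup>2" by simp
    then show ?thesis by (simp add: power2_eq_square algebra_simps)
  qed
  ultimately have "2 * z \<le> 1 + hump u" by (rule order_trans[rotated, OF add_left_mono])
  then have "(1 - hump u) / 2 \<le> 1 - z" by (simp add: field_simps)
  then have "al u * ((1 - hump u) / 2) \<le> al u * (1 - z)" using AB by (intro mult_left_mono) auto
  then show ?thesis by (simp add: z_def power2_eq_square right_diff_distrib)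
qed

end

text \<open>The form of an elimination step used throughout: a lower bound \<open>d'\<close> for the
  previous pivot bounds the square that is subtracted.\<close>

lemma sq_div_le:
  fixes c d b :: real
  assumes "c\<^sup>2 \<le> b * d'" "d' \<le> d" "0 < d'" "0 \<le> b"
  shows "c\<^sup>2 / d \<le> b"
proof -
  have "c\<^sup>2 \<le> b * d" using assms mult_left_mono[of d' d b] by simp
  then show ?thesis using assms by (simp add: pos_divide_le_eq)
qed

section \<open>Positivity of the pivots\<close>

text \<open>In \<open>cond4\<close> the term D_k already appears as \<open>Ce\<close> at the
  \<open>x\<close> of the index k - (p + q).\<close>

locale pivots = monomial_pair "real n'" "real j'" "real q'" "real r'" t for n' j' q' r' :: nat and t :: real +
  fixes H C :: "nat \<Rightarrow> real"
  defines "H k \<equiv> Ap (real k + 1) + Bp (real k + 1) - (if q' \<le> k then Bm (real k + 1) else 0)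
    - (if q' + r' \<le> k then Am (real k + 1) else 0)"
  defines "C k \<equiv> if k < q' then al (real k + 1) else Ce (real k + 1)"
  assumes cond1: "k < q' \<Longrightarrow> C k \<le> H k"
    and cond2: "q' \<le> k \<Longrightarrow> k < q' + r' \<Longrightarrow> C k \<le> H k"
    and cond4: "q' + r' + q' \<le> k \<Longrightarrow> C k + Ce (real k + 1 - real (q' + r' + q')) \<le> H k"
begin

abbreviation "N' \<equiv> q' + r' + q'"
abbreviation "xx k \<equiv> real k + 1"

lemma nats: "0 < q'" "0 < r'" and p_nat: "p = real (q' + r')" and X_nat: "X = real N' + 1"
  using q0 r0 by (auto simp: p_def X_def)

lemma H_low: "k < q' \<Longrightarrow> H k = Ap (xx k) + Bp (xx k)"
  by (simp add: H_def)

lemma H_high: "q' + r' \<le> k \<Longrightarrow> H k = t * profile (real n') p (xx k) + profile (real j') (real q') (xx k) / t"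
  using Ap_Am[of "xx k"] Bp_Bm[of "xx k"] by (simp add: H_def)

lemma N_cond: "Ce X + Ce 1 \<le> t * profile (real n') p X + profile (real j') (real q') X / t"
  using cond4[of N'] by (simp add: H_high C_def X_nat)

text \<open>The recursion jumps by \<open>r'\<close>, so the residue classes modulo
  \<open>r'\<close> are independent chains.\<close>

function d :: "nat \<Rightarrow> real" where
  "d k = (if k < r' then H k else H k - (C (k - r'))\<^sup>2 / d (k - r'))"
  by auto
termination by (relation "Wellfounded.measure id") (use nats in auto)

declare d.simps [simp del]

lemma d_first: "k < r' \<Longrightarrow> d k = H k"
  by (simp add: d.simps)

lemma d_next: "d (v + r') = H (v + r') - (C v)\<^sup>2 / d v"
  using d.simps[of "v + r'"] by simp

text \<open>
  For \<open>k < q'\<close> the off-diagonal entry alone would make the form a sum of squares: \<open>Ap\<close> at \<open>v\<close> and \<open>Bp\<close> at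
  \<open>v + r'\<close> span a rank-one block.
\<close>

lemma C_sq_low: "v < q' \<Longrightarrow> (C v)\<^sup>2 = Ap (xx v) * Bp (xx (v + r'))"
  using al_sq[of "xx v"] by (simp add: C_def add_ac)

text \<open>By the rank-one identity, a pivot of at least \<open>Ap\<close> at \<open>v\<close>
  makes the subtracted square at \<open>v + r'\<close> at most \<open>Bp\<close> there, so that
  \<open>Ap\<close> survives.\<close>

lemma pivot_Ap: "k < q' \<Longrightarrow> Ap (xx k) \<le> d k"
proof (induction k rule: less_induct)
  case (less k)
  show ?case
  proof (cases "k < r'")
    case True
    then show ?thesis using less.prems Bp_pos[of "xx k"] by (simp add: d_first H_low)
  next
    case False
    then obtain v where k: "k = v + r'" by (metis le_add_diff_inverse2 not_less)
    have "Ap (xx v) \<le> d v" using less nats k by auto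
    then have "(C v)\<^sup>2 / d v \<le> Bp (xx k)"
      using less.prems Ap_pos[of "xx v"] Bp_pos[of "xx k"] C_sq_low[of v]
      by (intro sq_div_le[where d' = "Ap (xx v)"]) (auto simp: k mult.commute)
    then show ?thesis using less.prems H_low[of k] d_next[of v] by (simp add: k)
  qed
qed

text \<open>The surplus \<open>al - Ap\<close> at the end \<open>k\<close> of the chain is propagated upwards from its first index \<open>k mod r'\<close>.\<close>

lemma pivot_chain:
  assumes "k < q'" "r' \<le> k" "j' \<le> n'" "t * (s + xx k) \<le> m + xx k"
  shows "k mod r' + l * r' \<le> k \<Longrightarrow> Ap (xx (k mod r' + l * r')) + (al (xx k) - Ap (xx k)) \<le> d (k mod r' + l * r')"
proof (induction l)
  case 0
  have "k mod r' < r'" "k mod r' < q'" using nats assms by (auto intro: le_less_trans[OF mod_less_eq_dividend])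
  moreover have "al (xx k) - Ap (xx k) \<le> Bp (xx (k mod r'))"
    using assms by (intro chain_start) auto
  ultimately show ?case by (simp add: d_first H_low)
next
  case (Suc l)
  define v w where "v = k mod r' + l * r'" and "w = k mod r' + Suc l * r'"
  define E where "E = al (xx k) - Ap (xx k)"
  have w: "w = v + r'" "w \<le> k" "w < q'" using Suc.prems assms by (auto simp: v_def w_def)
  have IH: "Ap (xx v) + E \<le> d v" using Suc w by (simp add: v_def E_def)
  have xw: "xx w = xx v + real r'" by (simp add: w(1))
  have step: "Ap (xx v) + E \<le> Bp (xx w)"
  proof -
    have "xx k \<le> p" using assms by (simp add: p_nat)
    then have "E \<le> Bp (xx v + real r') - Ap (xx v)"
      unfolding E_def using assms w by (intro chain_step) auto
    then show ?thesis unfolding xw by simp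
  qed
  have sq: "(C v)\<^sup>2 = Ap (xx v) * Bp (xx w)" using C_sq_low[of v] w by simp
  show ?case
  proof (cases "0 \<le> E")
    case False
    then show ?thesis unfolding w_def[symmetric] E_def[symmetric] using pivot_Ap[of w] w by simp
  next
    case True
    have pos: "0 < Ap (xx v)" by (simp add: Ap_pos)
    have "(C v)\<^sup>2 / d v \<le> Bp (xx w) - E"
    proof (rule sq_div_le[OF _ IH])
      \<comment> \<open>This product is the difference of \<open>(Bp - E) * (Ap + E)\<close> and
        \<open>Ap * Bp\<close>, with \<open>Ap\<close> taken at \<open>v\<close> and
        \<open>Bp\<close> at \<open>w\<close>.\<close>
      have "0 \<le> E * (Bp (xx w) - (Ap (xx v) + E))" using True step by simp
      then show "(C v)\<^sup>2 \<le> (Bp (xx w) - E) * (Ap (xx v) + E)" by (simp add: sq algebra_simps)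
    qed (use pos True step in auto)
    then have "Ap (xx w) + E \<le> d w" using w H_low[of w] d_next[of v] by simp
    then show ?thesis unfolding w_def E_def .
  qed
qed

text \<open>Large \<open>t\<close> is covered by \<open>pivot_Ap\<close>. For smaller
  \<open>t\<close> the chain argument applies if \<open>j' <= n'\<close>. Otherwise
  \<open>excluded_zone\<close> forces \<open>t * (s + x)\<close> below \<open>lo_bound x\<close>,
  where the diagonal entry dominates the sum of both neighbouring off-diagonal entries and plain
  induction works.\<close>

lemma pivot_al: "k < q' \<Longrightarrow> al (xx k) \<le> d k"
proof (induction k rule: less_induct)
  case (less k)
  have x: "0 < xx k" by simp
  show ?case
  proof (cases "k < r'")
    case True
    then show ?thesis using less.prems cond1[of k] by (simp add: d_first C_def)
  next
    case rk: False
    then obtain v where k: "k = v + r'" by (metis le_add_diff_inverse2 not_less)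
    show ?thesis
    proof (cases "m + xx k \<le> t * (s + xx k)")
      case True
      then show ?thesis using big_Ap[OF x] pivot_Ap less.prems by fastforce
    next
      case small: False
      show ?thesis
      proof (cases "j' \<le> n'")
        case True
        have "k mod r' + k div r' * r' = k" by simp
        then show ?thesis using pivot_chain[of k "k div r'"] less.prems rk True small by simp
      next
        case False
        have "t * (s + xx k) \<le> lo_bound (xx k)"
        proof (rule ccontr)
          assume "\<not> t * (s + xx k) \<le> lo_bound (xx k)"
          then show False using excluded_zone[of "xx k"] N_cond False small rk less.prems by simp
        qed
        then have "al (xx k) + al (xx k - real r') \<le> Ap (xx k) + Bp (xx k)"
          using rk by (intro low_zone) auto
        moreover have "xx k - real r' = xx v" by (simp add: k)
        moreover have "(C v)\<^sup>2 / d v \<le> al (xx v)"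
          using less k nats al_pos[of "xx v"]
          by (intro sq_div_le[where d' = "al (xx v)"]) (auto simp: C_def power2_eq_square)
        ultimately show ?thesis using less.prems H_low[of k] d_next[of v] by (simp add: k)
      qed
    qed
  qed
qed

text \<open>Here the chain passes from one branch of \<open>C\<close> to the other: the predecessor
  \<open>k' = k - r'\<close> still has the entry \<open>al\<close>, while \<open>Bm\<close> is
  already present at \<open>k\<close>. The subtracted square is bounded by \<open>Bp\<close> when
  \<open>t\<close> is large and by \<open>al\<close> at \<open>k'\<close> otherwise.\<close>

lemma pivot_cross:
  assumes "q' \<le> k" "r' \<le> k" "k < q' + r'"
  shows "Ce (xx (min (2 * k) N')) \<le> d k"
proof -
  obtain k' where k_eq: "k = k' + r'" using assms(2) by (metis le_add_diff_inverse2)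
  have k': "k' < q'" "r' \<le> k" "xx k' = xx k - real r'" "k = k' + r'" using assms by (auto simp: k_eq)
  have x': "0 < xx k'" "0 < xx k" by simp_all
  have dk: "d k = H k - (al (xx k'))\<^sup>2 / d k'" unfolding k_eq d_next using k'(1) by (simp add: C_def)
  have Hk: "H k = Ap (xx k) + Bp (xx k) - Bm (xx k)" using assms by (simp add: H_def)
  have sq: "(al (xx k'))\<^sup>2 = Bp (xx k) * Ap (xx k')"
    unfolding k_eq using C_sq_low[OF k'(1)] k'(1) by (simp add: C_def mult.commute)
  have vB: "(al (xx k'))\<^sup>2 / d k' \<le> Bp (xx k)"
    by (rule sq_div_le[OF eq_refl[OF sq] pivot_Ap[OF k'(1)] Ap_pos[OF x'(1)] less_imp_le[OF Bp_pos[OF x'(2)]]])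
  have va: "(al (xx k'))\<^sup>2 / d k' \<le> al (xx k')"
    using pivot_al[OF k'(1)] al_pos[OF x'(1)]
    by (intro sq_div_le[where d' = "al (xx k')"]) (auto simp: power2_eq_square)
  show ?thesis
  proof (cases "m + xx k \<le> t * (j' + xx k - real r')")
    case True
    then have "Ce (xx k) \<le> Ap (xx k) - Bm (xx k)" using assms by (intro high_branch) auto
    also have "\<dots> \<le> d k" using vB by (simp add: dk Hk)
    finally have "Ce (xx k) \<le> d k" .
    moreover have "Ce (xx (min (2 * k) N')) \<le> Ce (xx k)" using assms by (intro Ce_antimono) auto
    ultimately show ?thesis by simp
  next
    case False
    have "Ce X + Ce 1 - Ce (xx k') + al (xx k') \<le> H k"
      using low_branch[of "xx k", OF _ _ _ _ N_cond] False assms by (simp add: Hk k'(3) p_nat)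
    \<comment> \<open>By \<open>va\<close> the inner bracket is nonnegative; the last case below
      needs a positive lower bound for it.\<close>
    then have main: "Ce X + Ce 1 - Ce (xx k') + (al (xx k') - (al (xx k'))\<^sup>2 / d k') \<le> d k"
      by (simp add: dk)
    have C1: "Ce (xx k') \<le> Ce 1" by (intro Ce_antimono) auto
    show ?thesis
    proof (cases "N' \<le> 2 * k")
      case True
      then have "min (2 * k) N' = N'" by simp
      then show ?thesis using main va C1 X_nat by simp
    next
      case N: False
      then have mn: "min (2 * k) N' = 2 * k" by simp
      show ?thesis
      proof (cases "2 * (q' + r') \<le> 3 * k")
        case True
        have "Ce (xx (2 * k)) + Ce (xx (N' - 2 * k)) \<le> Ce 1 + Ce X"
          using N X_nat by (intro Ce_convex) (auto simp: of_nat_diff)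
        \<comment> \<open>The case condition \<open>2 * (q' + r') <= 3 * k\<close> is the same as
          \<open>N' - 2 * k <= k'\<close>.\<close>
        moreover have "Ce (xx k') \<le> Ce (xx (N' - 2 * k))"
          using True N assms by (intro Ce_antimono) (auto simp: k_eq of_nat_diff)
        ultimately show ?thesis using main va unfolding mn by linarith
      next
        case False
        \<comment> \<open>Together with \<open>q' <= k\<close> the case condition places
          \<open>k'\<close> at the start of its chain, where the pivot is explicit.\<close>
        then have "k' < r'" using assms by (simp add: k_eq)
        then have dk': "d k' = Ap (xx k') + Bp (xx k')" using k' by (simp add: d_first H_low)
        have "Ce (2 * (xx k' + real r') - 1) - Ce X \<le> al (xx k') * (1 - hump (xx k')) / 2"
          using N assms k' by (intro crossing) auto
        also have "\<dots> \<le> al (xx k') - (al (xx k'))\<^sup>2 / d k'"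
          unfolding dk' by (rule hump_gain) simp
        also have "2 * (xx k' + real r') - 1 = xx (2 * k)" by (simp add: k'(4))
        finally show ?thesis using main C1 unfolding mn by linarith
      qed
    qed
  qed
qed

text \<open>Log-convexity centred at \<open>k\<close> with right-hand point
  \<open>min (2 * k) N'\<close>. The subtraction \<open>2 * k - N'\<close> is truncated on purpose:
  for \<open>2 * k <= N'\<close> the left-hand index is 0, which gives \<open>Ce 1\<close>.\<close>

lemma square_le_Ce:
  assumes "q' \<le> k" "k < N'" "0 < d k" "if k < r' then Ce (xx k) \<le> d k else Ce (xx (min (2 * k) N')) \<le> d k"
  shows "(C k)\<^sup>2 / d k \<le> Ce (xx (2 * k - N'))"
proof -
  have C: "C k = Ce (xx k)" using assms by (simp add: C_def)
  show ?thesis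
  proof (cases "k < r'")
    case True
    then have "(C k)\<^sup>2 / d k \<le> Ce (xx k)"
      using assms Ce_pos[of "xx k"] by (intro sq_div_le[where d' = "Ce (xx k)"]) (auto simp: C power2_eq_square)
    also have "\<dots> \<le> Ce (xx (2 * k - N'))" using assms by (intro Ce_antimono) auto
    finally show ?thesis .
  next
    case False
    show ?thesis
    proof (cases "2 * k \<le> N'")
      case True
      have "(Ce (xx k))\<^sup>2 \<le> Ce 1 * Ce (xx (2 * k))" by (intro Ce_log_convex) auto
      then show ?thesis
        using assms False True Ce_pos[of "xx (2 * k)"] Ce_pos[of 1]
        by (intro sq_div_le[where d' = "Ce (xx (2 * k))"]) (auto simp: C)
    next
      case gt: False
      have "(Ce (xx k))\<^sup>2 \<le> Ce (xx (2 * k - N')) * Ce (xx N')"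
        using gt assms by (intro Ce_log_convex) (auto simp: of_nat_diff)
      then show ?thesis
        using assms False gt Ce_pos[of "xx N'"] Ce_pos[of "xx (2 * k - N')"]
        by (intro sq_div_le[where d' = "Ce (xx N')"]) (auto simp: C)
    qed
  qed
qed

lemma pivot_mid: "q' \<le> k \<Longrightarrow> k < N' \<Longrightarrow> if k < r' then Ce (xx k) \<le> d k else Ce (xx (min (2 * k) N')) \<le> d k"
proof (induction k rule: less_induct)
  case (less k)
  consider "k < r'" | "r' \<le> k" "k < q' + r'" | "q' + r' \<le> k" by linarith
  then show ?case
  proof cases
    case 1
    then show ?thesis using less.prems cond2[of k] by (simp add: d_first C_def)
  next
    case 2
    then show ?thesis using pivot_cross[of k] less.prems by simp
  next
    case 3
    have "r' \<le> k" using 3 by simp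
    then obtain v where k: "k = v + r'" by (metis le_add_diff_inverse2)
    have v: "v < k" "q' \<le> v" "v < N'" using 3 less.prems nats by (auto simp: k)
    have IH: "if v < r' then Ce (xx v) \<le> d v else Ce (xx (min (2 * v) N')) \<le> d v" using less v by blast
    then have "0 < d v" using Ce_pos[of "xx v"] Ce_pos[of "xx (min (2 * v) N')"] by (auto split: if_splits)
    then have "(C v)\<^sup>2 / d v \<le> Ce (xx (2 * v - N'))" using square_le_Ce[of v] v IH by auto
    also have "\<dots> \<le> Ce 1" by (intro Ce_antimono) auto
    finally have "(C v)\<^sup>2 / d v \<le> Ce 1" .
    moreover have "Ce X + Ce 1 \<le> H k"
    proof -
      have "t * profile (real n') p X \<le> t * profile (real n') p (xx k)"
        using less.prems t0 p0 X_nat by (intro mult_left_mono profile_antimono) auto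
      moreover have "profile (real j') (real q') X / t \<le> profile (real j') (real q') (xx k) / t"
        using less.prems t0 X_nat by (intro divide_right_mono profile_antimono) auto
      ultimately show ?thesis using N_cond H_high[OF 3] by linarith
    qed
    ultimately have "Ce X \<le> d k" using d_next[of v] by (simp add: k)
    moreover have "min (2 * k) N' = N'" "\<not> k < r'" using 3 nats by auto
    ultimately show ?thesis by (simp add: X_nat)
  qed
qed

text \<open>For \<open>v = k - r'\<close> one has \<open>k - N' = v - 2 * q'\<close>, and
  \<open>2 * v - N' >= k - N'\<close> as soon as \<open>v >= r'\<close>. So in each range of
  \<open>v\<close> the subtracted square is at most the shifted entry that \<open>cond4\<close>
  provides.\<close>

lemma pivot_high: "N' \<le> k \<Longrightarrow> Ce (xx k) \<le> d k"
proof (induction k rule: less_induct)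
  case (less k)
  have "r' \<le> k" using less.prems by simp
  then obtain v where k: "k = v + r'" by (metis le_add_diff_inverse2)
  have v: "v < k" "q' \<le> v" "2 * q' \<le> v" using less.prems nats by (auto simp: k)
  have Cv: "C v = Ce (xx v)" using v by (simp add: C_def)
  have "(C v)\<^sup>2 / d v \<le> Ce (xx (k - N'))"
  proof (cases "v < N'")
    case True
    have IH: "if v < r' then Ce (xx v) \<le> d v else Ce (xx (min (2 * v) N')) \<le> d v"
      using pivot_mid v True by blast
    then have dv: "0 < d v" using Ce_pos[of "xx v"] Ce_pos[of "xx (min (2 * v) N')"] by (auto split: if_splits)
    show ?thesis
    proof (cases "v < r'")
      case vr: True
      then have "(C v)\<^sup>2 / d v \<le> Ce (xx v)"
        using IH Ce_pos[of "xx v"] by (intro sq_div_le[where d' = "Ce (xx v)"]) (auto simp: Cv power2_eq_square)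
      also have "\<dots> \<le> Ce (xx (k - N'))" by (intro Ce_antimono) (auto simp: k)
      finally show ?thesis .
    next
      case False
      have "(C v)\<^sup>2 / d v \<le> Ce (xx (2 * v - N'))" using square_le_Ce[of v] v True IH dv by auto
      also have "\<dots> \<le> Ce (xx (k - N'))" using False less.prems by (intro Ce_antimono) (auto simp: k)
      finally show ?thesis .
    qed
  next
    case False
    then have "(C v)\<^sup>2 / d v \<le> Ce (xx v)"
      using less v Ce_pos[of "xx v"] by (intro sq_div_le[where d' = "Ce (xx v)"]) (auto simp: Cv power2_eq_square)
    also have "\<dots> \<le> Ce (xx (k - N'))" by (intro Ce_antimono) (auto simp: k)
    finally show ?thesis .
  qed
  moreover have "Ce (xx k) + Ce (xx (k - N')) \<le> H k"
  proof -
    have eq: "xx k - real N' = xx (k - N')" using less.prems by (simp add: of_nat_diff)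
    have "C k = Ce (xx k)" using less.prems nats by (simp add: C_def)
    then show ?thesis using cond4[OF less.prems] unfolding eq by simp
  qed
  ultimately show ?case using d_next[of v] by (simp add: k)
qed

lemma pivot_pos: "0 < d k"
proof -
  have C: "0 < Ce (real l + 1)" "0 < al (real l + 1)" for l using Ce_pos al_pos by auto
  consider "k < q'" | "q' \<le> k" "k < N'" | "N' \<le> k" by linarith
  then show ?thesis
  proof cases
    case 1 then show ?thesis using pivot_al[of k] C(2)[of k] by linarith
  next
    case 2 then show ?thesis using pivot_mid[of k] C(1)[of k] C(1)[of "min (2 * k) N'"] by (auto split: if_splits)
  next
    case 3 then show ?thesis using pivot_high[of k] C(1)[of k] by linarith
  qed
qed

theorem jacobi_factorization:
  "\<exists>d. (\<forall>k. 0 < d k) \<and> (\<forall>k. H k = d k + (if k < r' then 0 else (C (k - r'))\<^sup>2 / d (k - r')))"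
proof (intro exI[of _ d] conjI allI)
  fix k show "H k = d k + (if k < r' then 0 else (C (k - r'))\<^sup>2 / d (k - r'))"
    using d_next[of "k - r'"] by (cases "k < r'") (simp_all add: d_first)
qed (rule pivot_pos)

end

section \<open>Area moments of monomials\<close>

text \<open>Identifies area in the complex plane with Lebesgue measure on \<open>real^2\<close>,
  where invariance under orthogonal maps applies.\<close>

lemma lborel_distr_Complex: "distr lborel borel (\<lambda>v::real^2. Complex (v $ 1) (v $ 2)) = lborel"
proof (rule lborel_eqI[symmetric])
  have cont: "continuous_on UNIV (\<lambda>v::real^2. Complex (v $ 1) (v $ 2))"
    unfolding Complex_eq by (intro continuous_intros)
  then have meas: "(\<lambda>v::real^2. Complex (v $ 1) (v $ 2)) \<in> borel_measurable lborel"
    by (simp add: borel_measurable_continuous_onI)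
  fix l u :: complex assume lu: "\<And>b. b \<in> Basis \<Longrightarrow> l \<bullet> b \<le> u \<bullet> b"
  have le: "Re l \<le> Re u" "Im l \<le> Im u" using lu[of 1] lu[of \<i>] by (auto simp: Basis_complex_def inner_complex_def)
  have eq: "(\<lambda>v::real^2. Complex (v $ 1) (v $ 2)) -` box l u = box (vector [Re l, Im l]) (vector [Re u, Im u])"
    by (auto simp: box_def Basis_complex_def inner_complex_def mem_box_cart forall_2 Basis_vec_def cart_eq_inner_axis[symmetric] inner_axis)
  have "emeasure (distr lborel borel (\<lambda>v::real^2. Complex (v $ 1) (v $ 2))) (box l u)
      = emeasure lborel (box (vector [Re l, Im l]) (vector [Re u, Im u] :: real^2))"
    using meas by (subst emeasure_distr) (auto simp: eq)
  also have "\<dots> = ennreal ((Re u - Re l) * (Im u - Im l))"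
  proof -
    have "(\<Prod>b\<in>(Basis::(real^2) set). (vector [Re u, Im u] - vector [Re l, Im l]) \<bullet> b) = (Re u - Re l) * (Im u - Im l)"
      by (simp add: Basis_vec_def inner_axis axis_eq_axis UNIV_2 prod.union_disjoint)
    moreover have "(vector [Re l, Im l] :: real^2) \<bullet> b \<le> vector [Re u, Im u] \<bullet> b" if "b \<in> Basis" for b
      using that le by (auto simp: Basis_vec_def inner_axis UNIV_2)
    ultimately show ?thesis by (subst emeasure_lborel_box) auto
  qed
  also have "\<dots> = ennreal (\<Prod>b\<in>Basis. (u - l) \<bullet> b)"
    by (simp add: Basis_complex_def inner_complex_def)
  finally show "emeasure (distr lborel borel (\<lambda>v::real^2. Complex (v $ 1) (v $ 2))) (box l u) = ennreal (\<Prod>b\<in>Basis. (u - l) \<bullet> b)" .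
qed simp

text \<open>Boxes suffice. The preimage of a box under the rotation corresponds in
  \<open>real^2\<close> to its image under the inverse rotation \<open>f\<close>, an orthogonal
  transformation.\<close>

lemma lborel_distr_rotation:
  fixes c :: complex
  assumes c: "cmod c = 1"
  shows "distr lborel borel (\<lambda>z. c * z) = lborel"
proof (rule lborel_eqI[symmetric])
  define \<phi> :: "real^2 \<Rightarrow> complex" where "\<phi> v = Complex (v $ 1) (v $ 2)" for v
  define \<psi> :: "complex \<Rightarrow> real^2" where "\<psi> z = vector [Re z, Im z]" for z
  have \<phi>\<psi> [simp]: "\<phi> (\<psi> z) = z" "\<psi> (\<phi> v) = v" for z v
    by (auto simp: \<phi>_def \<psi>_def vec_eq_iff forall_2)
  have norm: "norm (\<psi> z) = cmod z" for z
    by (simp add: \<psi>_def norm_vec_def L2_set_def sum_2 cmod_def)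
  have cont: "continuous_on UNIV \<phi>"
    unfolding \<phi>_def Complex_eq by (intro continuous_intros)
  then have meas [measurable]: "\<phi> \<in> borel_measurable borel"
    by (simp add: borel_measurable_continuous_onI)
  fix l u :: complex assume lu: "\<And>b. b \<in> Basis \<Longrightarrow> l \<bullet> b \<le> u \<bullet> b"
  have push: "emeasure lborel S = emeasure lborel (\<phi> -` S)" if "S \<in> sets borel" for S
  proof -
    have "distr lborel borel \<phi> = lborel" using lborel_distr_Complex by (simp add: \<phi>_def[abs_def])
    then show "emeasure lborel S = emeasure lborel (\<phi> -` S)"
      using emeasure_distr[of \<phi> lborel borel S] that meas by simp
  qed
  define f where "f v = \<psi> (cnj c * \<phi> v)" for v
  have cc: "c * cnj c = 1" "cnj c * c = 1" using c complex_norm_square[of c] by (simp_all add: mult.commute)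
  have f: "orthogonal_transformation f"
    unfolding orthogonal_transformation
  proof (intro conjI allI)
    have "linear \<psi>" by (rule linearI) (auto simp: \<psi>_def vec_eq_iff forall_2)
    moreover have "linear (\<lambda>v. cnj c * \<phi> v)" by (rule linearI) (auto simp: \<phi>_def complex_eq_iff algebra_simps)
    ultimately show "linear f" unfolding f_def[abs_def] using linear_compose[of "\<lambda>v. cnj c * \<phi> v" \<psi>] by (simp add: o_def)
    fix v show "norm (f v) = norm v" using norm[of "\<phi> v"] c by (simp add: f_def norm norm_mult)
  qed
  have box: "box l u \<in> sets borel" by simp
  have inv: "(\<lambda>z. c * z) -` box l u \<in> sets borel"
    using measurable_sets[of "(\<lambda>z. c * z)" borel borel "box l u"] by simp
  have img: "\<phi> -` ((\<lambda>z. c * z) -` box l u) = f ` (\<phi> -` box l u)"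
  proof (intro set_eqI iffI)
    fix v assume "v \<in> \<phi> -` ((\<lambda>z. c * z) -` box l u)"
    then have "\<psi> (c * \<phi> v) \<in> \<phi> -` box l u" by simp
    moreover have "v = f (\<psi> (c * \<phi> v))" using cc by (simp add: f_def mult.assoc[symmetric])
    ultimately show "v \<in> f ` (\<phi> -` box l u)" by blast
  next
    fix v assume "v \<in> f ` (\<phi> -` box l u)"
    then show "v \<in> \<phi> -` ((\<lambda>z. c * z) -` box l u)" using cc by (auto simp: f_def mult.assoc[symmetric])
  qed
  have "emeasure (distr lborel borel (\<lambda>z. c * z)) (box l u) = emeasure lborel ((\<lambda>z. c * z) -` box l u)"
    using emeasure_distr[of "\<lambda>z. c * z" lborel borel "box l u"] by simp
  also have "\<dots> = emeasure lborel (f ` (\<phi> -` box l u))"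
    unfolding push[OF inv] img ..
  also have "\<dots> = emeasure lborel (\<phi> -` box l u)"
  proof -
    have "bounded (\<phi> -` box l u)"
    proof -
      obtain B where B: "\<And>z. z \<in> box l u \<Longrightarrow> norm z \<le> B" using bounded_box[of l u] by (auto simp: bounded_iff)
      have "norm v \<le> B" if "\<phi> v \<in> box l u" for v using B[OF that] norm[of "\<phi> v"] by simp
      then show ?thesis by (auto simp: bounded_iff)
    qed
    moreover have op: "open (\<phi> -` box l u)" by (rule open_vimage[OF open_box cont])
    ultimately have lm: "\<phi> -` box l u \<in> lmeasurable" by (rule lmeasurable_open)
    have "open (f ` (\<phi> -` box l u))"
      using f op by (metis open_surjective_linear_image orthogonal_transformation_linear orthogonal_transformation_surj)
    then have "f ` (\<phi> -` box l u) \<in> sets lborel" "\<phi> -` box l u \<in> sets lborel" using op by auto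
    moreover have "emeasure lebesgue (f ` (\<phi> -` box l u)) = emeasure lebesgue (\<phi> -` box l u)"
      using measure_orthogonal_image[OF f lm] measurable_orthogonal_image[OF f lm] lm
      by (simp add: emeasure_eq_measure2)
    ultimately show ?thesis by simp
  qed
  also have "\<dots> = emeasure lborel (box l u)" by (simp add: push)
  also have "\<dots> = ennreal (\<Prod>b\<in>Basis. (u - l) \<bullet> b)" using lu by (rule emeasure_lborel_box)
  finally show "emeasure (distr lborel borel (\<lambda>z. c * z)) (box l u) = ennreal (\<Prod>b\<in>Basis. (u - l) \<bullet> b)" .
qed simp

lemma lborel_integral_rotation:
  fixes h :: "complex \<Rightarrow> complex"
  assumes "cmod c = 1" "h \<in> borel_measurable borel"
  shows "(LINT z|lborel. h (c * z)) = (LINT z|lborel. h z)"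
proof -
  have "(LINT z|lborel. h z) = (LINT z|distr lborel borel (\<lambda>z. c * z). h z)"
    using lborel_distr_rotation[OF assms(1)] by simp
  also have "\<dots> = (LINT z|lborel. h (c * z))" using assms(2) by (intro integral_distr) auto
  finally show ?thesis by simp
qed

lemma moment_off_diagonal:
  assumes "a \<noteq> b"
  shows "(LINT z|lborel. indicator (ball 0 \<rho>) z *\<^sub>R (z ^ a * cnj z ^ b)) = (0 :: complex)"
proof -
  have *: "(LINT z|lborel. indicator (ball 0 \<rho>) z *\<^sub>R (z ^ a * cnj z ^ b)) = (0 :: complex)" if "a < b" for a b
  proof -
    \<comment> \<open>The angle is chosen so that rotation by \<open>c\<close> changes the sign of
      the integrand.\<close>
    define c where "c = cis (pi / real (b - a))"
    have c1: "cmod c = 1" by (simp add: c_def)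
    have cb: "c ^ a * cnj c ^ b = - 1"
    proof -
      have "c ^ a * cnj c ^ b = (c * cnj c) ^ a * cnj c ^ (b - a)"
        using that by (simp add: power_mult_distrib mult.assoc flip: power_add)
      also have "c * cnj c = 1" using c1 complex_norm_square[of c] by simp
      also have "cnj c ^ (b - a) = cis (- pi)"
        using that by (simp add: c_def cis_cnj Complex.DeMoivre)
      finally show ?thesis by (simp add: cis_conv_exp exp_minus)
    qed
    define h where "h z = indicator (ball 0 \<rho>) z *\<^sub>R (z ^ a * cnj z ^ b)" for z :: complex
    have "continuous_on UNIV (\<lambda>z::complex. z ^ a * cnj z ^ b)" by (intro continuous_intros)
    then have meas: "h \<in> borel_measurable borel" unfolding h_def[abs_def]
      by (intro borel_measurable_scaleR borel_measurable_indicator borel_measurable_continuous_onI) auto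
    have "h (c * z) = - h z" for z
      using c1 cb by (simp add: h_def indicator_def norm_mult power_mult_distrib mult_ac)
        (metis (no_types, opaque_lifting) mult.assoc mult.left_commute mult_minus1)
    then have "(LINT z|lborel. h z) = - (LINT z|lborel. h z)"
      using lborel_integral_rotation[OF c1 meas] by simp
    then show ?thesis by (simp add: h_def)
  qed
  consider "a < b" | "b < a" using assms by linarith
  then show ?thesis
  proof cases
    case 2
    have "cnj (LINT z|lborel. indicator (ball 0 \<rho>) z *\<^sub>R (z ^ b * cnj z ^ a)) = (LINT z|lborel. indicator (ball 0 \<rho>) z *\<^sub>R (z ^ a * cnj z ^ b))"
      unfolding Bochner_Integration.integral_cnj[symmetric] by (intro Bochner_Integration.integral_cong) (auto simp: indicator_def)
    then show ?thesis using *[OF 2] by simp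
  qed (rule *)
qed

text \<open>A layer-cake argument: \<open>cmod z ^ (2 * k)\<close> is the integral of its radial
  derivative \<open>w\<close>, and Fubini leaves the area of an annulus under the integral. For
  \<open>k = 0\<close> the derivative vanishes and \<open>0 ^ 0 = 1\<close>, hence the separate
  case.\<close>

lemma nn_moment:
  assumes "0 < \<rho>"
  shows "(\<integral>\<^sup>+z. (if cmod z < \<rho> then ennreal (cmod z ^ (2 * k)) else 0) \<partial>lborel) = ennreal (pi * \<rho> ^ (2 * k + 2) / real (k + 1))"
proof (cases "k = 0")
  case True
  have "(\<integral>\<^sup>+z. (if cmod z < \<rho> then 1 else 0) \<partial>lborel) = (\<integral>\<^sup>+z. indicator (ball (0::complex) \<rho>) z \<partial>lborel)"
    by (intro nn_integral_cong) (simp add: indicator_def)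
  also have "\<dots> = ennreal (pi * \<rho> ^ 2)"
    using assms by (simp add: emeasure_ball unit_ball_vol_2)
  finally show ?thesis using True by (simp add: power2_eq_square cong: if_cong)
next
  case False
  define w where "w r = real (2 * k) * r ^ (2 * k - 1)" for r :: real
  have w0: "0 \<le> w r" if "0 \<le> r" for r using that by (simp add: w_def)
  have wm [measurable]: "w \<in> borel_measurable borel" unfolding w_def[abs_def] by measurable
  have dw: "((\<lambda>r. r ^ (2 * k)) has_real_derivative w r) (at r)" for r
    unfolding w_def by (auto intro!: derivative_eq_intros)
  let ?f = "\<lambda>z r. if 0 \<le> r \<and> r \<le> cmod z \<and> cmod z < \<rho> then ennreal (w r) else 0"
  have "(if cmod z < \<rho> then ennreal (cmod z ^ (2 * k)) else 0) = (\<integral>\<^sup>+r. ?f z r \<partial>lborel)" for z :: complex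
  proof -
    have "(\<integral>\<^sup>+r. ennreal (w r) * indicator {0..cmod z} r \<partial>lborel) = ennreal (cmod z ^ (2 * k) - 0 ^ (2 * k))"
      by (rule nn_integral_FTC_Icc) (use dw w0 wm in \<open>auto intro: DERIV_subset\<close>)
    then have *: "(\<integral>\<^sup>+r. ennreal (w r) * indicator {0..cmod z} r \<partial>lborel) = ennreal (cmod z ^ (2 * k))"
      using False by simp
    show ?thesis
    proof (cases "cmod z < \<rho>")
      case True
      have "(\<integral>\<^sup>+r. ?f z r \<partial>lborel) = (\<integral>\<^sup>+r. ennreal (w r) * indicator {0..cmod z} r \<partial>lborel)"
        using True by (intro nn_integral_cong) (auto simp: indicator_def)
      then show ?thesis using * True by simp
    qed simp
  qed
  then have "(\<integral>\<^sup>+z. (if cmod z < \<rho> then ennreal (cmod z ^ (2 * k)) else 0) \<partial>lborel)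
      = (\<integral>\<^sup>+z. \<integral>\<^sup>+r. ?f z r \<partial>lborel \<partial>lborel)" by simp
  also have "\<dots> = (\<integral>\<^sup>+r. \<integral>\<^sup>+z. ?f z r \<partial>lborel \<partial>lborel)"
    by (rule lborel_pair.Fubini') measurable
  also have "\<dots> = (\<integral>\<^sup>+r. ennreal (w r * (pi * (\<rho>\<^sup>2 - r\<^sup>2))) * indicator {0..\<rho>} r \<partial>lborel)"
  proof (rule nn_integral_cong)
    fix r :: real
    show "(\<integral>\<^sup>+z. ?f z r \<partial>lborel) = ennreal (w r * (pi * (\<rho>\<^sup>2 - r\<^sup>2))) * indicator {0..\<rho>} r"
    proof (cases "0 \<le> r \<and> r \<le> \<rho>")
      case True
      have "(\<integral>\<^sup>+z. ?f z r \<partial>lborel) = (\<integral>\<^sup>+z. ennreal (w r) * indicator (ball (0::complex) \<rho> - ball 0 r) z \<partial>lborel)"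
        using True by (intro nn_integral_cong) (auto simp: indicator_def)
      also have "\<dots> = ennreal (w r) * emeasure lborel (ball (0::complex) \<rho> - ball 0 r)"
        by (subst nn_integral_cmult_indicator) auto
      also have "emeasure lborel (ball (0::complex) \<rho> - ball 0 r) = ennreal (pi * \<rho>\<^sup>2) - ennreal (pi * r\<^sup>2)"
        using True assms emeasure_Diff[of lborel "ball (0::complex) r" "ball 0 \<rho>"]
        by (simp add: emeasure_ball unit_ball_vol_2 subset_ball)
      also have "\<dots> = ennreal (pi * (\<rho>\<^sup>2 - r\<^sup>2))" by (simp add: ennreal_minus right_diff_distrib)
      finally show ?thesis using True w0 by (simp add: ennreal_mult' indicator_def)
    next
      case False
      then have "(\<integral>\<^sup>+z. ?f z r \<partial>lborel) = (\<integral>\<^sup>+z. 0 \<partial>(lborel :: complex measure))" by (intro nn_integral_cong) auto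
      then show ?thesis using False by (auto simp: indicator_def)
    qed
  qed
  also have "\<dots> = ennreal (pi * (\<rho>\<^sup>2 * \<rho> ^ (2 * k) - real k * \<rho> ^ (2 * k + 2) / real (k + 1))
      - pi * (\<rho>\<^sup>2 * 0 ^ (2 * k) - real k * 0 ^ (2 * k + 2) / real (k + 1)))"
  proof (rule nn_integral_FTC_Icc[where F = "\<lambda>r. pi * (\<rho>\<^sup>2 * r ^ (2 * k) - real k * r ^ (2 * k + 2) / real (k + 1))"])
    fix r :: real assume "r \<in> {0..\<rho>}"
    then have r: "0 \<le> r" "r \<le> \<rho>" by auto
    then have "r\<^sup>2 \<le> \<rho>\<^sup>2" by (intro power_mono) auto
    then show "0 \<le> w r * (pi * (\<rho>\<^sup>2 - r\<^sup>2))" using w0[OF r(1)] by simp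
    have e: "r ^ (2 * k + 1) = r ^ (2 * k - 1) * r\<^sup>2" using False by (simp flip: power_add)
    have "((\<lambda>r. real k * r ^ (2 * k + 2) / real (k + 1)) has_real_derivative w r * r\<^sup>2) (at r)"
    proof -
      have "((\<lambda>r. r ^ (2 * k + 2)) has_real_derivative real (2 * k + 2) * r ^ (2 * k + 1)) (at r)"
        by (rule DERIV_cong[OF DERIV_pow]) simp
      then have "((\<lambda>r. real k / real (k + 1) * r ^ (2 * k + 2)) has_real_derivative
          real k / real (k + 1) * (real (2 * k + 2) * r ^ (2 * k + 1))) (at r)"
        by (rule DERIV_cmult)
      moreover have "real k / real (k + 1) * (real (2 * k + 2) * r ^ (2 * k + 1)) = w r * r\<^sup>2"
      proof -
        have "real k / real (k + 1) * real (2 * k + 2) = real (2 * k)" by (simp add: field_simps)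
        then show ?thesis unfolding w_def e mult.assoc[symmetric] by simp
      qed
      ultimately show ?thesis by (simp only: times_divide_eq_left)
    qed
    from DERIV_cmult[OF DERIV_diff[OF DERIV_cmult[OF dw] this]]
    have "((\<lambda>r. pi * (\<rho>\<^sup>2 * r ^ (2 * k) - real k * r ^ (2 * k + 2) / real (k + 1))) has_real_derivative
        pi * (\<rho>\<^sup>2 * w r - w r * r\<^sup>2)) (at r)" .
    then show "((\<lambda>r. pi * (\<rho>\<^sup>2 * r ^ (2 * k) - real k * r ^ (2 * k + 2) / real (k + 1))) has_real_derivative
        w r * (pi * (\<rho>\<^sup>2 - r\<^sup>2))) (at r)"
      by (rule DERIV_cong) (simp only: right_diff_distrib mult_ac)
  qed (use assms in auto)
  also have "pi * (\<rho>\<^sup>2 * \<rho> ^ (2 * k) - real k * \<rho> ^ (2 * k + 2) / real (k + 1))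
      - pi * (\<rho>\<^sup>2 * 0 ^ (2 * k) - real k * 0 ^ (2 * k + 2) / real (k + 1)) = pi * \<rho> ^ (2 * k + 2) / real (k + 1)"
  proof -
    have z: "(0::real) ^ (2 * k) = 0" "(0::real) ^ (2 * k + 2) = 0" using False by auto
    have e: "\<rho> ^ (2 * k + 2) = \<rho>\<^sup>2 * \<rho> ^ (2 * k)" by (simp only: power_add mult.commute)
    show ?thesis unfolding z e by (simp add: divide_simps distrib_left right_diff_distrib)
  qed
  finally show ?thesis .
qed

section \<open>Integration over the disc and its concentric subdiscs\<close>

lemma finite_measure_area: "finite_measure area"
  by (rule finite_measure_lebesgue_on) simp

lemma measurable_area_continuous:
  fixes f :: "complex \<Rightarrow> 'a::euclidean_space"
  shows "continuous_on unit_disc f \<Longrightarrow> f \<in> borel_measurable area"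
  by (rule continuous_imp_measurable_on_sets_lebesgue) auto

lemma borel_measurable_cnj:
  fixes f :: "'a \<Rightarrow> complex"
  shows "f \<in> borel_measurable M \<Longrightarrow> (\<lambda>x. cnj (f x)) \<in> borel_measurable M"
  by (rule measurable_compose[OF _ borel_measurable_continuous_onI]) (auto intro: continuous_intros)

lemma indicator_measurable_area: "(indicator (ball 0 \<rho>) :: complex \<Rightarrow> real) \<in> borel_measurable area"
  by (intro measurable_restrict_space1 borel_measurable_indicator) auto

lemma integrable_area_bounded:
  fixes f :: "complex \<Rightarrow> 'a::euclidean_space"
  assumes "f \<in> borel_measurable area" "\<And>z. z \<in> unit_disc \<Longrightarrow> norm (f z) \<le> B"
  shows "integrable area f"
  using finite_measure.integrable_const_bound[OF finite_measure_area, of f B] assms by (auto simp: AE_restrict_space_iff)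

lemma area_integral_eq_lborel:
  fixes f :: "complex \<Rightarrow> complex"
  assumes "f \<in> borel_measurable borel" "\<rho> \<le> 1"
  shows "(LINT z|area. indicator (ball 0 \<rho>) z *\<^sub>R f z) = (LINT z|lborel. indicator (ball 0 \<rho>) z *\<^sub>R f z)"
proof -
  have meas: "(\<lambda>z. indicator (ball 0 \<rho>) z *\<^sub>R f z) \<in> borel_measurable lborel"
    using assms(1) by (intro borel_measurable_scaleR borel_measurable_indicator) auto
  have "(LINT z|area. indicator (ball 0 \<rho>) z *\<^sub>R f z) = (LINT z|lebesgue. indicator unit_disc z *\<^sub>R (indicator (ball 0 \<rho>) z *\<^sub>R f z))"
    by (rule integral_restrict_space) simp
  also have "\<dots> = (LINT z|lebesgue. indicator (ball 0 \<rho>) z *\<^sub>R f z)"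
    using assms(2) by (intro Bochner_Integration.integral_cong) (auto simp: indicator_def)
  also have "\<dots> = (LINT z|lborel. indicator (ball 0 \<rho>) z *\<^sub>R f z)"
    by (rule integral_completion[OF meas])
  finally show ?thesis .
qed

lemma mult_cnj_eq: "z * cnj z = (complex_of_real (cmod z))\<^sup>2"
  by (simp only: complex_norm_square of_real_power[symmetric])

lemma integral_sum_mult:
  fixes e :: "'i \<Rightarrow> 'a \<Rightarrow> complex"
  assumes "\<And>k. integrable M (e k)"
  shows "(LINT z|M. (\<Sum>k\<in>A. c k * e k z)) = (\<Sum>k\<in>A. c k * (LINT z|M. e k z))"
  using assms by (subst Bochner_Integration.integral_sum) auto

lemma integral_sum_sum_mult:
  fixes e :: "'i \<Rightarrow> 'j \<Rightarrow> 'a \<Rightarrow> complex"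
  assumes "\<And>k l. integrable M (e k l)"
  shows "(LINT z|M. (\<Sum>k\<in>A. \<Sum>l\<in>B. c k l * e k l z)) = (\<Sum>k\<in>A. \<Sum>l\<in>B. c k l * (LINT z|M. e k l z))"
  using assms by (subst Bochner_Integration.integral_sum) (auto simp: integral_sum_mult)

lemma moment:
  assumes "0 < \<rho>" "\<rho> \<le> 1"
  shows "(LINT z|area. indicator (ball 0 \<rho>) z *\<^sub>R (z ^ a * cnj z ^ b))
    = (if a = b then complex_of_real (pi * \<rho> ^ (2 * b + 2) / real (b + 1)) else 0)"
proof -
  have "continuous_on UNIV (\<lambda>z::complex. z ^ a * cnj z ^ b)" by (intro continuous_intros)
  then have eq: "(LINT z|area. indicator (ball 0 \<rho>) z *\<^sub>R (z ^ a * cnj z ^ b)) = (LINT z|lborel. indicator (ball 0 \<rho>) z *\<^sub>R (z ^ a * cnj z ^ b))"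
    using assms by (intro area_integral_eq_lborel borel_measurable_continuous_onI)
  show ?thesis
  proof (cases "a = b")
    case True
    have "(LINT z|lborel. indicator (ball 0 \<rho>) z *\<^sub>R (z ^ a * cnj z ^ b)) = (LINT z|lborel. complex_of_real (indicator (ball 0 \<rho>) z * cmod z ^ (2 * b)))"
    proof (intro Bochner_Integration.integral_cong refl)
      fix z :: complex
      have "z ^ a * cnj z ^ b = (complex_of_real (cmod z))\<^sup>2 ^ b"
        using True by (simp add: mult_cnj_eq flip: power_mult_distrib)
      then show "indicator (ball 0 \<rho>) z *\<^sub>R (z ^ a * cnj z ^ b) = complex_of_real (indicator (ball 0 \<rho>) z * cmod z ^ (2 * b))"
        by (simp add: power_mult scaleR_conv_of_real)
    qed
    also have "\<dots> = complex_of_real (LINT z|lborel. indicator (ball (0::complex) \<rho>) z * cmod z ^ (2 * b))"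
      by (rule integral_complex_of_real)
    also have "(LINT z|lborel. indicator (ball (0::complex) \<rho>) z * cmod z ^ (2 * b)) = pi * \<rho> ^ (2 * b + 2) / real (b + 1)"
    proof -
      have cm: "(\<lambda>z::complex. cmod z ^ (2 * b)) \<in> borel_measurable borel" by measurable
      have "(LINT z|lborel. indicator (ball (0::complex) \<rho>) z * cmod z ^ (2 * b))
          = enn2real (\<integral>\<^sup>+z. ennreal (indicator (ball (0::complex) \<rho>) z * cmod z ^ (2 * b)) \<partial>lborel)"
        using cm by (intro integral_eq_nn_integral borel_measurable_times borel_measurable_indicator) auto
      also have "(\<integral>\<^sup>+z. ennreal (indicator (ball (0::complex) \<rho>) z * cmod z ^ (2 * b)) \<partial>lborel)
          = (\<integral>\<^sup>+z. (if cmod z < \<rho> then ennreal (cmod z ^ (2 * b)) else 0) \<partial>(lborel :: complex measure))"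
        by (intro nn_integral_cong) (auto simp: indicator_def)
      finally show ?thesis using nn_moment[OF assms(1), of b] assms by simp
    qed
    finally show ?thesis using eq True by simp
  next
    case False
    then show ?thesis using eq moment_off_diagonal by simp
  qed
qed

section \<open>Taylor coefficients of Bergman functions\<close>

text \<open>The values off the disc are included, so the coefficients determine the total
  function.\<close>

definition has_coeffs :: "(complex \<Rightarrow> complex) \<Rightarrow> (nat \<Rightarrow> complex) \<Rightarrow> bool" where
  "has_coeffs f c \<longleftrightarrow> (\<forall>w\<in>unit_disc. (\<lambda>k. c k * w ^ k) sums f w) \<and> (\<forall>z. z \<notin> unit_disc \<longrightarrow> f z = 0)"

lemma bergman_has_coeffs:
  assumes "f \<in> bergman_space"
  obtains c where "has_coeffs f c"
proof
  show "has_coeffs f (\<lambda>k. (deriv ^^ k) f 0 / fact k)"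
    using holomorphic_power_series[of f 0 1] assms by (auto simp: bergman_space_def has_coeffs_def)
qed

lemma has_coeffs_holomorphic: "has_coeffs f c \<Longrightarrow> f holomorphic_on unit_disc"
  using power_series_holomorphic[of 0 1 c f] by (simp add: has_coeffs_def)

lemma has_coeffs_measurable: "has_coeffs f c \<Longrightarrow> f \<in> borel_measurable area"
  by (intro measurable_area_continuous holomorphic_on_imp_continuous_on has_coeffs_holomorphic)

lemma has_coeffs_abs_summable:
  assumes "has_coeffs f c" "0 \<le> \<rho>" "\<rho> < 1"
  shows "summable (\<lambda>k. cmod (c k) * \<rho> ^ k)"
proof -
  \<comment> \<open>A point of the disc of modulus larger than \<rho>: convergence there gives
    absolute convergence at radius \<rho>.\<close>
  define z where "z = complex_of_real ((1 + \<rho>) / 2)"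
  have z: "cmod z = (1 + \<rho>) / 2" unfolding z_def norm_of_real using assms by simp
  have "(\<lambda>k. c k * z ^ k) sums f z"
    using assms z by (auto simp: has_coeffs_def)
  then have "summable (\<lambda>k. c k * z ^ k)" by (rule sums_summable)
  then have "summable (\<lambda>k. norm (c k * complex_of_real \<rho> ^ k))"
    by (rule powser_insidea) (use assms z in simp)
  then show ?thesis using assms by (simp add: norm_mult norm_power)
qed

text \<open>On a disc of radius \<rho> < 1 all partial sums obey one bound, so dominated convergence
  applies. The parameter \<open>G\<close> lets the same argument serve an expression linear in the
  partial sum, for inner products, and a quadratic one, for norms.\<close>

lemma truncated_limit:
  fixes h :: "complex \<Rightarrow> complex"
  assumes c: "has_coeffs f c" and \<rho>: "0 < \<rho>" "\<rho> < 1"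
    and lim: "\<And>z. z \<in> ball 0 \<rho> \<Longrightarrow> (\<lambda>N. G N (\<Sum>k<N. c k * z ^ k) z) \<longlonglongrightarrow> h z"
    and meas: "\<And>N. (\<lambda>z. G N (\<Sum>k<N. c k * z ^ k) z) \<in> borel_measurable area" "h \<in> borel_measurable area"
    and bound: "\<And>N z s. z \<in> ball 0 \<rho> \<Longrightarrow> cmod s \<le> (\<Sum>k. cmod (c k) * \<rho> ^ k) \<Longrightarrow> cmod (G N s z) \<le> B"
  shows "(\<lambda>N. LINT z|area. indicator (ball 0 \<rho>) z *\<^sub>R G N (\<Sum>k<N. c k * z ^ k) z) \<longlonglongrightarrow> (LINT z|area. indicator (ball 0 \<rho>) z *\<^sub>R h z)"
proof (rule integral_dominated_convergence[where w = "\<lambda>_. B"])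
  have "0 \<le> (\<Sum>k. cmod (c k) * \<rho> ^ k)" using \<rho> by (intro suminf_nonneg has_coeffs_abs_summable[OF c]) auto
  then have "cmod (G 0 0 0) \<le> B" using bound[of 0 0 0] \<rho> by simp
  then have B0: "0 \<le> B" by (rule order_trans[OF norm_ge_zero])
  show "integrable area (\<lambda>_. B)" using finite_measure.integrable_const[OF finite_measure_area] .
  show "AE z in area. (\<lambda>N. indicator (ball 0 \<rho>) z *\<^sub>R G N (\<Sum>k<N. c k * z ^ k) z) \<longlonglongrightarrow> indicator (ball 0 \<rho>) z *\<^sub>R h z"
    using lim by (intro AE_I2) (auto simp: indicator_def)
  show "AE z in area. norm (indicator (ball 0 \<rho>) z *\<^sub>R G N (\<Sum>k<N. c k * z ^ k) z) \<le> B" for N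
  proof (intro AE_I2)
    fix z
    have "cmod (\<Sum>k<N. c k * z ^ k) \<le> (\<Sum>k. cmod (c k) * \<rho> ^ k)" if "z \<in> ball 0 \<rho>"
    proof -
      have "cmod (\<Sum>k<N. c k * z ^ k) \<le> (\<Sum>k<N. cmod (c k) * \<rho> ^ k)"
        using that by (intro sum_norm_le) (auto simp: norm_mult norm_power intro!: mult_left_mono power_mono)
      also have "\<dots> \<le> (\<Sum>k. cmod (c k) * \<rho> ^ k)"
        using has_coeffs_abs_summable[OF c] \<rho> by (intro sum_le_suminf) auto
      finally show ?thesis .
    qed
    then show "norm (indicator (ball 0 \<rho>) z *\<^sub>R G N (\<Sum>k<N. c k * z ^ k) z) \<le> B"
      using bound[of z "\<Sum>k<N. c k * z ^ k" N] B0 by (auto simp: indicator_def)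
  qed
qed (use meas in \<open>auto intro!: borel_measurable_scaleR indicator_measurable_area\<close>)

lemma integrable_indicator_poly:
  "integrable area (\<lambda>z. indicator (ball 0 \<rho>) z *\<^sub>R (z ^ a * cnj z ^ b))"
proof (rule integrable_area_bounded[where B = 1])
  show "(\<lambda>z. indicator (ball 0 \<rho>) z *\<^sub>R (z ^ a * cnj z ^ b)) \<in> borel_measurable area"
    by (intro borel_measurable_scaleR indicator_measurable_area measurable_area_continuous continuous_intros)
  fix z :: complex assume "z \<in> unit_disc"
  then have "cmod z ^ a * cmod z ^ b \<le> 1 * 1" by (intro mult_mono power_le_one) auto
  then show "norm (indicator (ball 0 \<rho>) z *\<^sub>R (z ^ a * cnj z ^ b)) \<le> 1"
    by (auto simp: indicator_def norm_mult norm_power)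
qed

lemma truncated_inner:
  assumes c: "has_coeffs f c" and \<rho>: "0 < \<rho>" "\<rho> < 1"
  shows "(LINT z|area. indicator (ball 0 \<rho>) z *\<^sub>R (f z * (z ^ m * cnj z ^ n)))
    = (if m \<le> n then c (n - m) * complex_of_real (pi * \<rho> ^ (2 * n + 2) / real (n + 1)) else 0)" (is "_ = ?R")
proof -
  let ?L = "\<lambda>N. LINT z|area. indicator (ball 0 \<rho>) z *\<^sub>R ((\<Sum>k<N. c k * z ^ k) * (z ^ m * cnj z ^ n))"
  have "?L \<longlonglongrightarrow> (LINT z|area. indicator (ball 0 \<rho>) z *\<^sub>R (f z * (z ^ m * cnj z ^ n)))"
  proof (rule truncated_limit[OF c \<rho>, where G = "\<lambda>N s z. s * (z ^ m * cnj z ^ n)" and B = "(\<Sum>k. cmod (c k) * \<rho> ^ k)"])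
    fix z :: complex assume z: "z \<in> ball 0 \<rho>"
    then have "(\<lambda>k. c k * z ^ k) sums f z" using c \<rho> by (auto simp: has_coeffs_def)
    then show "(\<lambda>N. (\<Sum>k<N. c k * z ^ k) * (z ^ m * cnj z ^ n)) \<longlonglongrightarrow> f z * (z ^ m * cnj z ^ n)"
      unfolding sums_def by (intro tendsto_mult_right)
    fix s :: complex assume s: "cmod s \<le> (\<Sum>k. cmod (c k) * \<rho> ^ k)"
    have "cmod z ^ m * cmod z ^ n \<le> 1 * 1" using z \<rho> by (intro mult_mono power_le_one) auto
    then have "cmod s * (cmod z ^ m * cmod z ^ n) \<le> (\<Sum>k. cmod (c k) * \<rho> ^ k) * 1"
      using s order_trans[OF norm_ge_zero s] by (intro mult_mono) auto
    then show "cmod (s * (z ^ m * cnj z ^ n)) \<le> (\<Sum>k. cmod (c k) * \<rho> ^ k)" by (simp add: norm_mult norm_power)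
  next
    show "(\<lambda>z. f z * (z ^ m * cnj z ^ n)) \<in> borel_measurable area"
      by (intro borel_measurable_times has_coeffs_measurable[OF c] measurable_area_continuous continuous_intros)
    show "(\<lambda>z. (\<Sum>k<N. c k * z ^ k) * (z ^ m * cnj z ^ n)) \<in> borel_measurable area" for N
      by (intro measurable_area_continuous continuous_intros)
  qed
  \<comment> \<open>By orthogonality only \<open>k = n - m\<close> contributes, so the sequence is
    eventually constant.\<close>
  moreover have "?L N = ?R" if "n < N" for N
  proof -
    have "?L N = (LINT z|area. (\<Sum>k<N. c k * (indicator (ball 0 \<rho>) z *\<^sub>R (z ^ (k + m) * cnj z ^ n))))"
      by (intro Bochner_Integration.integral_cong refl) (simp add: scaleR_conv_of_real sum_distrib_left sum_distrib_right power_add mult_ac)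
    also have "\<dots> = (\<Sum>k<N. c k * (LINT z|area. indicator (ball 0 \<rho>) z *\<^sub>R (z ^ (k + m) * cnj z ^ n)))"
      by (rule integral_sum_mult[OF integrable_indicator_poly])
    also have "\<dots> = (\<Sum>k<N. if k + m = n then c k * complex_of_real (pi * \<rho> ^ (2 * n + 2) / real (n + 1)) else 0)"
      using \<rho> by (intro sum.cong) (auto simp: moment)
    also have "\<dots> = ?R"
    proof (cases "m \<le> n")
      case True
      then have "(k + m = n) = (k = n - m)" for k by auto
      then show ?thesis using True that by simp
    next
      case False
      then show ?thesis by (intro trans[OF sum.neutral]) auto
    qed
    finally show ?thesis .
  qed
  then have "?L \<longlonglongrightarrow> ?R" by (intro tendsto_eventually eventually_sequentiallyI[of "Suc n"]) auto
  ultimately show ?thesis by (rule LIMSEQ_unique)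
qed

lemma truncated_norm_sums:
  assumes c: "has_coeffs f c" and \<rho>: "0 < \<rho>" "\<rho> < 1"
  shows "(\<lambda>k. (cmod (c k))\<^sup>2 * (pi * \<rho> ^ (2 * k + 2) / real (k + 1))) sums
    (LINT z|area. indicator (ball 0 \<rho>) z * (cmod (f z))\<^sup>2)"
proof -
  define I where "I = (LINT z|area. indicator (ball 0 \<rho>) z * (cmod (f z))\<^sup>2)"
  define S where "S = (\<Sum>k. cmod (c k) * \<rho> ^ k)"
  let ?L = "\<lambda>N. LINT z|area. indicator (ball 0 \<rho>) z *\<^sub>R ((\<Sum>k<N. c k * z ^ k) * cnj (\<Sum>k<N. c k * z ^ k))"
  have "?L \<longlonglongrightarrow> (LINT z|area. indicator (ball 0 \<rho>) z *\<^sub>R (f z * cnj (f z)))"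
  proof (rule truncated_limit[OF c \<rho>, where G = "\<lambda>N s z. s * cnj s" and B = "S * S"])
    fix z :: complex assume z: "z \<in> ball 0 \<rho>"
    then have "(\<lambda>k. c k * z ^ k) sums f z" using c \<rho> by (auto simp: has_coeffs_def)
    then show "(\<lambda>N. (\<Sum>k<N. c k * z ^ k) * cnj (\<Sum>k<N. c k * z ^ k)) \<longlonglongrightarrow> f z * cnj (f z)"
      unfolding sums_def by (intro tendsto_intros)
    fix s :: complex assume s: "cmod s \<le> (\<Sum>k. cmod (c k) * \<rho> ^ k)"
    then have "cmod s * cmod s \<le> S * S"
      using order_trans[OF norm_ge_zero s] by (intro mult_mono) (auto simp: S_def)
    then show "cmod (s * cnj s) \<le> S * S" by (simp add: norm_mult)
  next
    show "(\<lambda>z. f z * cnj (f z)) \<in> borel_measurable area"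
      by (intro borel_measurable_times borel_measurable_cnj has_coeffs_measurable[OF c])
    show "(\<lambda>z. (\<Sum>k<N. c k * z ^ k) * cnj (\<Sum>k<N. c k * z ^ k)) \<in> borel_measurable area" for N
      by (intro measurable_area_continuous continuous_intros)
  qed
  moreover have "(LINT z|area. indicator (ball 0 \<rho>) z *\<^sub>R (f z * cnj (f z))) = complex_of_real I"
  proof -
    have "(LINT z|area. indicator (ball 0 \<rho>) z *\<^sub>R (f z * cnj (f z))) = (LINT z|area. complex_of_real (indicator (ball 0 \<rho>) z * (cmod (f z))\<^sup>2))"
      by (intro Bochner_Integration.integral_cong) (auto simp: mult_cnj_eq scaleR_conv_of_real)
    then show ?thesis by (simp add: I_def integral_complex_of_real del: of_real_mult)
  qed
  moreover have "?L N = complex_of_real (\<Sum>k<N. (cmod (c k))\<^sup>2 * (pi * \<rho> ^ (2 * k + 2) / real (k + 1)))" for N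
  proof -
    have "?L N = (LINT z|area. (\<Sum>k<N. \<Sum>l<N. c k * cnj (c l) * (indicator (ball 0 \<rho>) z *\<^sub>R (z ^ k * cnj z ^ l))))"
      by (intro Bochner_Integration.integral_cong refl) (simp add: scaleR_conv_of_real sum_distrib_left sum_product mult_ac, rule sum.swap)
    also have "\<dots> = (\<Sum>k<N. \<Sum>l<N. c k * cnj (c l) * (LINT z|area. indicator (ball 0 \<rho>) z *\<^sub>R (z ^ k * cnj z ^ l)))"
      by (rule integral_sum_sum_mult[OF integrable_indicator_poly])
    also have "\<dots> = (\<Sum>k<N. \<Sum>l<N. if k = l then complex_of_real ((cmod (c k))\<^sup>2 * (pi * \<rho> ^ (2 * k + 2) / real (k + 1))) else 0)"
      using \<rho> by (intro sum.cong) (auto simp: moment mult_cnj_eq)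
    finally show ?thesis by simp
  qed
  ultimately have "(\<lambda>N. complex_of_real (\<Sum>k<N. (cmod (c k))\<^sup>2 * (pi * \<rho> ^ (2 * k + 2) / real (k + 1)))) \<longlonglongrightarrow> complex_of_real I"
    by simp
  then show ?thesis unfolding sums_def I_def[symmetric] by (simp only: tendsto_of_real_iff)
qed

lemma truncated_integrable:
  assumes c: "has_coeffs f c" and \<rho>: "0 \<le> \<rho>" "\<rho> < 1"
  shows "integrable area (\<lambda>z. indicator (ball 0 \<rho>) z * (cmod (f z))\<^sup>2)"
proof (rule integrable_area_bounded)
  show "(\<lambda>z. indicator (ball 0 \<rho>) z * (cmod (f z))\<^sup>2) \<in> borel_measurable area"
    using has_coeffs_measurable[OF c] indicator_measurable_area by measurable
  fix z :: complex
  have "cmod (f z) \<le> (\<Sum>k. cmod (c k) * \<rho> ^ k)" if "z \<in> ball 0 \<rho>"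
  proof -
    have *: "summable (\<lambda>k. cmod (c k) * cmod z ^ k)" "(\<lambda>k. c k * z ^ k) sums f z"
      using that \<rho> c has_coeffs_abs_summable[OF c] by (auto simp: has_coeffs_def)
    have "cmod (f z) = cmod (\<Sum>k. c k * z ^ k)" using * by (simp add: sums_iff)
    also have "\<dots> \<le> (\<Sum>k. cmod (c k) * cmod z ^ k)"
      using summable_norm[of "\<lambda>k. c k * z ^ k"] * by (simp add: norm_mult norm_power)
    also have "\<dots> \<le> (\<Sum>k. cmod (c k) * \<rho> ^ k)"
      using that \<rho> * has_coeffs_abs_summable[OF c] by (intro suminf_le mult_left_mono power_mono) auto
    finally show ?thesis .
  qed
  then show "norm (indicator (ball 0 \<rho>) z * (cmod (f z))\<^sup>2) \<le> (\<Sum>k. cmod (c k) * \<rho> ^ k)\<^sup>2"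
    by (auto simp: indicator_def intro: power_mono)
qed

section \<open>Letting the radius of the subdisc tend to 1\<close>

definition radius :: "nat \<Rightarrow> real" where
  "radius N = 1 - 1 / (real N + 2)"

lemma radius_bounds: "0 < radius N" "radius N < 1"
  by (auto simp: radius_def)

lemma radius_tendsto: "radius \<longlonglongrightarrow> 1"
  unfolding radius_def by real_asymp

lemma radius_mono: "M \<le> N \<Longrightarrow> radius M \<le> radius N"
  by (auto simp: radius_def intro!: divide_left_mono)

lemma indicator_radius_tendsto:
  assumes "z \<in> unit_disc"
  shows "(\<lambda>N. indicator (ball 0 (radius N)) z :: real) \<longlonglongrightarrow> 1"
proof (rule tendsto_eventually)
  have "eventually (\<lambda>N. cmod z < radius N) sequentially"
    using assms by (intro order_tendstoD[OF radius_tendsto]) auto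
  then show "eventually (\<lambda>N. indicator (ball 0 (radius N)) z = (1::real)) sequentially"
    by eventually_elim simp
qed

lemma truncation_tendsto:
  "AE z in area. (\<lambda>N. indicator (ball 0 (radius N)) z * (cmod (f z))\<^sup>2) \<longlonglongrightarrow> (cmod (f z))\<^sup>2"
proof (rule AE_I2)
  fix z assume "z \<in> space area"
  then have "z \<in> unit_disc" by simp
  from tendsto_mult_right[OF indicator_radius_tendsto[OF this], of "(cmod (f z))\<^sup>2"]
  show "(\<lambda>N. indicator (ball 0 (radius N)) z * (cmod (f z))\<^sup>2) \<longlonglongrightarrow> (cmod (f z))\<^sup>2" by simp
qed

text \<open>The squared norm of \<open>z ^ k\<close> is \<open>pi / (k + 1)\<close>, so
  \<open>pi * weight c k\<close> is the share of the k-th term in the squared norm.\<close>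

definition weight :: "(nat \<Rightarrow> complex) \<Rightarrow> nat \<Rightarrow> real" where
  "weight c k = (cmod (c k))\<^sup>2 / real (k + 1)"

lemma weight_nonneg [simp]: "0 \<le> weight c k"
  by (simp add: weight_def)

lemma truncated_weight_sums:
  assumes c: "has_coeffs f c"
  shows "(\<lambda>k. pi * weight c k * radius N ^ (2 * k + 2)) sums (LINT z|area. indicator (ball 0 (radius N)) z * (cmod (f z))\<^sup>2)"
  using truncated_norm_sums[OF c radius_bounds[of N]] by (simp add: weight_def mult_ac)

lemma truncated_le:
  assumes c: "has_coeffs f c" and w: "summable (weight c)"
  shows "(LINT z|area. indicator (ball 0 (radius N)) z * (cmod (f z))\<^sup>2) \<le> (\<Sum>k. pi * weight c k)"
proof (rule sums_le[OF _ truncated_weight_sums[OF c]])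
  fix k
  have "radius N ^ (2 * k + 2) \<le> 1" "0 \<le> radius N ^ (2 * k + 2)"
    using radius_bounds[of N] by (auto intro!: power_le_one simp del: power_Suc)
  then show "pi * weight c k * radius N ^ (2 * k + 2) \<le> pi * weight c k"
    by (intro mult_right_le_one_le) auto
  show "(\<lambda>k. pi * weight c k) sums (\<Sum>k. pi * weight c k)"
    using w by (intro summable_sums summable_mult)
qed

lemma sum_le_sums:
  fixes f :: "nat \<Rightarrow> real"
  assumes "f sums s" "finite A" "\<And>k. 0 \<le> f k"
  shows "sum f A \<le> s"
  using sum_le_suminf[of f A] assms by (simp add: sums_iff)

text \<open>Two bounds meet: finite sums are at most the integral when the radius tends to 1, and
  the integrals over subdiscs are at most the full series.\<close>

lemma norm_sums:
  assumes c: "has_coeffs f c" and f: "integrable area (\<lambda>z. (cmod (f z))\<^sup>2)"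
  shows "(\<lambda>k. pi * weight c k) sums (LINT z|area. (cmod (f z))\<^sup>2)"
proof -
  let ?J = "LINT z|area. (cmod (f z))\<^sup>2"
  let ?I = "\<lambda>N. LINT z|area. indicator (ball 0 (radius N)) z * (cmod (f z))\<^sup>2"
  have I_le: "?I N \<le> ?J" for N
    using f truncated_integrable[OF c, of "radius N"] radius_bounds[of N]
    by (intro integral_mono) (auto simp: indicator_def)
  have I_lim: "?I \<longlonglongrightarrow> ?J"
  proof (rule integral_dominated_convergence[where w = "\<lambda>z. (cmod (f z))\<^sup>2"])
    show "(\<lambda>z. indicator (ball 0 (radius N)) z * (cmod (f z))\<^sup>2) \<in> borel_measurable area" for N
      using has_coeffs_measurable[OF c] indicator_measurable_area by measurable
    show "AE z in area. norm (indicator (ball 0 (radius N)) z * (cmod (f z))\<^sup>2) \<le> (cmod (f z))\<^sup>2" for N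
      by (intro AE_I2) (simp add: indicator_def)
  qed (fact borel_measurable_integrable[OF f] f truncation_tendsto)+
  have partial: "(\<Sum>k<K. pi * weight c k) \<le> ?J" for K
  proof (rule LIMSEQ_le_const2)
    have "(\<lambda>N. \<Sum>k<K. pi * weight c k * radius N ^ (2 * k + 2)) \<longlonglongrightarrow> (\<Sum>k<K. pi * weight c k * 1 ^ (2 * k + 2))"
      by (intro tendsto_intros radius_tendsto)
    then show "(\<lambda>N. \<Sum>k<K. pi * weight c k * radius N ^ (2 * k + 2)) \<longlonglongrightarrow> (\<Sum>k<K. pi * weight c k)" by simp
    have "(\<Sum>k<K. pi * weight c k * radius N ^ (2 * k + 2)) \<le> ?I N" for N
    proof (rule sum_le_sums[OF truncated_weight_sums[OF c]])
      fix k
      have "0 \<le> radius N ^ (2 * k + 2)" using radius_bounds[of N] by (intro zero_le_power) auto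
      then show "0 \<le> pi * weight c k * radius N ^ (2 * k + 2)" by (intro mult_nonneg_nonneg) auto
    qed auto
    then show "\<exists>N0. \<forall>N\<ge>N0. (\<Sum>k<K. pi * weight c k * radius N ^ (2 * k + 2)) \<le> ?J"
      by (intro exI[of _ 0] allI impI order_trans[OF _ I_le])
  qed
  then have summ: "summable (\<lambda>k. pi * weight c k)"
    by (intro bounded_imp_summable[where B = ?J]) (simp_all only: lessThan_Suc_atMost[symmetric] partial, simp)
  have "?I N \<le> (\<Sum>k. pi * weight c k)" for N
    by (rule truncated_le[OF c]) (use summ in \<open>simp add: summable_cmult_iff\<close>)
  then have "?J \<le> (\<Sum>k. pi * weight c k)" by (intro LIMSEQ_le_const2[OF I_lim]) auto
  moreover have "(\<Sum>k. pi * weight c k) \<le> ?J" using partial summ by (intro suminf_le_const)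
  ultimately show ?thesis using summ by (simp add: sums_iff)
qed

text \<open>Monotone convergence over the subdiscs, whose integrals are bounded by the series of
  weights.\<close>

lemma has_coeffs_bergman:
  assumes c: "has_coeffs f c" and w: "summable (weight c)"
  shows "f \<in> bergman_space"
proof -
  let ?I = "\<lambda>N. LINT z|area. indicator (ball 0 (radius N)) z * (cmod (f z))\<^sup>2"
  have int: "integrable area (\<lambda>z. indicator (ball 0 (radius N)) z * (cmod (f z))\<^sup>2)" for N
    using truncated_integrable[OF c, of "radius N"] radius_bounds[of N] by auto
  have mono: "indicator (ball 0 (radius M)) z * (cmod (f z))\<^sup>2 \<le> indicator (ball 0 (radius N)) z * (cmod (f z))\<^sup>2" if "M \<le> N" for M N z
    using radius_mono[OF that] by (auto simp: indicator_def)
  have inc: "incseq ?I" by (intro incseq_SucI integral_mono int mono) auto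
  have "\<forall>N. ?I N \<le> (\<Sum>k. pi * weight c k)"
    by (intro allI truncated_le[OF c w])
  then obtain L where L: "?I \<longlonglongrightarrow> L" by (rule incseq_convergent[OF inc])
  have "integrable area (\<lambda>z. (cmod (f z))\<^sup>2)"
  proof (rule integrable_monotone_convergence[OF int _ _ L])
    show "AE z in area. mono (\<lambda>N. indicator (ball 0 (radius N)) z * (cmod (f z))\<^sup>2)"
      by (intro AE_I2 monoI mono)
    show "AE z in area. (\<lambda>N. indicator (ball 0 (radius N)) z * (cmod (f z))\<^sup>2) \<longlonglongrightarrow> (cmod (f z))\<^sup>2"
      by (rule truncation_tendsto)
    show "(\<lambda>z. (cmod (f z))\<^sup>2) \<in> borel_measurable area"
      using has_coeffs_measurable[OF c] by measurable
  qed
  then show ?thesis using c has_coeffs_holomorphic[OF c] by (auto simp: bergman_space_def has_coeffs_def)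
qed

definition power_fun :: "(nat \<Rightarrow> complex) \<Rightarrow> complex \<Rightarrow> complex" where
  "power_fun c z = (if z \<in> unit_disc then \<Sum>k. c k * z ^ k else 0)"

text \<open>The square of \<open>cmod (c k * z ^ k)\<close> is the product of
  \<open>weight c k\<close> and \<open>(k + 1) * cmod z ^ (2 * k)\<close>; the modulus is therefore
  at most their sum, and both are summable.\<close>

lemma has_coeffs_power_fun:
  assumes "summable (weight c)"
  shows "has_coeffs (power_fun c) c"
proof -
  have cancel: "u / K * (K * v) = u * v" if "K \<noteq> 0" for u v K :: real using that by simp
  have "summable (\<lambda>k. c k * z ^ k)" if z: "cmod z < 1" for z
  proof -
    have s: "summable (\<lambda>k. real (k + 1) * (cmod z)\<^sup>2 ^ k)"
    proof -
      have "(cmod z)\<^sup>2 < 1" using power_strict_mono[OF z, of 2] by simp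
      then have "summable (\<lambda>k. of_nat (Suc k) * (cmod z)\<^sup>2 ^ k)"
        by (intro sums_summable[OF geometric_deriv_sums]) simp
      then show ?thesis by (simp only: Suc_eq_plus1)
    qed
    show ?thesis
    proof (rule summable_norm_cancel, rule summable_comparison_test'[OF summable_add[OF assms s]])
      fix k
      define x y where "x = weight c k" and "y = real (k + 1) * (cmod z)\<^sup>2 ^ k"
      have nn: "0 \<le> x" "0 \<le> y" by (simp_all add: x_def y_def)
      have "(cmod (c k * z ^ k))\<^sup>2 = (cmod (c k))\<^sup>2 * (cmod z ^ k)\<^sup>2"
        by (simp only: norm_mult norm_power power_mult_distrib)
      also have "(cmod z ^ k)\<^sup>2 = (cmod z)\<^sup>2 ^ k" by (simp only: power_mult[symmetric] mult.commute)
      also have "(cmod (c k))\<^sup>2 * (cmod z)\<^sup>2 ^ k = x * y"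
        unfolding x_def y_def weight_def by (rule cancel[symmetric]) simp
      also have "x * y \<le> (x + y)\<^sup>2" using mult_nonneg_nonneg[OF nn] zero_le_power2[of x] zero_le_power2[of y]
        unfolding power2_sum mult.assoc by linarith
      finally have "cmod (c k * z ^ k) \<le> x + y" by (rule power2_le_imp_le) (rule add_nonneg_nonneg[OF nn])
      then show "norm (norm (c k * z ^ k)) \<le> weight c k + real (k + 1) * (cmod z)\<^sup>2 ^ k" unfolding x_def y_def real_norm_def abs_norm_cancel .
    qed
  qed
  then show ?thesis unfolding has_coeffs_def power_fun_def by (auto intro: summable_sums)
qed

lemma power_fun_bergman: "summable (weight c) \<Longrightarrow> power_fun c \<in> bergman_space"
  by (rule has_coeffs_bergman[OF has_coeffs_power_fun])

lemma bergman_norm_sums: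
  assumes "f \<in> bergman_space" "has_coeffs f c"
  shows "(\<lambda>k. pi * weight c k) sums (l2_norm f)\<^sup>2"
proof -
  have "integrable area (\<lambda>z. (cmod (f z))\<^sup>2)" using assms(1) by (simp add: bergman_space_def)
  from norm_sums[OF assms(2) this] show ?thesis by (simp add: l2_norm_def)
qed

lemma bergman_weight_summable:
  assumes "f \<in> bergman_space" "has_coeffs f c"
  shows "summable (weight c)"
proof -
  have "summable (\<lambda>k. pi * weight c k)" by (rule sums_summable[OF bergman_norm_sums[OF assms]])
  then have "summable (\<lambda>k. 1 / pi * (pi * weight c k))" by (rule summable_mult)
  then show ?thesis by simp
qed

section \<open>The Bergman projection\<close>

text \<open>Measurability is demanded separately because the integral sees only the modulus.\<close>

definition L2 :: "(complex \<Rightarrow> complex) set" where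
  "L2 = {f. f \<in> borel_measurable area \<and> integrable area (\<lambda>z. (cmod (f z))\<^sup>2)}"

lemma bergman_L2: "f \<in> bergman_space \<Longrightarrow> f \<in> L2"
  by (auto simp: L2_def bergman_space_def intro!: measurable_area_continuous holomorphic_on_imp_continuous_on)

lemma mult_le_sum_squares:
  fixes x y :: real
  assumes "0 \<le> x" "0 \<le> y"
  shows "x * y \<le> x\<^sup>2 + y\<^sup>2"
  using sum_squares_bound[of x y] mult_nonneg_nonneg[OF assms] unfolding mult.assoc by linarith

lemma L2_mult_cnj_integrable:
  assumes "f \<in> L2" "g \<in> L2"
  shows "integrable area (\<lambda>z. f z * cnj (g z))"
proof (rule Bochner_Integration.integrable_bound)
  show "integrable area (\<lambda>z. (cmod (f z))\<^sup>2 + (cmod (g z))\<^sup>2)" using assms by (auto simp: L2_def)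
  show "(\<lambda>z. f z * cnj (g z)) \<in> borel_measurable area"
    using assms by (intro borel_measurable_times borel_measurable_cnj) (auto simp: L2_def)
  show "AE z in area. norm (f z * cnj (g z)) \<le> norm ((cmod (f z))\<^sup>2 + (cmod (g z))\<^sup>2)"
  proof (intro AE_I2)
    fix z
    show "norm (f z * cnj (g z)) \<le> norm ((cmod (f z))\<^sup>2 + (cmod (g z))\<^sup>2)"
      using mult_le_sum_squares[of "cmod (f z)" "cmod (g z)"] by (simp add: norm_mult)
  qed
qed

lemma L2_bounded_mult:
  assumes f: "f \<in> L2" and \<phi>: "\<phi> \<in> borel_measurable area" "\<And>z. z \<in> unit_disc \<Longrightarrow> cmod (\<phi> z) \<le> B"
  shows "(\<lambda>z. \<phi> z * f z) \<in> L2"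
proof -
  have "integrable area (\<lambda>z. (cmod (\<phi> z * f z))\<^sup>2)"
  proof (rule Bochner_Integration.integrable_bound)
    show "integrable area (\<lambda>z. B\<^sup>2 * (cmod (f z))\<^sup>2)" using f by (auto simp: L2_def)
    show "(\<lambda>z. (cmod (\<phi> z * f z))\<^sup>2) \<in> borel_measurable area"
      using f \<phi>(1) by (auto simp: L2_def)
    show "AE z in area. norm ((cmod (\<phi> z * f z))\<^sup>2) \<le> norm (B\<^sup>2 * (cmod (f z))\<^sup>2)"
      using \<phi>(2) by (intro AE_I2) (auto simp: norm_mult power_mult_distrib intro!: mult_right_mono power_mono)
  qed
  then show ?thesis using f \<phi>(1) by (auto simp: L2_def)
qed

lemma L2_cmult: "f \<in> L2 \<Longrightarrow> (\<lambda>z. c * f z) \<in> L2"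
  by (rule L2_bounded_mult[where B = "cmod c"]) auto

lemma L2_add:
  assumes "f \<in> L2" "g \<in> L2"
  shows "(\<lambda>z. f z + g z) \<in> L2"
proof -
  have "integrable area (\<lambda>z. (cmod (f z + g z))\<^sup>2)"
  proof (rule Bochner_Integration.integrable_bound)
    show "integrable area (\<lambda>z. 2 * (cmod (f z))\<^sup>2 + 2 * (cmod (g z))\<^sup>2)" using assms by (auto simp: L2_def)
    show "(\<lambda>z. (cmod (f z + g z))\<^sup>2) \<in> borel_measurable area" using assms by (auto simp: L2_def)
    show "AE z in area. norm ((cmod (f z + g z))\<^sup>2) \<le> norm (2 * (cmod (f z))\<^sup>2 + 2 * (cmod (g z))\<^sup>2)"
    proof (intro AE_I2)
      fix z
      have "(cmod (f z + g z))\<^sup>2 \<le> (cmod (f z) + cmod (g z))\<^sup>2"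
        by (intro power_mono norm_triangle_ineq) auto
      also have "\<dots> \<le> 2 * (cmod (f z))\<^sup>2 + 2 * (cmod (g z))\<^sup>2"
        using sum_squares_bound[of "cmod (f z)" "cmod (g z)"] by (simp add: power2_sum)
      finally show "norm ((cmod (f z + g z))\<^sup>2) \<le> norm (2 * (cmod (f z))\<^sup>2 + 2 * (cmod (g z))\<^sup>2)" by simp
    qed
  qed
  then show ?thesis using assms by (auto simp: L2_def)
qed

lemma L2_diff: "f \<in> L2 \<Longrightarrow> g \<in> L2 \<Longrightarrow> (\<lambda>z. f z - g z) \<in> L2"
  using L2_add[of f "\<lambda>z. -1 * g z"] L2_cmult[of g "-1"] by simp

lemma continuous_L2:
  assumes "continuous_on UNIV f"
  shows "f \<in> L2"
proof -
  have "bounded (f ` cball 0 1)"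
    by (intro compact_imp_bounded compact_continuous_image continuous_on_subset[OF assms]) auto
  then obtain B where B: "\<forall>z\<in>cball 0 1. cmod (f z) \<le> B" by (auto simp: bounded_iff)
  have m: "f \<in> borel_measurable area" by (intro measurable_area_continuous continuous_on_subset[OF assms]) auto
  have "integrable area (\<lambda>z. (cmod (f z))\<^sup>2)"
  proof (rule integrable_area_bounded)
    fix z :: complex assume "z \<in> unit_disc"
    then have "cmod (f z) \<le> B" using B by auto
    then show "norm ((cmod (f z))\<^sup>2) \<le> B\<^sup>2" by (simp add: power_mono)
  qed (use m in measurable)
  then show ?thesis using m by (simp add: L2_def)
qed

lemma l2_inner_diff_left: "f \<in> L2 \<Longrightarrow> g \<in> L2 \<Longrightarrow> h \<in> L2 \<Longrightarrow> l2_inner (\<lambda>z. f z - g z) h = l2_inner f h - l2_inner g h"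
  using Bochner_Integration.integral_diff[OF L2_mult_cnj_integrable[of f h] L2_mult_cnj_integrable[of g h]]
  by (simp add: l2_inner_def left_diff_distrib)

lemma l2_inner_add_left: "f \<in> L2 \<Longrightarrow> g \<in> L2 \<Longrightarrow> h \<in> L2 \<Longrightarrow> l2_inner (\<lambda>z. f z + g z) h = l2_inner f h + l2_inner g h"
  using Bochner_Integration.integral_add[OF L2_mult_cnj_integrable[of f h] L2_mult_cnj_integrable[of g h]]
  by (simp add: l2_inner_def distrib_right)

lemma l2_inner_cmult_left: "l2_inner (\<lambda>z. c * f z) g = c * l2_inner f g"
  by (simp add: l2_inner_def mult.assoc)

lemma l2_inner_cnj: "l2_inner g f = cnj (l2_inner f g)"
proof -
  have "l2_inner g f = (LINT z|area. cnj (f z * cnj (g z)))" by (simp add: l2_inner_def mult.commute)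
  also have "\<dots> = cnj (l2_inner f g)" unfolding l2_inner_def by (rule Bochner_Integration.integral_cnj)
  finally show ?thesis .
qed

lemma l2_inner_self: "l2_inner f f = complex_of_real ((l2_norm f)\<^sup>2)"
proof -
  have "l2_inner f f = (LINT z|area. complex_of_real ((cmod (f z))\<^sup>2))"
    unfolding l2_inner_def by (simp only: complex_norm_square)
  then show ?thesis by (simp add: l2_norm_def integral_complex_of_real del: of_real_power)
qed

lemma monomial_inner:
  assumes f: "f \<in> bergman_space" and c: "has_coeffs f c"
  shows "(LINT z|area. f z * (z ^ m * cnj z ^ n))
    = (if m \<le> n then c (n - m) * complex_of_real (pi / real (n + 1)) else 0)"
proof -
  have b: "(\<lambda>z. z ^ n * cnj z ^ m) \<in> L2" by (intro continuous_L2 continuous_intros)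
  have int: "integrable area (\<lambda>z. f z * (z ^ m * cnj z ^ n))"
    using L2_mult_cnj_integrable[OF bergman_L2[OF f] b] by (simp add: mult.commute)
  let ?I = "\<lambda>N. LINT z|area. indicator (ball 0 (radius N)) z *\<^sub>R (f z * (z ^ m * cnj z ^ n))"
  have "?I \<longlonglongrightarrow> (LINT z|area. f z * (z ^ m * cnj z ^ n))"
  proof (rule integral_dominated_convergence[where w = "\<lambda>z. cmod (f z * (z ^ m * cnj z ^ n))"])
    show "AE z in area. (\<lambda>N. indicator (ball 0 (radius N)) z *\<^sub>R (f z * (z ^ m * cnj z ^ n))) \<longlonglongrightarrow> f z * (z ^ m * cnj z ^ n)"
    proof (rule AE_I2)
      fix z assume "z \<in> space area"
      then have "z \<in> unit_disc" by simp
      from tendsto_scaleR[OF indicator_radius_tendsto[OF this] tendsto_const, of "f z * (z ^ m * cnj z ^ n)"]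
      show "(\<lambda>N. indicator (ball 0 (radius N)) z *\<^sub>R (f z * (z ^ m * cnj z ^ n))) \<longlonglongrightarrow> f z * (z ^ m * cnj z ^ n)" by simp
    qed
    show "(\<lambda>z. f z * (z ^ m * cnj z ^ n)) \<in> borel_measurable area" using int by (rule borel_measurable_integrable)
    then show "(\<lambda>z. indicator (ball 0 (radius N)) z *\<^sub>R (f z * (z ^ m * cnj z ^ n))) \<in> borel_measurable area" for N
      by (intro borel_measurable_scaleR indicator_measurable_area)
    show "integrable area (\<lambda>z. cmod (f z * (z ^ m * cnj z ^ n)))" using int by (rule integrable_norm)
    show "AE z in area. norm (indicator (ball 0 (radius N)) z *\<^sub>R (f z * (z ^ m * cnj z ^ n))) \<le> cmod (f z * (z ^ m * cnj z ^ n))" for N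
      by (intro AE_I2) (simp add: indicator_def)
  qed
  moreover have "?I \<longlonglongrightarrow> (if m \<le> n then c (n - m) * complex_of_real (pi * 1 ^ (2 * n + 2) / real (n + 1)) else 0)"
    unfolding truncated_inner[OF c radius_bounds]
  proof (cases "m \<le> n")
    case True
    have "(\<lambda>N. c (n - m) * complex_of_real (pi * radius N ^ (2 * n + 2) / real (n + 1)))
       \<longlonglongrightarrow> c (n - m) * complex_of_real (pi * 1 ^ (2 * n + 2) / real (n + 1))"
      by (intro tendsto_intros radius_tendsto) simp
    then show "(\<lambda>N. if m \<le> n then c (n - m) * complex_of_real (pi * radius N ^ (2 * n + 2) / real (n + 1)) else 0)
       \<longlonglongrightarrow> (if m \<le> n then c (n - m) * complex_of_real (pi * 1 ^ (2 * n + 2) / real (n + 1)) else 0)"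
      using True by simp
  qed simp
  ultimately show ?thesis using LIMSEQ_unique by force
qed

lemma l2_inner_monomial:
  assumes f: "f \<in> bergman_space" and c: "has_coeffs f c"
  shows "l2_inner f (\<lambda>z. z ^ l) = c l * complex_of_real (pi / real (l + 1))"
  using monomial_inner[OF f c, of 0 l] by (simp add: l2_inner_def)

lemma has_coeffs_diff_poly:
  assumes "has_coeffs f c"
  shows "has_coeffs (\<lambda>z. if z \<in> unit_disc then f z - (\<Sum>k<N. c k * z ^ k) else 0) (\<lambda>k. if k < N then 0 else c k)"
proof -
  have "(\<lambda>k. (if k < N then 0 else c k) * w ^ k) sums (f w - (\<Sum>k<N. c k * w ^ k))" if "w \<in> unit_disc" for w
  proof -
    have "(\<lambda>k. c k * w ^ k) sums f w" using assms that by (simp add: has_coeffs_def)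
    moreover have "(\<lambda>k. if k \<in> {..<N} then c k * w ^ k else 0) sums (\<Sum>k<N. c k * w ^ k)"
      by (rule sums_If_finite_set) simp
    ultimately have "(\<lambda>k. c k * w ^ k - (if k \<in> {..<N} then c k * w ^ k else 0)) sums (f w - (\<Sum>k<N. c k * w ^ k))"
      by (rule sums_diff)
    also have "(\<lambda>k. c k * w ^ k - (if k \<in> {..<N} then c k * w ^ k else 0)) = (\<lambda>k. (if k < N then 0 else c k) * w ^ k)"
      by auto
    finally show ?thesis .
  qed
  then show ?thesis by (auto simp: has_coeffs_def)
qed

text \<open>A weighted form of Young's inequality, in the role of Cauchy-Schwarz.\<close>

lemma l2_inner_bound:
  assumes "f \<in> L2" "g \<in> L2" "0 < e"
  shows "cmod (l2_inner f g) \<le> e * (l2_norm f)\<^sup>2 + (l2_norm g)\<^sup>2 / e"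
proof -
  have "cmod (l2_inner f g) \<le> (LINT z|area. cmod (f z * cnj (g z)))"
    unfolding l2_inner_def by (rule integral_norm_bound)
  also have "\<dots> \<le> (LINT z|area. e * (cmod (f z))\<^sup>2 + (cmod (g z))\<^sup>2 / e)"
  proof (rule integral_mono)
    show "integrable area (\<lambda>z. cmod (f z * cnj (g z)))" using L2_mult_cnj_integrable assms by (intro integrable_norm) auto
    show "integrable area (\<lambda>z. e * (cmod (f z))\<^sup>2 + (cmod (g z))\<^sup>2 / e)" using assms by (auto simp: L2_def)
    fix z
    have "(e * cmod (f z)) * cmod (g z) \<le> (e * cmod (f z))\<^sup>2 + (cmod (g z))\<^sup>2"
      using assms(3) by (intro mult_le_sum_squares) auto
    then have "e * (cmod (f z) * cmod (g z)) \<le> e * (e * (cmod (f z))\<^sup>2 + (cmod (g z))\<^sup>2 / e)"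
      using assms(3) by (simp add: power2_eq_square distrib_left mult_ac)
    then show "cmod (f z * cnj (g z)) \<le> e * (cmod (f z))\<^sup>2 + (cmod (g z))\<^sup>2 / e"
      using assms(3) by (simp add: norm_mult)
  qed
  also have "\<dots> = e * (l2_norm f)\<^sup>2 + (l2_norm g)\<^sup>2 / e"
    using assms by (simp add: l2_norm_def L2_def)
  finally show ?thesis .
qed

text \<open>Since \<open>w\<close> is orthogonal to the partial sums, the inner product with
  \<open>g\<close> equals that with the tail \<open>r N\<close>, whose norm tends to 0. In the bound
  \<open>N\<close> goes to infinity before \<open>e\<close> goes to 0.\<close>

lemma orthogonal_bergman:
  assumes w: "w \<in> L2" and orth: "\<And>l. l2_inner w (\<lambda>z. z ^ l) = 0" and g: "g \<in> bergman_space"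
  shows "l2_inner w g = 0"
proof -
  obtain c where c: "has_coeffs g c" using bergman_has_coeffs[OF g] .
  define r where "r N z = (if z \<in> unit_disc then g z - (\<Sum>k<N. c k * z ^ k) else 0)" for N z
  have rc: "has_coeffs (r N) (\<lambda>k. if k < N then 0 else c k)" for N
    unfolding r_def using has_coeffs_diff_poly[OF c] .
  have sc: "summable (weight c)" using bergman_weight_summable[OF g c] .
  have wr: "weight (\<lambda>k. if k < N then 0 else c k) k = (if k < N then 0 else weight c k)" for N k
    by (simp add: weight_def)
  have rB: "r N \<in> bergman_space" for N
  proof (rule has_coeffs_bergman[OF rc])
    show "summable (weight (\<lambda>k. if k < N then 0 else c k))"
      by (rule summable_comparison_test'[OF sc, of 0]) (auto simp: wr)
  qed
  have poly: "(\<lambda>z. \<Sum>k<N. c k * z ^ k) \<in> L2" for N by (intro continuous_L2 continuous_intros)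
  have eq: "l2_inner w g = l2_inner w (r N)" for N
  proof -
    have "l2_inner w (\<lambda>z. \<Sum>k<N. c k * z ^ k) = (LINT z|area. (\<Sum>k<N. cnj (c k) * (w z * cnj (z ^ k))))"
      unfolding l2_inner_def by (simp add: sum_distrib_left mult_ac)
    also have "\<dots> = (\<Sum>k<N. cnj (c k) * l2_inner w (\<lambda>z. z ^ k))"
      unfolding l2_inner_def by (intro integral_sum_mult L2_mult_cnj_integrable w continuous_L2 continuous_intros)
    finally have z: "l2_inner w (\<lambda>z. \<Sum>k<N. c k * z ^ k) = 0" using orth by simp
    have "l2_inner w (r N) = l2_inner w (\<lambda>z. g z - (\<Sum>k<N. c k * z ^ k))"
      unfolding l2_inner_def by (intro Bochner_Integration.integral_cong) (auto simp: r_def)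
    also have "\<dots> = cnj (l2_inner g w - l2_inner (\<lambda>z. \<Sum>k<N. c k * z ^ k) w)"
      by (subst l2_inner_cnj) (simp add: l2_inner_diff_left bergman_L2 g poly w)
    also have "\<dots> = l2_inner w g - l2_inner w (\<lambda>z. \<Sum>k<N. c k * z ^ k)"
      by (simp add: l2_inner_cnj[of _ w])
    finally show ?thesis using z by simp
  qed
  have rn: "(l2_norm (r N))\<^sup>2 = (\<Sum>k. pi * weight c (k + N))" for N
  proof -
    have "(\<lambda>k. pi * weight (\<lambda>k. if k < N then 0 else c k) k) sums (l2_norm (r N))\<^sup>2"
      by (rule bergman_norm_sums[OF rB rc])
    then have "(\<lambda>k. pi * weight (\<lambda>k. if k < N then 0 else c k) (k + N)) sums (l2_norm (r N))\<^sup>2"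
      by (subst sums_iff_shift) (simp add: wr)
    then show ?thesis by (simp add: wr sums_iff)
  qed
  have lim: "(\<lambda>N. (l2_norm (r N))\<^sup>2) \<longlonglongrightarrow> 0"
    unfolding rn by (intro suminf_exist_split2 summable_mult sc)
  have bound: "cmod (l2_inner w g) \<le> e * (l2_norm w)\<^sup>2" if e: "0 < e" for e
  proof (rule LIMSEQ_le_const)
    have "(\<lambda>N. e * (l2_norm w)\<^sup>2 + (l2_norm (r N))\<^sup>2 / e) \<longlonglongrightarrow> e * (l2_norm w)\<^sup>2 + 0 / e"
      using e by (intro tendsto_intros lim) auto
    then show "(\<lambda>N. e * (l2_norm w)\<^sup>2 + (l2_norm (r N))\<^sup>2 / e) \<longlonglongrightarrow> e * (l2_norm w)\<^sup>2" by simp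
    show "\<exists>N0. \<forall>N\<ge>N0. cmod (l2_inner w g) \<le> e * (l2_norm w)\<^sup>2 + (l2_norm (r N))\<^sup>2 / e"
      using l2_inner_bound[OF w bergman_L2[OF rB] e] eq by auto
  qed
  have "((\<lambda>e. e * (l2_norm w)\<^sup>2) \<longlongrightarrow> 0 * (l2_norm w)\<^sup>2) (at_right 0)"
    by (intro tendsto_intros)
  then have "cmod (l2_inner w g) \<le> 0 * (l2_norm w)\<^sup>2"
    by (rule tendsto_lowerbound) (use bound in \<open>auto simp: eventually_at_right_less intro: eventually_mono[OF eventually_at_right_less]\<close>)
  then show ?thesis by simp
qed

section \<open>Linear structure of the Bergman space and identification of the projection\<close>

lemma bergman_diff:
  assumes "f \<in> bergman_space" "g \<in> bergman_space"
  shows "(\<lambda>z. f z - g z) \<in> bergman_space"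
  using assms L2_diff[OF bergman_L2[OF assms(1)] bergman_L2[OF assms(2)]]
  by (auto simp: bergman_space_def L2_def intro: holomorphic_intros)

lemma bergman_add:
  assumes "f \<in> bergman_space" "g \<in> bergman_space"
  shows "(\<lambda>z. f z + g z) \<in> bergman_space"
  using assms L2_add[OF bergman_L2[OF assms(1)] bergman_L2[OF assms(2)]]
  by (auto simp: bergman_space_def L2_def intro: holomorphic_intros)

lemma bergman_cmult:
  assumes "f \<in> bergman_space"
  shows "(\<lambda>z. c * f z) \<in> bergman_space"
  using assms L2_cmult[OF bergman_L2[OF assms]]
  by (auto simp: bergman_space_def L2_def intro: holomorphic_intros)

lemma bergman_norm_zero:
  assumes f: "f \<in> bergman_space" and "l2_inner f f = 0"
  shows "f = (\<lambda>_. 0)"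
proof -
  obtain c where c: "has_coeffs f c" using bergman_has_coeffs[OF f] .
  have "(\<lambda>k. pi * weight c k) sums 0"
    using bergman_norm_sums[OF f c] assms(2) by (simp add: l2_inner_self del: of_real_power)
  then have "pi * weight c k = 0" for k by (subst (asm) sums_iff, auto simp: suminf_eq_zero_iff)
  then have "c k = 0" for k by (simp add: weight_def)
  then have "f z = 0" for z
    using c sums_unique2[of "\<lambda>_. 0::complex" 0] by (cases "z \<in> unit_disc") (auto simp: has_coeffs_def)
  then show ?thesis by auto
qed

text \<open>An explicit candidate \<open>F\<close>, tested against monomials only, takes the place
  of an abstract existence argument; uniqueness comes from definiteness of the inner
  product.\<close>

lemma bergman_proj_eq:
  assumes h: "h \<in> L2" and F: "F \<in> bergman_space"
    and orth: "\<And>l. l2_inner (\<lambda>z. h z - F z) (\<lambda>z. z ^ l) = 0"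
  shows "bergman_proj h = F" "\<And>g. g \<in> bergman_space \<Longrightarrow> l2_inner h g = l2_inner F g"
proof -
  have o: "l2_inner (\<lambda>z. h z - F z) g = 0" if "g \<in> bergman_space" for g
    using orthogonal_bergman[OF L2_diff[OF h bergman_L2[OF F]] orth that] .
  then show "l2_inner h g = l2_inner F g" if "g \<in> bergman_space" for g
    using that l2_inner_diff_left[OF h bergman_L2[OF F] bergman_L2[OF that]] by simp
  show "bergman_proj h = F"
    unfolding bergman_proj_def
  proof (rule the_equality)
    fix f assume f: "f \<in> bergman_space \<and> (\<forall>g\<in>bergman_space. l2_inner (\<lambda>z. h z - f z) g = 0)"
    have d: "(\<lambda>z. f z - F z) \<in> bergman_space" using f F by (intro bergman_diff) auto
    have "l2_inner (\<lambda>z. f z - F z) (\<lambda>z. f z - F z) =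
        l2_inner (\<lambda>z. h z - F z) (\<lambda>z. f z - F z) - l2_inner (\<lambda>z. h z - f z) (\<lambda>z. f z - F z)"
      using f F h d by (simp add: l2_inner_diff_left bergman_L2)
    then have "l2_inner (\<lambda>z. f z - F z) (\<lambda>z. f z - F z) = 0" using o f d by simp
    from bergman_norm_zero[OF d this] have "f z - F z = 0" for z by (rule fun_cong)
    then show "f = F" by auto
  qed (use F o in auto)
qed

section \<open>Toeplitz operators whose symbol is a sum of two monomials\<close>

lemma sums_drop_zeros:
  fixes h :: "nat \<Rightarrow> 'a::real_normed_vector"
  assumes "h sums s" "\<And>l. l < d \<Longrightarrow> h l = 0"
  shows "(\<lambda>k. h (k + d)) sums s"
  using assms by (subst sums_iff_shift) (simp add: sum.neutral)

lemma sums_delay: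
  fixes g :: "nat \<Rightarrow> 'a::real_normed_vector"
  assumes "g sums s"
  shows "(\<lambda>l. if d \<le> l then g (l - d) else 0) sums s"
  using sums_iff_shift[of "\<lambda>l. if d \<le> l then g (l - d) else 0" d s] assms by (simp add: sum.neutral)

text \<open>The reindexing is a shift: for \<open>m <= n\<close> initial terms are lost, otherwise
  zeros are put in front.\<close>

lemma suminf_reindex_le:
  fixes g :: "nat \<Rightarrow> real"
  assumes g: "summable g" "\<And>k. 0 \<le> g k"
  shows "summable (\<lambda>l. if m \<le> n + l then g (n + l - m) else 0)"
    and "(\<Sum>l. if m \<le> n + l then g (n + l - m) else 0) \<le> suminf g"
proof -
  have "summable (\<lambda>l. if m \<le> n + l then g (n + l - m) else 0) \<and> (\<Sum>l. if m \<le> n + l then g (n + l - m) else 0) \<le> suminf g"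
  proof (cases "m \<le> n")
    case True
    then have e: "(\<lambda>l. if m \<le> n + l then g (n + l - m) else 0) = (\<lambda>l. g (l + (n - m)))"
    proof (intro ext)
      fix l
      have "n + l - m = l + (n - m)" "m \<le> n + l" using True by arith+
      then show "(if m \<le> n + l then g (n + l - m) else 0) = g (l + (n - m))" by simp
    qed
    have "suminf g = (\<Sum>l. g (l + (n - m))) + sum g {..<n - m}"
      by (rule suminf_split_initial_segment[OF g(1)])
    moreover have "0 \<le> sum g {..<n - m}" using g(2) by (rule sum_nonneg)
    ultimately show ?thesis unfolding e using summable_ignore_initial_segment[OF g(1)] by simp
  next
    case False
    then have e: "(\<lambda>l. if m \<le> n + l then g (n + l - m) else 0) = (\<lambda>l. if m - n \<le> l then g (l - (m - n)) else 0)"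
    proof (intro ext)
      fix l
      have "n + l - m = l - (m - n)" "m \<le> n + l \<longleftrightarrow> m - n \<le> l" using False by arith+
      then show "(if m \<le> n + l then g (n + l - m) else 0) = (if m - n \<le> l then g (l - (m - n)) else 0)" by simp
    qed
    show ?thesis unfolding e using sums_delay[OF summable_sums[OF g(1)], of "m - n"] by (auto simp: sums_iff)
  qed
  then show "summable (\<lambda>l. if m \<le> n + l then g (n + l - m) else 0)"
    and "(\<Sum>l. if m \<le> n + l then g (n + l - m) else 0) \<le> suminf g" by auto
qed

text \<open>The inner product of \<open>z ^ m * cnj z ^ n * u\<close> with \<open>z ^ l\<close>,
  divided by \<open>pi\<close>; the projection has \<open>l + 1\<close> times this number as its
  Taylor coefficient.\<close>

definition mono_coeff :: "nat \<Rightarrow> nat \<Rightarrow> (nat \<Rightarrow> complex) \<Rightarrow> nat \<Rightarrow> complex" where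
  "mono_coeff m n U l = (if m \<le> n + l then U (n + l - m) / complex_of_real (real (n + l + 1)) else 0)"

definition mono_weight :: "nat \<Rightarrow> nat \<Rightarrow> (nat \<Rightarrow> complex) \<Rightarrow> nat \<Rightarrow> real" where
  "mono_weight m n U l = real (l + 1) * (cmod (mono_coeff m n U l))\<^sup>2"

lemma mono_weight_eq:
  "mono_weight m n U l = (if m \<le> n + l then real (l + 1) / (real (n + l + 1))\<^sup>2 * (cmod (U (n + l - m)))\<^sup>2 else 0)"
  unfolding mono_weight_def mono_coeff_def by (simp add: norm_divide power_divide del: of_nat_add of_nat_Suc)

lemma mono_weight_nonneg: "0 \<le> mono_weight m n U l"
  by (simp add: mono_weight_def)

text \<open>The termwise reason why multiplication by a monomial followed by projection is a
  contraction: \<open>(l + 1) * (n + l - m + 1) <= (n + l + 1)^2\<close>.\<close>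

lemma mono_weight_le: "mono_weight m n U l \<le> (if m \<le> n + l then weight U (n + l - m) else 0)"
proof (cases "m \<le> n + l")
  case True
  have "real (l + 1) * real (n + l - m + 1) \<le> real (n + l + 1) * real (n + l + 1)"
    by (intro mult_mono) auto
  then have "real (l + 1) / (real (n + l + 1))\<^sup>2 \<le> 1 / real (n + l - m + 1)"
    by (simp add: frac_le_eq divide_le_eq le_divide_eq power2_eq_square del: of_nat_add of_nat_Suc of_nat_mult)
  then have "real (l + 1) / (real (n + l + 1))\<^sup>2 * (cmod (U (n + l - m)))\<^sup>2 \<le> 1 / real (n + l - m + 1) * (cmod (U (n + l - m)))\<^sup>2"
    by (rule mult_right_mono) simp
  then show ?thesis using True unfolding mono_weight_eq weight_def by simp
qed (simp add: mono_weight_eq)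

lemma mono_weight_summable:
  assumes "summable (weight U)"
  shows "summable (mono_weight m n U)" "suminf (mono_weight m n U) \<le> suminf (weight U)"
proof -
  note r = suminf_reindex_le[OF assms weight_nonneg, of m n]
  show s: "summable (mono_weight m n U)"
    by (rule summable_comparison_test'[OF r(1), of 0]) (use mono_weight_le mono_weight_nonneg in \<open>simp only: real_norm_def abs_of_nonneg\<close>)
  show "suminf (mono_weight m n U) \<le> suminf (weight U)"
    by (rule order_trans[OF suminf_le[OF mono_weight_le s r(1)] r(2)])
qed

definition binomial_symbol :: "complex \<Rightarrow> complex \<Rightarrow> nat \<Rightarrow> nat \<Rightarrow> nat \<Rightarrow> nat \<Rightarrow> complex \<Rightarrow> complex" where
  "binomial_symbol a b m n i j z = a * z ^ m * cnj z ^ n + b * z ^ i * cnj z ^ j"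

definition toeplitz_coeff :: "complex \<Rightarrow> complex \<Rightarrow> nat \<Rightarrow> nat \<Rightarrow> nat \<Rightarrow> nat \<Rightarrow> (nat \<Rightarrow> complex) \<Rightarrow> nat \<Rightarrow> complex" where
  "toeplitz_coeff a b m n i j U l = complex_of_real (real (l + 1)) * (a * mono_coeff m n U l + b * mono_coeff i j U l)"

lemma weight_toeplitz_coeff:
  "weight (toeplitz_coeff a b m n i j U) l = real (l + 1) * (cmod (a * mono_coeff m n U l + b * mono_coeff i j U l))\<^sup>2"
proof -
  have "(K * x)\<^sup>2 / K = K * x\<^sup>2" if "K \<noteq> 0" for K x :: real using that by (simp add: power2_eq_square)
  from this[of "real (l + 1)"] show ?thesis
    unfolding weight_def toeplitz_coeff_def norm_mult norm_of_real by simp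
qed

lemma cmod_add_sq: "(cmod (x + y))\<^sup>2 = (cmod x)\<^sup>2 + (cmod y)\<^sup>2 + 2 * Re (x * cnj y)"
  by (simp add: cmod_power2 power2_sum algebra_simps)

lemma cmod_add_sq_le: "(cmod (x + y))\<^sup>2 \<le> 2 * (cmod x)\<^sup>2 + 2 * (cmod y)\<^sup>2"
proof -
  have "0 \<le> (cmod (x - y))\<^sup>2" by simp
  also have "\<dots> = (cmod x)\<^sup>2 + (cmod y)\<^sup>2 - 2 * Re (x * cnj y)" using cmod_add_sq[of x "- y"] by simp
  finally show ?thesis using cmod_add_sq[of x y] by simp
qed

lemma weight_toeplitz_coeff_le:
  "weight (toeplitz_coeff a b m n i j U) l \<le> 2 * (cmod a)\<^sup>2 * mono_weight m n U l + 2 * (cmod b)\<^sup>2 * mono_weight i j U l"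
proof -
  have "real (l + 1) * (cmod (a * mono_coeff m n U l + b * mono_coeff i j U l))\<^sup>2
      \<le> real (l + 1) * (2 * (cmod (a * mono_coeff m n U l))\<^sup>2 + 2 * (cmod (b * mono_coeff i j U l))\<^sup>2)"
    by (rule mult_left_mono[OF cmod_add_sq_le]) simp
  also have "\<dots> = 2 * (cmod a)\<^sup>2 * mono_weight m n U l + 2 * (cmod b)\<^sup>2 * mono_weight i j U l"
    by (simp only: norm_mult power_mult_distrib mono_weight_def distrib_left mult_ac)
  finally show ?thesis unfolding weight_toeplitz_coeff .
qed

lemma toeplitz_coeff_summable:
  assumes "summable (weight U)"
  shows "summable (weight (toeplitz_coeff a b m n i j U))"
    and "suminf (weight (toeplitz_coeff a b m n i j U)) \<le> (2 * (cmod a)\<^sup>2 + 2 * (cmod b)\<^sup>2) * suminf (weight U)"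
proof -
  note s = mono_weight_summable[OF assms]
  have s2: "summable (\<lambda>l. 2 * (cmod a)\<^sup>2 * mono_weight m n U l + 2 * (cmod b)\<^sup>2 * mono_weight i j U l)"
    by (intro summable_add summable_mult s)
  show s1: "summable (weight (toeplitz_coeff a b m n i j U))"
    by (rule summable_comparison_test'[OF s2, of 0]) (use weight_toeplitz_coeff_le in \<open>simp only: real_norm_def abs_of_nonneg weight_nonneg\<close>)
  have "suminf (weight (toeplitz_coeff a b m n i j U)) \<le> (\<Sum>l. 2 * (cmod a)\<^sup>2 * mono_weight m n U l + 2 * (cmod b)\<^sup>2 * mono_weight i j U l)"
    by (rule suminf_le[OF weight_toeplitz_coeff_le s1 s2])
  also have "\<dots> = 2 * (cmod a)\<^sup>2 * suminf (mono_weight m n U) + 2 * (cmod b)\<^sup>2 * suminf (mono_weight i j U)"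
    by (subst suminf_add[symmetric]) (intro summable_mult s, intro summable_mult s, simp add: suminf_mult s)
  also have "\<dots> \<le> 2 * (cmod a)\<^sup>2 * suminf (weight U) + 2 * (cmod b)\<^sup>2 * suminf (weight U)"
    by (intro add_mono mult_left_mono s) auto
  finally show "suminf (weight (toeplitz_coeff a b m n i j U)) \<le> (2 * (cmod a)\<^sup>2 + 2 * (cmod b)\<^sup>2) * suminf (weight U)"
    by (simp only: distrib_right)
qed

lemma monomial_mult_L2:
  assumes "u \<in> L2"
  shows "(\<lambda>z. z ^ m * cnj z ^ n * u z) \<in> L2"
proof (rule L2_bounded_mult[OF assms, where B = 1])
  show "(\<lambda>z. z ^ m * cnj z ^ n) \<in> borel_measurable area" by (intro measurable_area_continuous continuous_intros)
  fix z :: complex assume "z \<in> unit_disc"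
  then have "cmod z ^ m * cmod z ^ n \<le> 1 * 1" by (intro mult_mono power_le_one) auto
  then show "cmod (z ^ m * cnj z ^ n) \<le> 1" by (simp add: norm_mult norm_power)
qed

lemma symbol_mult_L2:
  assumes "u \<in> L2"
  shows "(\<lambda>z. binomial_symbol a b m n i j z * u z) \<in> L2"
proof -
  have "(\<lambda>z. a * (z ^ m * cnj z ^ n * u z) + b * (z ^ i * cnj z ^ j * u z)) \<in> L2"
    by (intro L2_add L2_cmult monomial_mult_L2 assms)
  then show ?thesis by (simp add: binomial_symbol_def algebra_simps)
qed

lemma l2_inner_monomial_mult:
  assumes u: "u \<in> bergman_space" and U: "has_coeffs u U"
  shows "l2_inner (\<lambda>z. z ^ m * cnj z ^ n * u z) (\<lambda>z. z ^ l) = mono_coeff m n U l * complex_of_real pi"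
proof -
  have "l2_inner (\<lambda>z. z ^ m * cnj z ^ n * u z) (\<lambda>z. z ^ l) = (LINT z|area. u z * (z ^ m * cnj z ^ (n + l)))"
    unfolding l2_inner_def by (simp add: power_add mult_ac)
  then show ?thesis unfolding monomial_inner[OF u U] mono_coeff_def by simp
qed

text \<open>The coefficients are forced by the inner products with monomials. The last claim, which
  removes the projection inside an inner product, is what the adjoint is computed from.\<close>

lemma toeplitz_power_fun:
  fixes a b m n i j
  assumes u: "u \<in> bergman_space" and U: "has_coeffs u U"
  defines "F \<equiv> power_fun (toeplitz_coeff a b m n i j U)"
  shows "toeplitz (binomial_symbol a b m n i j) u = F"
    and "F \<in> bergman_space" "has_coeffs F (toeplitz_coeff a b m n i j U)"
    and "\<And>g. g \<in> bergman_space \<Longrightarrow> l2_inner (\<lambda>z. binomial_symbol a b m n i j z * u z) g = l2_inner F g"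
proof -
  note s = toeplitz_coeff_summable(1)[OF bergman_weight_summable[OF u U], of a b m n i j]
  show F: "F \<in> bergman_space" and Fc: "has_coeffs F (toeplitz_coeff a b m n i j U)"
    unfolding F_def using power_fun_bergman[OF s] has_coeffs_power_fun[OF s] .
  let ?h = "\<lambda>z. binomial_symbol a b m n i j z * u z"
  have h: "?h \<in> L2" by (rule symbol_mult_L2[OF bergman_L2[OF u]])
  have mono: "(\<lambda>z. z ^ l) \<in> L2" for l by (intro continuous_L2 continuous_intros)
  have orth: "l2_inner (\<lambda>z. ?h z - F z) (\<lambda>z. z ^ l) = 0" for l
  proof -
    have "l2_inner ?h (\<lambda>z. z ^ l) = l2_inner (\<lambda>z. a * (z ^ m * cnj z ^ n * u z) + b * (z ^ i * cnj z ^ j * u z)) (\<lambda>z. z ^ l)"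
      by (simp add: binomial_symbol_def algebra_simps)
    also have "\<dots> = a * (mono_coeff m n U l * complex_of_real pi) + b * (mono_coeff i j U l * complex_of_real pi)"
      unfolding l2_inner_add_left[OF L2_cmult[OF monomial_mult_L2[OF bergman_L2[OF u]]] L2_cmult[OF monomial_mult_L2[OF bergman_L2[OF u]]] mono]
        l2_inner_cmult_left l2_inner_monomial_mult[OF u U] ..
    also have "\<dots> = toeplitz_coeff a b m n i j U l * complex_of_real (pi / real (l + 1))"
    proof -
      have "a' * (x * P) + b' * (y * P) = K * (a' * x + b' * y) * (P / K)" if "K \<noteq> 0" for a' b' x y K P :: complex
        using that by (simp add: distrib_left mult_ac)
      from this[of "complex_of_real (real (l + 1))"] show ?thesis
        unfolding toeplitz_coeff_def of_real_divide by (simp only: of_real_eq_0_iff)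
    qed
    also have "\<dots> = l2_inner F (\<lambda>z. z ^ l)" by (rule l2_inner_monomial[OF F Fc, symmetric])
    finally show ?thesis using l2_inner_diff_left[OF h bergman_L2[OF F] mono] by simp
  qed
  show "toeplitz (binomial_symbol a b m n i j) u = F"
    unfolding toeplitz_def by (rule bergman_proj_eq(1)[OF h F orth])
  show "l2_inner ?h g = l2_inner F g" if "g \<in> bergman_space" for g
    by (rule bergman_proj_eq(2)[OF h F orth that])
qed

section \<open>Boundedness, adjoint and self-commutator\<close>

lemma has_coeffs_unique:
  assumes "has_coeffs f c" "has_coeffs g c"
  shows "f = g"
proof
  fix z
  show "f z = g z"
  proof (cases "z \<in> unit_disc")
    case True
    then have "(\<lambda>k. c k * z ^ k) sums f z" "(\<lambda>k. c k * z ^ k) sums g z" using assms by (auto simp: has_coeffs_def)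
    then show ?thesis by (rule sums_unique2)
  qed (use assms in \<open>auto simp: has_coeffs_def\<close>)
qed

lemma has_coeffs_add:
  assumes "has_coeffs f c" "has_coeffs g d"
  shows "has_coeffs (\<lambda>z. f z + g z) (\<lambda>k. c k + d k)"
  using assms unfolding has_coeffs_def distrib_right by (auto intro: sums_add)

lemma has_coeffs_cmult:
  assumes "has_coeffs f c"
  shows "has_coeffs (\<lambda>z. x * f z) (\<lambda>k. x * c k)"
  using assms unfolding has_coeffs_def mult.assoc by (auto intro: sums_mult)

lemma toeplitz_coeff_add:
  "toeplitz_coeff a b m n i j (\<lambda>k. U k + V k) = (\<lambda>l. toeplitz_coeff a b m n i j U l + toeplitz_coeff a b m n i j V l)"
  unfolding toeplitz_coeff_def mono_coeff_def by (intro ext) (simp add: add_divide_distrib distrib_left del: of_nat_add of_nat_Suc)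

lemma toeplitz_coeff_cmult:
  "toeplitz_coeff a b m n i j (\<lambda>k. x * U k) = (\<lambda>l. x * toeplitz_coeff a b m n i j U l)"
  unfolding toeplitz_coeff_def mono_coeff_def by (intro ext) (simp add: distrib_left mult.left_commute[of x] del: of_nat_add of_nat_Suc)

lemma l2_norm_nonneg: "0 \<le> l2_norm f"
  by (simp add: l2_norm_def)

lemma toeplitz_norm_sums:
  assumes u: "u \<in> bergman_space" and U: "has_coeffs u U"
  shows "(\<lambda>k. pi * weight (toeplitz_coeff a b m n i j U) k) sums (l2_norm (toeplitz (binomial_symbol a b m n i j) u))\<^sup>2"
  unfolding toeplitz_power_fun(1)[OF u U]
  by (rule bergman_norm_sums[OF toeplitz_power_fun(2,3)[OF u U]])

lemma toeplitz_bergman: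
  assumes "u \<in> bergman_space"
  shows "toeplitz (binomial_symbol a b m n i j) u \<in> bergman_space"
  using bergman_has_coeffs[OF assms] toeplitz_power_fun(1,2)[OF assms] by metis

text \<open>Linearity is checked on coefficients, which determine the function; the norm bound
  combines the contraction estimates of the two monomials.\<close>

lemma bounded_toeplitz: "bounded_operator (toeplitz (binomial_symbol a b m n i j))" (is "bounded_operator ?T")
  unfolding bounded_operator_def
proof (intro conjI ballI allI)
  fix u assume u: "u \<in> bergman_space"
  obtain U where U: "has_coeffs u U" using bergman_has_coeffs[OF u] .
  show "?T u \<in> bergman_space" by (rule toeplitz_bergman[OF u])
  show "?T (\<lambda>z. x * u z) = (\<lambda>z. x * ?T u z)" for x
    unfolding toeplitz_power_fun(1)[OF u U] toeplitz_power_fun(1)[OF bergman_cmult[OF u] has_coeffs_cmult[OF U]]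
    by (rule has_coeffs_unique[OF toeplitz_power_fun(3)[OF bergman_cmult[OF u] has_coeffs_cmult[OF U], unfolded toeplitz_coeff_cmult]
        has_coeffs_cmult[OF toeplitz_power_fun(3)[OF u U]], folded toeplitz_coeff_cmult])
  fix v assume v: "v \<in> bergman_space"
  obtain V where V: "has_coeffs v V" using bergman_has_coeffs[OF v] .
  show "?T (\<lambda>z. u z + v z) = (\<lambda>z. ?T u z + ?T v z)"
    unfolding toeplitz_power_fun(1)[OF u U] toeplitz_power_fun(1)[OF v V] toeplitz_power_fun(1)[OF bergman_add[OF u v] has_coeffs_add[OF U V]]
    by (rule has_coeffs_unique[OF toeplitz_power_fun(3)[OF bergman_add[OF u v] has_coeffs_add[OF U V], unfolded toeplitz_coeff_add]
        has_coeffs_add[OF toeplitz_power_fun(3)[OF u U] toeplitz_power_fun(3)[OF v V]], folded toeplitz_coeff_add])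
next
  show "\<exists>B. \<forall>u\<in>bergman_space. l2_norm (?T u) \<le> B * l2_norm u"
  proof (intro exI ballI)
    fix u assume u: "u \<in> bergman_space"
    obtain U where U: "has_coeffs u U" using bergman_has_coeffs[OF u] .
    note s = bergman_weight_summable[OF u U]
    note t = toeplitz_coeff_summable[OF s, of a b m n i j]
    let ?c = "2 * (cmod a)\<^sup>2 + 2 * (cmod b)\<^sup>2"
    have "(l2_norm (?T u))\<^sup>2 = pi * suminf (weight (toeplitz_coeff a b m n i j U))"
      using sums_unique[OF toeplitz_norm_sums[OF u U]] suminf_mult[OF t(1)] by simp
    also have "\<dots> \<le> pi * (?c * suminf (weight U))" by (rule mult_left_mono[OF t(2)]) simp
    also have "\<dots> = ?c * (l2_norm u)\<^sup>2"
      using sums_unique[OF bergman_norm_sums[OF u U]] suminf_mult[OF s] by simp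
    also have "\<dots> = (sqrt ?c * l2_norm u)\<^sup>2" by (simp add: power_mult_distrib)
    finally show "l2_norm (?T u) \<le> sqrt ?c * l2_norm u"
      by (rule power2_le_imp_le) (simp add: l2_norm_nonneg)
  qed
qed

text \<open>The conjugate symbol is again a sum of two monomials, with exponents exchanged, so the
  formulas for the operator also describe its adjoint.\<close>

lemma adjoint_toeplitz:
  assumes v: "v \<in> bergman_space"
  shows "adjoint_op (toeplitz (binomial_symbol a b m n i j)) v = toeplitz (binomial_symbol (cnj a) (cnj b) n m j i) v"
    and "\<And>u. u \<in> bergman_space \<Longrightarrow> l2_inner (toeplitz (binomial_symbol a b m n i j) u) v = l2_inner u (toeplitz (binomial_symbol (cnj a) (cnj b) n m j i) v)"
proof -
  let ?T = "toeplitz (binomial_symbol a b m n i j)" and ?T' = "toeplitz (binomial_symbol (cnj a) (cnj b) n m j i)"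
  show adj: "l2_inner (?T u) v = l2_inner u (?T' v)" if u: "u \<in> bergman_space" for u
  proof -
    obtain U where U: "has_coeffs u U" using bergman_has_coeffs[OF u] .
    obtain V where V: "has_coeffs v V" using bergman_has_coeffs[OF v] .
    have "l2_inner (?T u) v = l2_inner (\<lambda>z. binomial_symbol a b m n i j z * u z) v"
      unfolding toeplitz_power_fun(1)[OF u U] by (rule toeplitz_power_fun(4)[OF u U v, symmetric])
    also have "\<dots> = cnj (l2_inner (\<lambda>z. binomial_symbol (cnj a) (cnj b) n m j i z * v z) u)"
      unfolding l2_inner_cnj[symmetric] by (simp add: l2_inner_def binomial_symbol_def algebra_simps)
    also have "\<dots> = cnj (l2_inner (?T' v) u)"
      unfolding toeplitz_power_fun(1)[OF v V] toeplitz_power_fun(4)[OF v V u] ..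
    finally show ?thesis unfolding l2_inner_cnj[symmetric] .
  qed
  show "adjoint_op ?T v = ?T' v"
    unfolding adjoint_op_def
  proof (rule the_equality)
    fix w assume w: "w \<in> bergman_space \<and> (\<forall>u\<in>bergman_space. l2_inner (?T u) v = l2_inner u w)"
    have T': "?T' v \<in> bergman_space" by (rule toeplitz_bergman[OF v])
    have d: "(\<lambda>z. w z - ?T' v z) \<in> bergman_space" using w T' by (intro bergman_diff) auto
    have "l2_inner (\<lambda>z. w z - ?T' v z) (\<lambda>z. w z - ?T' v z) = l2_inner w (\<lambda>z. w z - ?T' v z) - l2_inner (?T' v) (\<lambda>z. w z - ?T' v z)"
      using w T' d by (intro l2_inner_diff_left bergman_L2) auto
    also have "\<dots> = cnj (l2_inner (\<lambda>z. w z - ?T' v z) w - l2_inner (\<lambda>z. w z - ?T' v z) (?T' v))"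
      by (simp add: l2_inner_cnj[of _ "\<lambda>z. w z - ?T' v z"])
    also have "\<dots> = 0" using w adj[OF d] d by auto
    finally have "(\<lambda>z. w z - ?T' v z) = (\<lambda>_. 0)" by (rule bergman_norm_zero[OF d])
    then have "w z - ?T' v z = 0" for z by (rule fun_cong)
    then show "w = ?T' v" by auto
  qed (use toeplitz_bergman[OF v] adj in auto)
qed

lemma self_commutator_inner:
  fixes a b m n i j
  defines "T \<equiv> toeplitz (binomial_symbol a b m n i j)" and "T' \<equiv> toeplitz (binomial_symbol (cnj a) (cnj b) n m j i)"
  assumes u: "u \<in> bergman_space"
  shows "l2_inner (self_commutator T u) u = complex_of_real ((l2_norm (T u))\<^sup>2 - (l2_norm (T' u))\<^sup>2)"
proof -
  have B: "T u \<in> bergman_space" "T' u \<in> bergman_space" unfolding T_def T'_def by (rule toeplitz_bergman[OF u])+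
  then have B2: "T' (T u) \<in> bergman_space" "T (T' u) \<in> bergman_space" unfolding T_def T'_def by (auto intro: toeplitz_bergman)
  have adj: "l2_inner (T x) y = l2_inner x (T' y)" "adjoint_op T y = T' y" if "x \<in> bergman_space" "y \<in> bergman_space" for x y
    unfolding T_def T'_def using adjoint_toeplitz[OF that(2)] that(1) by auto
  have "l2_inner (self_commutator T u) u = l2_inner (T' (T u)) u - l2_inner (T (T' u)) u"
    unfolding self_commutator_def adj(2)[OF u B(1)] adj(2)[OF u u] by (intro l2_inner_diff_left bergman_L2 B2 u)
  also have "l2_inner (T' (T u)) u = cnj (l2_inner (T u) (T u))"
    unfolding adj(1)[OF u B(1)] by (rule l2_inner_cnj)
  also have "l2_inner (T (T' u)) u = l2_inner (T' u) (T' u)" by (rule adj(1)[OF B(2) u])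
  finally show ?thesis by (simp add: l2_inner_self)
qed

section \<open>Nonnegativity of the self-commutator\<close>

text \<open>Completing the square with the pivot \<open>d k\<close> shows that the k-th term is at
  least \<open>W (k - r) - W k\<close>, with \<open>W\<close> read as 0 at negative indices. The
  delayed series has the same sum as \<open>W\<close>, so these lower bounds add up to 0.\<close>

lemma jacobi_form_nonneg:
  fixes d H C :: "nat \<Rightarrow> real" and U :: "nat \<Rightarrow> complex"
  assumes d: "\<And>k. 0 < d k"
    and H: "\<And>k. H k = d k + (if k < r then 0 else (C (k - r))\<^sup>2 / d (k - r))"
    and HU: "summable (\<lambda>k. H k * (cmod (U k))\<^sup>2)"
    and w: "cmod \<omega> \<le> 1"
    and s: "(\<lambda>k. H k * (cmod (U k))\<^sup>2 + 2 * C k * Re (\<omega> * U k * cnj (U (k + r)))) sums s"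
  shows "0 \<le> s"
proof -
  define W where "W k = (C k)\<^sup>2 / d k * (cmod (U (k + r)))\<^sup>2" for k
  have W0: "0 \<le> W k" for k unfolding W_def using d[of k] by simp
  have Wle: "W k \<le> H (k + r) * (cmod (U (k + r)))\<^sup>2" for k
    unfolding W_def by (rule mult_right_mono) (use H[of "k + r"] d[of "k + r"] in auto)
  have "summable W"
    by (rule summable_comparison_test'[OF summable_ignore_initial_segment[OF HU, of r], of 0])
      (simp only: real_norm_def abs_of_nonneg[OF W0] Wle)
  then have W: "W sums suminf W" by (rule summable_sums)
  have V: "(\<lambda>k. if r \<le> k then W (k - r) else 0) sums suminf W" by (rule sums_delay[OF W])
  have termwise: "(if r \<le> k then W (k - r) else 0) - W k \<le> H k * (cmod (U k))\<^sup>2 + 2 * C k * Re (\<omega> * U k * cnj (U (k + r)))" for k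
  proof -
    define x y where "x = cmod (U k)" and "y = cmod (U (k + r))"
    have "\<bar>Re (\<omega> * U k * cnj (U (k + r)))\<bar> \<le> cmod (\<omega> * U k * cnj (U (k + r)))" by (rule abs_Re_le_cmod)
    also have "\<dots> = cmod \<omega> * (x * y)" by (simp add: norm_mult x_def y_def)
    also have "\<dots> \<le> 1 * (x * y)" by (rule mult_right_mono[OF w]) (simp add: x_def y_def)
    finally have "\<bar>C k\<bar> * \<bar>Re (\<omega> * U k * cnj (U (k + r)))\<bar> \<le> \<bar>C k\<bar> * (x * y)"
      by (intro mult_left_mono) auto
    then have cross: "- (\<bar>C k\<bar> * (x * y)) \<le> C k * Re (\<omega> * U k * cnj (U (k + r)))"
      unfolding abs_mult[symmetric] by linarith
    have "0 \<le> (d k * x - \<bar>C k\<bar> * y)\<^sup>2 / d k" using d[of k] by simp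
    also have "\<dots> = d k * x\<^sup>2 - 2 * (\<bar>C k\<bar> * (x * y)) + (C k)\<^sup>2 / d k * y\<^sup>2"
      using d[of k] by (simp add: power2_diff power_mult_distrib add_divide_distrib diff_divide_distrib) (simp add: power2_eq_square)
    finally have amgm: "2 * (\<bar>C k\<bar> * (x * y)) \<le> d k * x\<^sup>2 + W k" by (simp add: W_def y_def)
    have split: "H k * x\<^sup>2 = d k * x\<^sup>2 + (if r \<le> k then W (k - r) else 0)"
      unfolding H[of k] by (simp add: W_def x_def distrib_right)
    show ?thesis using cross amgm split unfolding x_def[symmetric] mult.assoc by linarith
  qed
  have "(\<lambda>k. (if r \<le> k then W (k - r) else 0) - W k) sums (suminf W - suminf W)"
    by (rule sums_diff[OF V W])
  from sums_le[OF termwise this s] show ?thesis by simp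
qed

text \<open>Coefficient of \<open>(cmod (U k))^2\<close> in the norm difference, divided by
  \<open>pi\<close>, for one monomial and its conjugate.\<close>

definition diag_weight :: "nat \<Rightarrow> nat \<Rightarrow> nat \<Rightarrow> real" where
  "diag_weight m n k = (real m - real n + real k + 1) / (real m + real k + 1)\<^sup>2
    - (if m - n \<le> k then (real n - real m + real k + 1) / (real n + real k + 1)\<^sup>2 else 0)"

text \<open>The monomial moves \<open>U k\<close> to the index \<open>k + p\<close>, its conjugate
  to \<open>k - p\<close>; both series are shifted so that \<open>U k\<close> stands at
  \<open>k\<close>.\<close>

lemma diag_weight_sums:
  assumes "n < m" "summable (weight U)"
  shows "(\<lambda>k. diag_weight m n k * (cmod (U k))\<^sup>2) sums (suminf (mono_weight m n U) - suminf (mono_weight n m U))"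
proof -
  define p where "p = m - n"
  have m: "m = n + p" using assms(1) by (simp add: p_def)
  have s: "mono_weight m n U sums suminf (mono_weight m n U)" "mono_weight n m U sums suminf (mono_weight n m U)"
    by (intro summable_sums mono_weight_summable assms(2))+
  have "(\<lambda>k. mono_weight m n U (k + p)) sums suminf (mono_weight m n U)"
    by (rule sums_drop_zeros[OF s(1)]) (simp add: mono_weight_def mono_coeff_def m)
  then have "(\<lambda>k. mono_weight m n U (k + p) - (if p \<le> k then mono_weight n m U (k - p) else 0)) sums
      (suminf (mono_weight m n U) - suminf (mono_weight n m U))"
    by (rule sums_diff[OF _ sums_delay[OF s(2)]])
  also have "(\<lambda>k. mono_weight m n U (k + p) - (if p \<le> k then mono_weight n m U (k - p) else 0)) = (\<lambda>k. diag_weight m n k * (cmod (U k))\<^sup>2)"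
  proof
    fix k
    have "m \<le> n + (k + p)" "n + (k + p) - m = k" "real (k + p + 1) = real m - real n + real k + 1"
        "real (n + (k + p) + 1) = real m + real k + 1"
      by (simp_all add: m)
    then have "mono_weight m n U (k + p) = (real m - real n + real k + 1) / (real m + real k + 1)\<^sup>2 * (cmod (U k))\<^sup>2"
      unfolding mono_weight_eq by (simp only: if_True)
    moreover have "mono_weight n m U (k - p) = (real n - real m + real k + 1) / (real n + real k + 1)\<^sup>2 * (cmod (U k))\<^sup>2" if "p \<le> k"
    proof -
      have "n \<le> m + (k - p)" "m + (k - p) - n = k" "real (k - p + 1) = real n - real m + real k + 1"
          "real (m + (k - p) + 1) = real n + real k + 1"
        using that by (simp_all add: m of_nat_diff)
      then show ?thesis unfolding mono_weight_eq by (simp only: if_True)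
    qed
    ultimately show "mono_weight m n U (k + p) - (if p \<le> k then mono_weight n m U (k - p) else 0) = diag_weight m n k * (cmod (U k))\<^sup>2"
      unfolding diag_weight_def p_def[symmetric] by (simp add: left_diff_distrib)
  qed
  finally show ?thesis .
qed

section \<open>Interaction of the two monomials and assembly of the form\<close>

definition cross_term :: "complex \<Rightarrow> complex \<Rightarrow> nat \<Rightarrow> nat \<Rightarrow> nat \<Rightarrow> nat \<Rightarrow> (nat \<Rightarrow> complex) \<Rightarrow> nat \<Rightarrow> real" where
  "cross_term a b m n i j U l = 2 * real (l + 1) * Re (a * mono_coeff m n U l * cnj (b * mono_coeff i j U l))"

lemma weight_toeplitz_coeff_split:
  "weight (toeplitz_coeff a b m n i j U) l = (cmod a)\<^sup>2 * mono_weight m n U l + (cmod b)\<^sup>2 * mono_weight i j U l + cross_term a b m n i j U l"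
  unfolding weight_toeplitz_coeff cmod_add_sq cross_term_def mono_weight_def norm_mult power_mult_distrib
  by (simp only: distrib_left mult_ac)

lemma cross_term_sums:
  assumes "summable (weight U)"
  shows "cross_term a b m n i j U sums (suminf (weight (toeplitz_coeff a b m n i j U))
    - (cmod a)\<^sup>2 * suminf (mono_weight m n U) - (cmod b)\<^sup>2 * suminf (mono_weight i j U))"
proof -
  have "(\<lambda>l. weight (toeplitz_coeff a b m n i j U) l - (cmod a)\<^sup>2 * mono_weight m n U l - (cmod b)\<^sup>2 * mono_weight i j U l)
      sums (suminf (weight (toeplitz_coeff a b m n i j U))
    - (cmod a)\<^sup>2 * suminf (mono_weight m n U) - (cmod b)\<^sup>2 * suminf (mono_weight i j U))"
    by (intro sums_diff sums_mult summable_sums mono_weight_summable toeplitz_coeff_summable assms)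
  then show ?thesis unfolding weight_toeplitz_coeff_split by simp
qed

lemma Re_cross:
  "Re (a * (u / complex_of_real x) * cnj (b * (v / complex_of_real y))) = Re (a * cnj b * u * cnj v) / (x * y)"
proof -
  have "a * (u / complex_of_real x) * cnj (b * (v / complex_of_real y)) = a * cnj b * u * cnj v / complex_of_real (x * y)"
    by (simp add: mult_ac)
  then show ?thesis by (simp only: Re_divide_of_real)
qed

lemma Re_cross_cnj:
  "Re (cnj a * (v / complex_of_real x) * cnj (cnj b * (u / complex_of_real y))) = Re (a * cnj b * u * cnj v) / (x * y)"
proof -
  have "cnj a * cnj (cnj b) * v * cnj u = cnj (a * cnj b * u * cnj v)" by (simp add: mult_ac)
  then show ?thesis unfolding Re_cross by (simp only: cnj.sel)
qed

lemma cross_term_eq: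
  assumes "n + p = m" "j + q = i" "q + r = p"
  shows "cross_term a b m n i j U (k + p)
    = 2 * ((real p + real k + 1) / ((real m + real k + 1) * (real j + real p + real k + 1))) * Re (a * cnj b * U k * cnj (U (k + r)))"
proof -
  have S: "mono_coeff m n U (k + p) = U k / complex_of_real (real m + real k + 1)"
      "mono_coeff i j U (k + p) = U (k + r) / complex_of_real (real j + real p + real k + 1)"
    using assms by (auto simp: mono_coeff_def add_ac)
  have K: "real (k + p + 1) = real p + real k + 1" by simp
  show ?thesis unfolding cross_term_def S Re_cross K
    by (simp only: times_divide_eq_left times_divide_eq_right mult.assoc)
qed

lemma cross_term_adjoint_eq:
  assumes "n + p = m" "j + q = i" "q + r = p"
  shows "cross_term (cnj a) (cnj b) n m j i U l
    = 2 * ((real l + 1) / ((real m + real l + 1) * (real i + real l + 1))) * Re (a * cnj b * U (l + q) * cnj (U (l + q + r)))"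
proof -
  have S: "mono_coeff n m U l = U (l + q + r) / complex_of_real (real m + real l + 1)"
      "mono_coeff j i U l = U (l + q) / complex_of_real (real i + real l + 1)"
    using assms by (auto simp: mono_coeff_def add_ac)
  have K: "real (l + 1) = real l + 1" by simp
  show ?thesis unfolding cross_term_def S Re_cross_cnj K
    by (simp only: times_divide_eq_left times_divide_eq_right mult.assoc)
qed

text \<open>The product of \<open>U k\<close> and \<open>cnj (U (k + r))\<close> occurs at index
  \<open>k + p\<close> for the operator and at \<open>k - q\<close> for its adjoint, there only if
  \<open>k >= q\<close>. This is the origin of the two branches of \<open>coeff_C\<close>.\<close>

lemma coeff_C_cross_term:
  assumes m: "n + p = m" and i: "j + q = i" and r: "q + r = p"
  shows "cross_term a b m n i j U (k + p) - (if q \<le> k then cross_term (cnj a) (cnj b) n m j i U (k - q) else 0)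
    = 2 * coeff_C m n i j k * Re (a * cnj b * U k * cnj (U (k + r)))"
proof -
  let ?R = "Re (a * cnj b * U k * cnj (U (k + r)))"
  have e: "real p = real m - real n" "real j + (real m - real n) = real m - real n + real j"
    using m by auto
  have 1: "cross_term a b m n i j U (k + p)
      = 2 * ((real m - real n + real k + 1) / ((real m + real k + 1) * (real m - real n + real j + real k + 1))) * ?R"
    unfolding cross_term_eq[OF m i r] e ..
  have 2: "cross_term (cnj a) (cnj b) n m j i U (k - q)
      = 2 * ((real j - real i + real k + 1) / ((real j + real k + 1) * (real j - real i + real m + real k + 1))) * ?R"
    if "q \<le> k"
  proof -
    have e: "real (k - q) + 1 = real j - real i + real k + 1" "real m + real (k - q) + 1 = real j - real i + real m + real k + 1"
        "real i + real (k - q) + 1 = real j + real k + 1" "k - q + q = k"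
      using that i by auto
    show ?thesis unfolding cross_term_adjoint_eq[OF m i r] e by (simp only: mult.commute[of "real j + real k + 1"])
  qed
  have q: "i - j = q" using i by simp
  show ?thesis
  proof (cases "q \<le> k")
    case True
    then show ?thesis unfolding 1 2[OF True] coeff_C_def q by (simp only: if_True not_False_eq_True not_less[symmetric] if_False left_diff_distrib right_diff_distrib)
  next
    case False
    then show ?thesis unfolding 1 coeff_C_def q by simp
  qed
qed

text \<open>Division by \<open>cmod a * cmod b\<close> leaves a form that depends on the
  coefficients only through the ratio of their moduli and the unimodular \<omega>.\<close>

lemma toeplitz_weights_le:
  fixes n j q r :: nat and d :: "nat \<Rightarrow> real"
  assumes m: "n + p = m" and i: "j + q = i" and r: "q + r = p" and q: "0 < q"
    and ab: "a \<noteq> 0" "b \<noteq> 0" and U: "summable (weight U)"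
    and d: "\<And>k. 0 < d k"
      "\<And>k. cmod (a / b) * diag_weight m n k + cmod (b / a) * diag_weight i j k
        = d k + (if k < r then 0 else (coeff_C m n i j (k - r))\<^sup>2 / d (k - r))"
  shows "suminf (weight (toeplitz_coeff (cnj a) (cnj b) n m j i U)) \<le> suminf (weight (toeplitz_coeff a b m n i j U))"
proof -
  define S S' where "S = suminf (weight (toeplitz_coeff a b m n i j U))"
    and "S' = suminf (weight (toeplitz_coeff (cnj a) (cnj b) n m j i U))"
  define M1 M1' M2 M2' where "M1 = suminf (mono_weight m n U)" and "M1' = suminf (mono_weight n m U)"
    and "M2 = suminf (mono_weight i j U)" and "M2' = suminf (mono_weight j i U)"
  define A B where "A = cmod a" and "B = cmod b"
  have AB: "0 < A" "0 < B" using ab by (auto simp: A_def B_def)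
  have nm: "n < m" "j < i" using m i r q by auto
  define w where "w k = a * cnj b * U k * cnj (U (k + r))" for k
  have D1: "(\<lambda>k. diag_weight m n k * (cmod (U k))\<^sup>2) sums (M1 - M1')"
    and D2: "(\<lambda>k. diag_weight i j k * (cmod (U k))\<^sup>2) sums (M2 - M2')"
    unfolding M1_def M1'_def M2_def M2'_def by (intro diag_weight_sums nm U)+
  have c1: "cross_term a b m n i j U sums (S - A\<^sup>2 * M1 - B\<^sup>2 * M2)"
    and c2: "cross_term (cnj a) (cnj b) n m j i U sums (S' - A\<^sup>2 * M1' - B\<^sup>2 * M2')"
    using cross_term_sums[OF U, of a b m n i j] cross_term_sums[OF U, of "cnj a" "cnj b" n m j i]
    unfolding S_def S'_def M1_def M1'_def M2_def M2'_def A_def B_def complex_mod_cnj .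
  have "(\<lambda>k. cross_term a b m n i j U (k + p)) sums (S - A\<^sup>2 * M1 - B\<^sup>2 * M2)"
  proof (rule sums_drop_zeros[OF c1])
    fix l assume "l < p"
    then have "mono_coeff m n U l = 0" using m by (simp add: mono_coeff_def)
    then show "cross_term a b m n i j U l = 0" by (simp add: cross_term_def)
  qed
  from sums_diff[OF this sums_delay[OF c2, of q]]
  have X: "(\<lambda>k. 2 * coeff_C m n i j k * Re (w k)) sums ((S - A\<^sup>2 * M1 - B\<^sup>2 * M2) - (S' - A\<^sup>2 * M1' - B\<^sup>2 * M2'))"
    unfolding coeff_C_cross_term[OF m i r] w_def .
  define H where "H k = A / B * diag_weight m n k + B / A * diag_weight i j k" for k
  have Hs: "(\<lambda>k. H k * (cmod (U k))\<^sup>2) sums (A / B * (M1 - M1') + B / A * (M2 - M2'))"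
    unfolding H_def distrib_right mult.assoc by (intro sums_add sums_mult D1 D2)
  define \<omega> where "\<omega> = a * cnj b / complex_of_real (A * B)"
  have Rw: "Re (\<omega> * U k * cnj (U (k + r))) = 1 / (A * B) * Re (w k)" for k
  proof -
    have "\<omega> * U k * cnj (U (k + r)) = w k / complex_of_real (A * B)" by (simp add: \<omega>_def w_def)
    then show ?thesis by (simp only: Re_divide_of_real) simp
  qed
  let ?s = "A / B * (M1 - M1') + B / A * (M2 - M2') + 1 / (A * B) * ((S - A\<^sup>2 * M1 - B\<^sup>2 * M2) - (S' - A\<^sup>2 * M1' - B\<^sup>2 * M2'))"
  have "(\<lambda>k. H k * (cmod (U k))\<^sup>2 + 1 / (A * B) * (2 * coeff_C m n i j k * Re (w k))) sums ?s"
    by (intro sums_add sums_mult Hs X)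
  then have Z: "(\<lambda>k. H k * (cmod (U k))\<^sup>2 + 2 * coeff_C m n i j k * Re (\<omega> * U k * cnj (U (k + r)))) sums ?s"
    unfolding Rw by (simp only: mult.left_commute)
  have "0 \<le> ?s"
  proof (rule jacobi_form_nonneg[OF d(1) _ _ _ Z])
    show "H k = d k + (if k < r then 0 else (coeff_C m n i j (k - r))\<^sup>2 / d (k - r))" for k
      unfolding d(2)[symmetric] H_def A_def B_def by (simp add: norm_divide)
    show "summable (\<lambda>k. H k * (cmod (U k))\<^sup>2)" by (rule sums_summable[OF Hs])
    show "cmod \<omega> \<le> 1" using AB by (simp add: \<omega>_def norm_mult norm_divide A_def B_def)
  qed
  also have "?s = (S - S') / (A * B)"
    using AB by (simp add: field_simps power2_eq_square)
  finally have "0 \<le> S - S'" using AB by (simp add: zero_le_divide_iff) (use mult_pos_pos[OF AB] in auto)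
  then show ?thesis by (simp add: S_def S'_def)
qed

lemma pivots_exist:
  fixes n j q r m i :: nat and t :: real
  defines "m \<equiv> n + (q + r)" and "i \<equiv> j + q"
  assumes q: "0 < q" and r: "0 < r" and t: "0 < t"
    and low: "\<And>k. k < q + r \<Longrightarrow> coeff_C m n i j k \<le> t * diag_weight m n k + diag_weight i j k / t"
    and high: "\<And>k. q + r + q \<le> k \<Longrightarrow> coeff_C m n i j k + coeff_D m n i j k \<le> t * diag_weight m n k + diag_weight i j k / t"
  shows "\<exists>d. (\<forall>k. 0 < d k) \<and> (\<forall>k. t * diag_weight m n k + diag_weight i j k / t
      = d k + (if k < r then 0 else (coeff_C m n i j (k - r))\<^sup>2 / d (k - r)))"
proof -
  interpret P: monomial_pair "real n" "real j" "real q" "real r" t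
    by unfold_locales (use q r t in auto)
  have qr: "m - n = q + r" "i - j = q" by (auto simp: m_def i_def)
  have C: "coeff_C m n i j k = (if k < q then P.al (real k + 1) else P.Ce (real k + 1))" for k
  proof -
    have "P.al (real k + 1) = (real m - real n + real k + 1) / ((real m + real k + 1) * (real m - real n + real j + real k + 1))"
      unfolding P.al_def P.p_def P.m_def P.s_def m_def by (simp add: algebra_simps)
    moreover have "P.be (real k + 1) = (real j - real i + real k + 1) / ((real j + real k + 1) * (real j - real i + real m + real k + 1))"
      unfolding P.be_def m_def i_def by (simp add: algebra_simps)
    ultimately show ?thesis unfolding coeff_C_def qr using P.Ce_eq[of "real k + 1"] by simp
  qed
  \<comment> \<open>D_k is the second branch of C, continued to the index k - (p + q) even where
    that index is below q.\<close>
  have D: "coeff_D m n i j k = P.Ce (real k + 1 - real (q + r + q))" if "q + r + q \<le> k" for k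
  proof -
    define y where "y = real k + 1 - real (q + r + q)"
    have y: "0 < y" using that by (simp add: y_def)
    have "P.al y = (real j - real i + real k + 1) / ((real j - real i + real n + real k + 1) * (2 * real j - real i + real k + 1))"
      unfolding P.al_def P.p_def P.m_def P.s_def y_def i_def by (simp add: algebra_simps)
    moreover have "P.be y = (2 * real j - 2 * real i + real n - real m + real k + 1) /
       ((2 * real j - real i + real n - real m + real k + 1) * (2 * real j - 2 * real i + real n + real k + 1))"
      unfolding P.be_def y_def m_def i_def by (simp add: algebra_simps)
    ultimately show ?thesis unfolding coeff_D_def y_def[symmetric] using P.Ce_eq[OF y] by simp
  qed
  have H: "t * diag_weight m n k + diag_weight i j k / t
      = P.Ap (real k + 1) + P.Bp (real k + 1) - (if q \<le> k then P.Bm (real k + 1) else 0)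
        - (if q + r \<le> k then P.Am (real k + 1) else 0)" for k
  proof -
    have "P.Ap (real k + 1) = t * ((real m - real n + real k + 1) / (real m + real k + 1)\<^sup>2)"
      unfolding P.Ap_def P.p_def P.m_def m_def by (simp add: algebra_simps)
    moreover have "P.Bp (real k + 1) = (real i - real j + real k + 1) / (real i + real k + 1)\<^sup>2 / t"
      unfolding P.Bp_def P.i_def i_def by (simp add: algebra_simps)
    moreover have "P.Am (real k + 1) = t * ((real n - real m + real k + 1) / (real n + real k + 1)\<^sup>2)"
      unfolding P.Am_def P.p_def m_def by (simp add: algebra_simps)
    moreover have "P.Bm (real k + 1) = (real j - real i + real k + 1) / (real j + real k + 1)\<^sup>2 / t"
      unfolding P.Bm_def i_def by (simp add: algebra_simps)
    ultimately show ?thesis unfolding diag_weight_def qr by (simp add: right_diff_distrib diff_divide_distrib)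
  qed
  interpret J: pivots n j q r t
    "\<lambda>k. P.Ap (real k + 1) + P.Bp (real k + 1) - (if q \<le> k then P.Bm (real k + 1) else 0)
        - (if q + r \<le> k then P.Am (real k + 1) else 0)"
    "\<lambda>k. if k < q then P.al (real k + 1) else P.Ce (real k + 1)"
  proof (unfold_locales, unfold H[symmetric] C[symmetric])
    show "coeff_C m n i j k \<le> t * diag_weight m n k + diag_weight i j k / t" if "k < q" for k
      by (rule low) (use that in simp)
    show "coeff_C m n i j k \<le> t * diag_weight m n k + diag_weight i j k / t" if "k < q + r" for k
      by (rule low[OF that])
    show "coeff_C m n i j k + P.Ce (real k + 1 - real (q + r + q)) \<le> t * diag_weight m n k + diag_weight i j k / t" if "q + r + q \<le> k" for k
      using high[OF that] unfolding D[OF that] .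
  qed
  show ?thesis unfolding H C by (rule J.jacobi_factorization)
qed

theorem theorem3:
  fixes m n i j :: nat and a b :: complex and f g :: "complex \<Rightarrow> complex"
  assumes "n < m" and "j < i" and "i - j < m - n"
    and "a \<noteq> 0" and "b \<noteq> 0"
    and "f = (\<lambda>z. a * z ^ m * cnj z ^ n)"
    and "g = (\<lambda>z. b * z ^ i * cnj z ^ j)"
    and "\<And>k::nat. k < i - j \<Longrightarrow>
      cmod (a / b) * ((real m + real k - real n + 1) / (real m + real k + 1)\<^sup>2)
      + cmod (b / a) * ((real i + real k - real j + 1) / (real i + real k + 1)\<^sup>2)
      \<ge> coeff_C m n i j k"
    and "\<And>k::nat. i - j \<le> k \<Longrightarrow> k < m - n \<Longrightarrow>
      cmod (a / b) * ((real m + real k - real n + 1) / (real m + real k + 1)\<^sup>2)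
      + cmod (b / a) * ((real i + real k - real j + 1) / (real i + real k + 1)\<^sup>2
                      - (real j + real k - real i + 1) / (real j + real k + 1)\<^sup>2)
      \<ge> coeff_C m n i j k"
    and "\<And>k::nat. m - n \<le> k \<Longrightarrow> k < (m - n) + (i - j) \<Longrightarrow>
      cmod (a / b) * ((real m + real k - real n + 1) / (real m + real k + 1)\<^sup>2
                    - (real n + real k - real m + 1) / (real n + real k + 1)\<^sup>2)
      + cmod (b / a) * ((real i + real k - real j + 1) / (real i + real k + 1)\<^sup>2
                      - (real j + real k - real i + 1) / (real j + real k + 1)\<^sup>2)
      \<ge> coeff_C m n i j k"
    and "\<And>k::nat. (m - n) + (i - j) \<le> k \<Longrightarrow>
      cmod (a / b) * ((real m + real k - real n + 1) / (real m + real k + 1)\<^sup>2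
                    - (real n + real k - real m + 1) / (real n + real k + 1)\<^sup>2)
      + cmod (b / a) * ((real i + real k - real j + 1) / (real i + real k + 1)\<^sup>2
                      - (real j + real k - real i + 1) / (real j + real k + 1)\<^sup>2)
      \<ge> coeff_C m n i j k + coeff_D m n i j k"
  shows "hyponormal (toeplitz (\<lambda>z. f z + g z))"
proof -
  define q where "q = i - j"
  define r where "r = (m - n) - (i - j)"
  define t where "t = cmod (a / b)"
  have q: "0 < q" and r: "0 < r" and i: "i = j + q" and m: "m = n + (q + r)"
    using assms(1-3) by (auto simp: q_def r_def)
  have t: "0 < t" using assms(4,5) by (simp add: t_def)
  have inv: "cmod (b / a) = 1 / t" by (simp add: t_def norm_divide)
  have diag: "diag_weight m n k = (real m + real k - real n + 1) / (real m + real k + 1)\<^sup>2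
      - (if m - n \<le> k then (real n + real k - real m + 1) / (real n + real k + 1)\<^sup>2 else 0)" for m n k
    unfolding diag_weight_def by (simp add: algebra_simps)
  have low: "coeff_C m n i j k \<le> t * diag_weight m n k + diag_weight i j k / t" if k: "k < q + r" for k
  proof (cases "k < i - j")
    case True
    then have "\<not> m - n \<le> k" "\<not> i - j \<le> k" using k by (auto simp: m)
    then show ?thesis using assms(8)[OF True] unfolding diag inv t_def[symmetric] by (simp add: mult.commute)
  next
    case False
    then have *: "i - j \<le> k" "\<not> m - n \<le> k" "k < m - n" using k by (auto simp: m)
    then show ?thesis using assms(9)[OF *(1,3)] unfolding diag inv t_def[symmetric] by (simp add: mult.commute)
  qed
  have high: "coeff_C m n i j k + coeff_D m n i j k \<le> t * diag_weight m n k + diag_weight i j k / t" if k: "q + r + q \<le> k" for k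
  proof -
    have *: "i - j \<le> k" "m - n \<le> k" "(m - n) + (i - j) \<le> k" using k by (auto simp: m i)
    then show ?thesis using assms(11)[OF *(3)] unfolding diag inv t_def[symmetric] by (simp add: mult.commute)
  qed
  obtain d where d: "\<And>k. 0 < d k"
      "\<And>k. t * diag_weight m n k + diag_weight i j k / t = d k + (if k < r then 0 else (coeff_C m n i j (k - r))\<^sup>2 / d (k - r))"
    using pivots_exist[of q r t n j] q r t low high unfolding m[symmetric] i[symmetric] by auto
  have sym: "(\<lambda>z. f z + g z) = binomial_symbol a b m n i j"
    by (auto simp: assms(6,7) binomial_symbol_def)
  have le: "(l2_norm (toeplitz (binomial_symbol (cnj a) (cnj b) n m j i) u))\<^sup>2 \<le> (l2_norm (toeplitz (binomial_symbol a b m n i j) u))\<^sup>2"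
    if u: "u \<in> bergman_space" for u
  proof -
    obtain U where U: "has_coeffs u U" using bergman_has_coeffs[OF u] .
    note s = bergman_weight_summable[OF u U]
    have "suminf (weight (toeplitz_coeff (cnj a) (cnj b) n m j i U)) \<le> suminf (weight (toeplitz_coeff a b m n i j U))"
    proof (rule toeplitz_weights_le[OF m[symmetric] i[symmetric] refl q assms(4,5) s d(1)])
      show "cmod (a / b) * diag_weight m n k + cmod (b / a) * diag_weight i j k = d k + (if k < r then 0 else (coeff_C m n i j (k - r))\<^sup>2 / d (k - r))" for k
        unfolding inv t_def[symmetric] d(2)[symmetric] by simp
    qed
    then have "pi * suminf (weight (toeplitz_coeff (cnj a) (cnj b) n m j i U)) \<le> pi * suminf (weight (toeplitz_coeff a b m n i j U))"
      by (rule mult_left_mono) simp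
    then show ?thesis
      using sums_unique[OF toeplitz_norm_sums[OF u U, of a b m n i j]] sums_unique[OF toeplitz_norm_sums[OF u U, of "cnj a" "cnj b" n m j i]]
        suminf_mult[OF toeplitz_coeff_summable(1)[OF s]] by simp
  qed
  show ?thesis
    unfolding hyponormal_def sym
  proof (intro conjI ballI bounded_toeplitz)
    fix u assume u: "u \<in> bergman_space"
    show "l2_inner (self_commutator (toeplitz (binomial_symbol a b m n i j)) u) u \<in> \<real>\<^sub>\<ge>\<^sub>0"
      unfolding self_commutator_inner[OF u] nonneg_Reals_of_real_iff using le[OF u] by simp
  qed
qed

end
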